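(* Let $(g,\mathbf{v})$ be an admissible pair with $v_1=1$, with measure $\mu_{g;\mathbf{v}}$ and limit shape $\omega_{\Lambda_{g;\mathbf{v}}}$. The support of $\mu_{g;\mathbf{v}}$ is discrete and coincides with the set of local minima of $\omega_{\Lambda_{g;\mathbf{v}}}(x)$. Moreover, if $g>0$ then $\mathrm{supp}(\mu_{g;\mathbf{v}})\subseteq[-g^{-1},+\infty)$, whereas if $g<0$ then $\mathrm{supp}(\mu_{g;\mathbf{v}})\subseteq(-\infty,-g^{-1}]$. Finally, the distance between two consecutive points of $\mathrm{supp}(\mu_{g;\mathbf{v}})$ is at least $|g|$.
   Context: Admissible pairs. $\mathrm{Sym}=\mathbb{R}[p_1,p_2,\dots]$; $J^{(\alpha)}_\lambda$ is the integral form Jack symmetric function (Macdonald, Ch. VI.10; coefficient of $p_1^{|\lambda|}$ equal to $1$). A sequence $\mathbf{v}$ determines a totally Jack-positive specialization if the algebra homomorphism $p_k\mapsto v_k$ takes nonnegative values on $J^{(\alpha)}_\lambda$ for all partitions $\lambda$ and all $\alpha>0$. $(g,\mathbf{v})\in\mathbb{R}\times\mathbb{R}^\infty$ is admissible if either $g>0$ and $\mathbf{v}$ determines a totally Jack-positive specialization, or $g<0$ and $((-1)^{j-1}v_j)_{j\ge1}$ does. Łukasiewicz paths. $\mathbf{L}_0(\ell)$ is the set of sequences $\Gamma=(w_0,\dots,w_\ell)$, $w_j=(j,y_j)$, $y_j\in\mathbb{Z}_{\ge0}$, $y_0=y_\ell=0$, $y_j-y_{j-1}\ge-1$, with no $j\ge1$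 such that $y_j=y_{j-1}=0$. $\mathbf{S}^i_\rightarrow(\Gamma)=\{w_j:j\ge1,y_j=y_{j-1}=i\}$, $\mathbf{S}_i(\Gamma)=\{w_j:j\ge1,y_j-y_{j-1}=i\}$ for $i\ge1$. Measure and limit shape. For an admissible pair with $v_1=1$, $\mu_{g;\mathbf{v}}$ is the (existing and unique) probability measure on $\mathbb{R}$ with moments $\int x^\ell\mu_{g;\mathbf{v}}(dx)=\sum_{\Gamma\in\mathbf{L}_0(\ell)}\prod_{i\ge1}(ig)^{|\mathbf{S}^i_\rightarrow(\Gamma)|}v_i^{|\mathbf{S}_i(\Gamma)|}$, $\ell\ge1$. The limit shape $\omega_{\Lambda_{g;\mathbf{v}}}$ is the $1$-Lipschitz function $\omega\colon\mathbb{R}\to\mathbb{R}_{\ge0}$ with $\omega(x)\ge|x|$, $\int\frac{\omega(x)-|x|}2dx=1$, associated with $\mu_{g;\mathbf{v}}$ by the Markov--Krein correspondence: $\int\frac{\mu_{g;\mathbf{v}}(dx)}{z-x}=\frac1z\exp\int\frac1{x-z}\big(\frac{\omega(x)-|x|}2\big)'dx$ for $\Im z>0$. It is the sup-norm limit in probability of profiles of rescaled random Young diagrams: of $T_{\sqrt{\alpha/d},1/\sqrt{\alpha d}}\lambda$ (each box of $\lambda$ rescaled to width $\sqrt{\alpha/d}$, height $1/\sqrt{\alpha d}$; profile = boundary in coordinates $(x-y,x+y)$), where $\alpha=g^2d$ if $g>0$, $\alpha=1/(g^2d)$ if $g<0$, and $\lambda\in\mathbb{Y}_d$ is distributed by the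 measure $\mathbb{P}$ with $\big(\tfrac{g^2d}{\lceil|g|d\rceil^2}\big)^{\|\mu\|/2}\prod_iv_{\mu_i}=\sum_{\lambda\in\mathbb{Y}_d}\mathbb{P}(\lambda)\chi^{(\alpha)}_\lambda(\mu)$ for all $\mu\in\mathbb{Y}_d$; here $\|\mu\|=|\mu|-\ell(\mu)$, $\chi^{(\alpha)}_\lambda(\mu)=\alpha^{-\|\mu\|/2}\frac{z_\mu}{d!}[p_\mu]J^{(\alpha)}_\lambda$, $z_\mu=\prod_i i^{m_i(\mu)}m_i(\mu)!$. *)

theory Defs
  imports "HOL-Probability.Probability" "HOL-Library.Multiset" "HOL-Library.Poly_Mapping"
begin

section \<open>Partitions\<close>

text \<open>A partition is the multiset of its (positive) parts.\<close>

definition partitions :: "nat \<Rightarrow> nat multiset set" where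
  "partitions n = {\<mu>. 0 \<notin># \<mu> \<and> sum_mset \<mu> = n}"

definition largest_parts_sum :: "nat \<Rightarrow> nat multiset \<Rightarrow> nat" where
  "largest_parts_sum k \<mu> = sum_list (take k (rev (sorted_list_of_multiset \<mu>)))"

text \<open>The set of all partitions \<open>\<nu> \<le> \<kappa>\<close> in the dominance order (including \<open>\<kappa>\<close> itself).\<close>

definition dominated_by :: "nat multiset \<Rightarrow> nat multiset set" where
  "dominated_by \<kappa> = {\<nu> \<in> partitions (sum_mset \<kappa>).
     \<forall>k. largest_parts_sum k \<nu> \<le> largest_parts_sum k \<kappa>}"

definition z_coeff :: "nat multiset \<Rightarrow> real" where
  "z_coeff \<mu> = (\<Prod>i\<in>set_mset \<mu>. real i ^ count \<mu> i * fact (count \<mu> i))"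


section \<open>Symmetric functions\<close>

text \<open>
  The ring \<open>Sym = \<real>[p\<^sub>1, p\<^sub>2, \<dots>]\<close> is the monoid algebra over multisets of positive integers:
  \<open>Poly_Mapping.single \<mu> 1\<close> is \<open>p\<^sub>\<mu>\<close>, the product of the \<open>p\<^sub>k\<close> with \<open>k \<in># \<mu>\<close>, and
  \<open>lookup f \<mu>\<close> is the coefficient \<open>[p\<^sub>\<mu>] f\<close>. The type also has a variable \<open>p\<^sub>0\<close>; it does not occur
  in the elements of \<open>Sym_deg n\<close>.
\<close>

type_synonym symfun = "nat multiset \<Rightarrow>\<^sub>0 real"

definition Sym_deg :: "nat \<Rightarrow> symfun set" where
  "Sym_deg n = {f. Poly_Mapping.keys f \<subseteq> partitions n}"

text \<open>The value at \<open>f\<close> of the algebra homomorphism to \<open>\<real>\<close> sending \<open>p\<^sub>k\<close> to \<open>v k\<close>.\<close>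

definition specialize :: "(nat \<Rightarrow> real) \<Rightarrow> symfun \<Rightarrow> real" where
  "specialize v f = (\<Sum>\<mu>\<in>Poly_Mapping.keys f. Poly_Mapping.lookup f \<mu> * (\<Prod>k\<in>#\<mu>. v k))"

definition power_sum :: "nat \<Rightarrow> (nat \<Rightarrow> real) \<Rightarrow> nat \<Rightarrow> real" where
  "power_sum N x k = (\<Sum>i<N. x i ^ k)"

text \<open>
  The monomial symmetric function \<open>m\<^sub>\<nu>(x\<^sub>0, \<dots>, x\<^bsub>N-1\<^esub>)\<close>: the sum of all distinct monomials
  whose multiset of nonzero exponents is \<open>\<nu>\<close>.
\<close>

definition monomial_sf :: "nat multiset \<Rightarrow> nat \<Rightarrow> (nat \<Rightarrow> real) \<Rightarrow> real" where
  "monomial_sf \<nu> N x =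
     (\<Sum>\<beta> | (\<forall>i\<ge>N. \<beta> i = 0) \<and> filter_mset (\<lambda>b. b \<noteq> 0) (image_mset \<beta> (mset_set {..<N})) = \<nu>.
        \<Prod>i<N. x i ^ \<beta> i)"

text \<open>
  \<open>f\<close> lies in the linear span of the \<open>m\<^sub>\<nu>\<close> with \<open>\<nu> \<in> S\<close>, the equality
  of symmetric functions being expressed through their values in finitely many real variables.
\<close>

definition in_monomial_span :: "nat multiset set \<Rightarrow> symfun \<Rightarrow> bool" where
  "in_monomial_span S f \<longleftrightarrow>
     (\<exists>c. \<forall>N x. specialize (power_sum N x) f = (\<Sum>\<nu>\<in>S. c \<nu> * monomial_sf \<nu> N x))"

text \<open>The scalar product with \<open>\<langle>p\<^sub>\<kappa>, p\<^sub>\<mu>\<rangle> = \<delta>\<^bsub>\<kappa>\<mu>\<^esub> \<alpha>\<^bsup>\<ell>(\<kappa>)\<^esup> z\<^sub>\<kappa>\<close>.\<close>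

definition jack_inner :: "real \<Rightarrow> symfun \<Rightarrow> symfun \<Rightarrow> real" where
  "jack_inner \<alpha> f h = (\<Sum>\<mu>\<in>Poly_Mapping.keys f.
     Poly_Mapping.lookup f \<mu> * Poly_Mapping.lookup h \<mu> * \<alpha> ^ size \<mu> * z_coeff \<mu>)"


section \<open>Jack symmetric functions and admissible pairs\<close>

text \<open>
  \<open>J\<close> is the family of integral form Jack symmetric functions of parameter \<open>\<alpha>\<close>: unitriangularity
  and orthogonality determine the monic functions \<open>P\<^sub>\<kappa>\<close> (Macdonald, VI.10), and \<open>J\<^sub>\<kappa>\<close> is the
  multiple of \<open>P\<^sub>\<kappa>\<close> normalized by \<open>[p\<^sub>1\<^bsup>|\<kappa>|\<^esup>] J\<^sub>\<kappa> = 1\<close>. For \<open>\<alpha> > 0\<close> such a family exists and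
  \<open>J \<kappa>\<close> is uniquely determined for every partition \<open>\<kappa>\<close>: since the \<open>J\<^sub>\<kappa>\<close> are nonzero and
  orthogonal, hence linearly independent, their leading coefficients cannot vanish.
\<close>

definition jack_family :: "real \<Rightarrow> (nat multiset \<Rightarrow> symfun) \<Rightarrow> bool" where
  "jack_family \<alpha> J \<longleftrightarrow>
     (\<forall>n. \<forall>\<kappa>\<in>partitions n.
        J \<kappa> \<in> Sym_deg n \<and>
        in_monomial_span (dominated_by \<kappa>) (J \<kappa>) \<and>
        Poly_Mapping.lookup (J \<kappa>) (replicate_mset n 1) = 1) \<and>
     (\<forall>m n. \<forall>\<kappa>\<in>partitions m. \<forall>\<mu>\<in>partitions n. \<kappa> \<noteq> \<mu> \<longrightarrow> jack_inner \<alpha> (J \<kappa>) (J \<mu>) = 0)"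

text \<open>Sequences \<open>v\<close> are indexed by \<open>k \<ge> 1\<close>; the value \<open>v 0\<close> is never used.\<close>

definition totally_jack_positive :: "(nat \<Rightarrow> real) \<Rightarrow> bool" where
  "totally_jack_positive v \<longleftrightarrow>
     (\<forall>\<alpha>>0. \<exists>J. jack_family \<alpha> J \<and> (\<forall>n. \<forall>\<kappa>\<in>partitions n. specialize v (J \<kappa>) \<ge> 0))"

definition admissible :: "real \<Rightarrow> (nat \<Rightarrow> real) \<Rightarrow> bool" where
  "admissible g v \<longleftrightarrow>
     (g > 0 \<and> totally_jack_positive v) \<or>
     (g < 0 \<and> totally_jack_positive (\<lambda>j. (-1) ^ (j - 1) * v j))"


section \<open>Lukasiewicz paths and the measure\<close>

text \<open>A path is the list \<open>[y\<^sub>0, \<dots>, y\<^sub>l]\<close> of its heights; its point \<open>w\<^sub>j = (j, y\<^sub>j)\<close> is represented by \<open>j\<close>.\<close>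

definition luk_paths :: "nat \<Rightarrow> nat list set" where
  "luk_paths l = {y. length y = l + 1 \<and> y ! 0 = 0 \<and> y ! l = 0 \<and>
     (\<forall>j\<in>{1..l}. int (y ! j) - int (y ! (j - 1)) \<ge> -1) \<and>
     \<not> (\<exists>j\<in>{1..l}. y ! j = 0 \<and> y ! (j - 1) = 0)}"

definition horizontal_steps :: "nat \<Rightarrow> nat list \<Rightarrow> nat set" where
  "horizontal_steps i y = {j. 1 \<le> j \<and> j < length y \<and> y ! j = i \<and> y ! (j - 1) = i}"

definition up_steps :: "nat \<Rightarrow> nat list \<Rightarrow> nat set" where
  "up_steps i y = {j. 1 \<le> j \<and> j < length y \<and> int (y ! j) - int (y ! (j - 1)) = int i}"

text \<open>
  The product over all \<open>i \<ge> 1\<close> may be restricted to \<open>i \<le> l\<close>: since every step goes down by at most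
  one and the path ends at height 0, all its heights are at most \<open>l\<close>.
\<close>

definition path_moment :: "real \<Rightarrow> (nat \<Rightarrow> real) \<Rightarrow> nat \<Rightarrow> real" where
  "path_moment g v l = (\<Sum>y\<in>luk_paths l. \<Prod>i=1..l.
     (real i * g) ^ card (horizontal_steps i y) * v i ^ card (up_steps i y))"

definition is_mu :: "real \<Rightarrow> (nat \<Rightarrow> real) \<Rightarrow> real measure \<Rightarrow> bool" where
  "is_mu g v M \<longleftrightarrow> real_distribution M \<and>
     (\<forall>l\<ge>1. has_bochner_integral M (\<lambda>x. x ^ l) (path_moment g v l))"

definition measure_support :: "real measure \<Rightarrow> real set" where
  "measure_support M = {x. \<forall>U. open U \<and> x \<in> U \<longrightarrow> emeasure M U > 0}"


section \<open>The limit shape\<close>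

text \<open>
  A 1-Lipschitz function is differentiable almost everywhere, so the junk values of \<open>deriv\<close>
  are irrelevant. Under the other conditions the derivative is at most 0 on the positive and
  at least 0 on the negative half-line, so the integral in the exponent converges absolutely.
\<close>

definition is_limit_shape :: "real measure \<Rightarrow> (real \<Rightarrow> real) \<Rightarrow> bool" where
  "is_limit_shape M \<omega> \<longleftrightarrow>
     1-lipschitz_on UNIV \<omega> \<and>
     (\<forall>x. \<omega> x \<ge> \<bar>x\<bar>) \<and>
     has_bochner_integral lborel (\<lambda>x. (\<omega> x - \<bar>x\<bar>) / 2) 1 \<and>
     (\<forall>z. Im z > 0 \<longrightarrow>
        (\<integral>x. 1 / (z - complex_of_real x) \<partial>M) =
        1 / z * exp (\<integral>x. 1 / (complex_of_real x - z) *
                         complex_of_real (deriv (\<lambda>t. (\<omega> t - \<bar>t\<bar>) / 2) x) \<partial>lebesgue))"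

definition local_minima :: "(real \<Rightarrow> real) \<Rightarrow> real set" where
  "local_minima f = {x. \<forall>\<^sub>F y in nhds x. f x \<le> f y}"

end

theory Submission
  imports Defs "HOL-Complex_Analysis.Complex_Analysis" "HOL-Real_Asymp.Real_Asymp"
begin

text \<open>
  As \<open>\<alpha> \<rightarrow> \<infinity>\<close> the Jack functions indexed by \<open>(n)\<close> and \<open>(n-1,1)\<close> degenerate, up to
  positive factors, to the monomial functions \<open>p\<^sub>n\<close> and \<open>p\<^bsub>n-1\<^esub> p\<^sub>1 - p\<^sub>n\<close>; so \<open>v\<close> is nonnegative
  and decreasing. By reflection one may take \<open>g > 0\<close>. With \<open>\<Sum> e\<^sub>m z\<^sup>m = exp (\<Sum> v\<^sub>k z\<^sup>k / (k g))\<close> and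
  \<open>F\<^sub>m u = u (u - g) \<dots> (u - (m-1) g)\<close>, the path expansion of the moments says that all polynomials
  \<open>T\<^sub>j = F\<^bsub>j+1\<^esub> (\<Sum>m\<le>j. e\<^sub>m / F\<^sub>m)\<close> integrate to \<open>0\<close>. To the left of \<open>-1/g\<close> they have constant sign and
  outgrow their values elsewhere, so there is no mass there. The Stieltjes transform \<open>G\<close> then satisfies
  \<open>X u = - g (G u) X (u + g)\<close> for an entire function \<open>X\<close> without zeros far to the left, so it is
  meromorphic and the support is discrete. Zeros and poles of \<open>G\<close> interlace on the line; counting
  orders of vanishing of \<open>X\<close> along steps of length \<open>g\<close>, a half-open window of length \<open>g\<close> contains at
  most one zero of \<open>X\<close>, and every pole is a zero of \<open>X\<close> shifted by \<open>-g\<close>. Finally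
  \<open>(1 - \<omega>')/2\<close> is a density with Poisson integral \<open>- arg G\<close> (kernel \<open>y / ((x - u)\<^sup>2 + y\<^sup>2)\<close>), so \<open>\<omega>\<close> has slope \<open>1\<close> where
  \<open>G > 0\<close> and \<open>-1\<close> where \<open>G < 0\<close>, and its local minima are the poles.
\<close>

section \<open>Dominance order and orthogonal expansions\<close>

text \<open>Two exponential rates have to match. To the right \<open>T j\<close> exceeds its scale
  at \<open>- (1 / g)\<close> by at most exp (4 x / (5 g)), coming from 2 powr (x / g) and ln 2 <
  7/10; the path recursion yields exponential moments below the rate 10 / (11 g). Since 4/5 < 10/11
  the polynomials can be integrated uniformly in j, and this slack fixes the numerical constants.
  The window count: the zeros of \<open>X\<close> in (w, w + g] are those up to w + g minus those up
  to w. With multiplicity this is the sum over t \<le> w of the change of order from t to t + g, at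
  most the number of poles minus the number of zeros of the transform up to w, hence at most 1 by
  interlacing. The sums are finite because \<open>X\<close> has no zeros far to the left. Boundary
  values are handled by one device. The Poisson kernel is at least 1 / (2 y) on a window of radius
  y, so Poisson integrals dominate symmetric difference quotients, and a monotone function whose
  symmetric derivative vanishes on an interval is constant there. It serves the distribution
  function of \<open>M\<close> and the slopes of \<omega> alike.\<close>

lemma finite_partitions: "finite (partitions n)"
proof -
  have "partitions n \<subseteq> (\<Union>k\<le>n. {\<mu>. set_mset \<mu> \<subseteq> {..n} \<and> size \<mu> = k})"
  proof
    fix \<mu> assume m: "\<mu> \<in> partitions n"
    have "x \<le> n" if "x \<in># \<mu>" for x
      using m that by (auto simp: partitions_def dest!: multi_member_split)
    moreover have "size \<mu> \<le> sum_mset \<mu>" if "0 \<notin># \<mu>" for \<mu> :: "nat multiset"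
      using that by (induction \<mu>) (auto simp: Suc_le_eq)
    ultimately show "\<mu> \<in> (\<Union>k\<le>n. {\<mu>. set_mset \<mu> \<subseteq> {..n} \<and> size \<mu> = k})"
      using m by (auto simp: partitions_def)
  qed
  moreover have "finite {\<mu>. set_mset \<mu> \<subseteq> {..n} \<and> size \<mu> = k}" for k
    using finite_multisets_of_size[of "{..n}" k] by (simp add: multisets_of_size_def)
  ultimately show ?thesis by (auto intro: finite_subset)
qed

text \<open>Bessel's inequality, summed over the standard basis, is an equality; hence each instance is.\<close>

lemma orthonormal_matrix_transpose:
  fixes u :: "'a \<Rightarrow> 'a \<Rightarrow> real"
  assumes "finite P"
    and orth: "\<And>\<kappa> \<kappa>'. \<kappa> \<in> P \<Longrightarrow> \<kappa>' \<in> P \<Longrightarrow>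
      (\<Sum>\<mu>\<in>P. u \<kappa> \<mu> * u \<kappa>' \<mu>) = (if \<kappa> = \<kappa>' then 1 else 0)"
    and "\<mu> \<in> P" "\<nu> \<in> P"
  shows "(\<Sum>\<kappa>\<in>P. u \<kappa> \<mu> * u \<kappa> \<nu>) = (if \<mu> = \<nu> then 1 else 0)"
proof -
  define d where "d \<mu> \<nu> = (if \<mu> = \<nu> then 1 else 0) - (\<Sum>\<kappa>\<in>P. u \<kappa> \<mu> * u \<kappa> \<nu>)" for \<mu> \<nu>
  have bessel: "(\<Sum>\<nu>\<in>P. (d \<mu> \<nu>)\<^sup>2) = 1 - (\<Sum>\<kappa>\<in>P. (u \<kappa> \<mu>)\<^sup>2)" if "\<mu> \<in> P" for \<mu>
  proof -
    have "(\<Sum>\<nu>\<in>P. (d \<mu> \<nu>)\<^sup>2) = (\<Sum>\<nu>\<in>P. (if \<mu> = \<nu> then 1 else 0) -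
        (if \<mu> = \<nu> then 2 * (\<Sum>\<kappa>\<in>P. u \<kappa> \<mu> * u \<kappa> \<nu>) else 0) + (\<Sum>\<kappa>\<in>P. u \<kappa> \<mu> * u \<kappa> \<nu>)\<^sup>2)"
      by (intro sum.cong) (auto simp: d_def power2_eq_square algebra_simps)
    also have "\<dots> = 1 - 2 * (\<Sum>\<kappa>\<in>P. (u \<kappa> \<mu>)\<^sup>2) + (\<Sum>\<nu>\<in>P. (\<Sum>\<kappa>\<in>P. u \<kappa> \<mu> * u \<kappa> \<nu>)\<^sup>2)"
      using that \<open>finite P\<close> by (simp add: sum.distrib sum_subtractf power2_eq_square)
    also have "(\<Sum>\<nu>\<in>P. (\<Sum>\<kappa>\<in>P. u \<kappa> \<mu> * u \<kappa> \<nu>)\<^sup>2) =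
        (\<Sum>\<nu>\<in>P. \<Sum>\<kappa>\<in>P. \<Sum>\<kappa>'\<in>P. u \<kappa> \<mu> * u \<kappa>' \<mu> * (u \<kappa> \<nu> * u \<kappa>' \<nu>))"
      by (simp add: power2_eq_square sum_product algebra_simps)
    also have "\<dots> = (\<Sum>\<kappa>\<in>P. \<Sum>\<kappa>'\<in>P. \<Sum>\<nu>\<in>P. u \<kappa> \<mu> * u \<kappa>' \<mu> * (u \<kappa> \<nu> * u \<kappa>' \<nu>))"
      by (rule trans[OF sum.swap], rule sum.cong[OF refl], rule sum.swap)
    also have "\<dots> = (\<Sum>\<kappa>\<in>P. \<Sum>\<kappa>'\<in>P. if \<kappa> = \<kappa>' then u \<kappa> \<mu> * u \<kappa>' \<mu> else 0)"
      by (intro sum.cong refl) (auto simp: sum_distrib_left[symmetric] orth)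
    also have "\<dots> = (\<Sum>\<kappa>\<in>P. (u \<kappa> \<mu>)\<^sup>2)"
      using \<open>finite P\<close> by (simp add: power2_eq_square)
    finally show ?thesis by simp
  qed
  have "(\<Sum>\<mu>\<in>P. \<Sum>\<nu>\<in>P. (d \<mu> \<nu>)\<^sup>2) = real (card P) - (\<Sum>\<mu>\<in>P. \<Sum>\<kappa>\<in>P. (u \<kappa> \<mu>)\<^sup>2)"
    using bessel by (simp add: sum_subtractf)
  also have "(\<Sum>\<mu>\<in>P. \<Sum>\<kappa>\<in>P. (u \<kappa> \<mu>)\<^sup>2) = (\<Sum>\<kappa>\<in>P. \<Sum>\<mu>\<in>P. u \<kappa> \<mu> * u \<kappa> \<mu>)"
    by (subst sum.swap) (simp add: power2_eq_square)
  also have "\<dots> = real (card P)" using orth by simp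
  finally have "(\<Sum>\<mu>\<in>P. \<Sum>\<nu>\<in>P. (d \<mu> \<nu>)\<^sup>2) = 0" by simp
  then have "(\<Sum>\<nu>\<in>P. (d \<mu> \<nu>)\<^sup>2) = 0"
    using assms by (subst (asm) sum_nonneg_eq_0_iff) (auto intro!: sum_nonneg)
  then have "d \<mu> \<nu> = 0"
    using assms by (subst (asm) sum_nonneg_eq_0_iff) auto
  then show ?thesis by (simp add: d_def)
qed

text \<open>The family is indexed by the same finite set as the coordinates, so after weighting by
  sqrt (c \<mu>) and normalization the matrix \<open>u\<close> is square; orthonormal rows then
  force orthonormal columns, which is completeness.\<close>

lemma orthogonal_basis_expansion:
  fixes J :: "'a \<Rightarrow> 'a \<Rightarrow> real"
  assumes "finite P" and c: "\<And>\<mu>. \<mu> \<in> P \<Longrightarrow> c \<mu> > 0"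
    and orth: "\<And>\<kappa> \<kappa>'. \<kappa> \<in> P \<Longrightarrow> \<kappa>' \<in> P \<Longrightarrow> \<kappa> \<noteq> \<kappa>' \<Longrightarrow>
      (\<Sum>\<mu>\<in>P. J \<kappa> \<mu> * J \<kappa>' \<mu> * c \<mu>) = 0"
    and nz: "\<And>\<kappa>. \<kappa> \<in> P \<Longrightarrow> \<exists>\<mu>\<in>P. J \<kappa> \<mu> \<noteq> 0"
    and "\<mu> \<in> P"
  shows "f \<mu> = (\<Sum>\<kappa>\<in>P. (\<Sum>\<nu>\<in>P. f \<nu> * J \<kappa> \<nu> * c \<nu>) /
    (\<Sum>\<nu>\<in>P. J \<kappa> \<nu> * J \<kappa> \<nu> * c \<nu>) * J \<kappa> \<mu>)"
proof -
  define N where "N \<kappa> = (\<Sum>\<nu>\<in>P. J \<kappa> \<nu> * J \<kappa> \<nu> * c \<nu>)" for \<kappa>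
  have N: "N \<kappa> > 0" if k: "\<kappa> \<in> P" for \<kappa>
  proof -
    obtain m where "m \<in> P" "J \<kappa> m \<noteq> 0" using nz k by blast
    then show ?thesis unfolding N_def using \<open>finite P\<close> c
      by (intro sum_pos2[of _ m])
        (auto intro!: mult_nonneg_nonneg mult_pos_pos simp: less_imp_le simp flip: power2_eq_square)
  qed
  define u where "u \<kappa> \<mu> = J \<kappa> \<mu> * sqrt (c \<mu>) / sqrt (N \<kappa>)" for \<kappa> \<mu>
  have uu: "(\<Sum>\<mu>\<in>P. u \<kappa> \<mu> * u \<kappa>' \<mu>) = (if \<kappa> = \<kappa>' then 1 else 0)" if "\<kappa> \<in> P" "\<kappa>' \<in> P" for \<kappa> \<kappa>'
  proof -
    have "(\<Sum>\<mu>\<in>P. u \<kappa> \<mu> * u \<kappa>' \<mu>) = (\<Sum>\<mu>\<in>P. J \<kappa> \<mu> * J \<kappa>' \<mu> * c \<mu>) / (sqrt (N \<kappa>) * sqrt (N \<kappa>'))"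
      unfolding sum_divide_distrib
    proof (intro sum.cong refl)
      fix x assume "x \<in> P"
      then have s: "sqrt (c x) * sqrt (c x) = c x" using c[of x] by simp
      have "u \<kappa> x * u \<kappa>' x = J \<kappa> x * J \<kappa>' x * (sqrt (c x) * sqrt (c x)) / (sqrt (N \<kappa>) * sqrt (N \<kappa>'))"
        by (simp add: u_def)
      then show "u \<kappa> x * u \<kappa>' x = J \<kappa> x * J \<kappa>' x * c x / (sqrt (N \<kappa>) * sqrt (N \<kappa>'))"
        by (simp only: s)
    qed
    then show ?thesis using orth[OF that] N[OF that(1)] by (auto simp: N_def[symmetric])
  qed
  have tr: "(\<Sum>\<kappa>\<in>P. u \<kappa> \<nu> * u \<kappa> \<mu>) = (if \<nu> = \<mu> then 1 else 0)" if "\<nu> \<in> P" for \<nu>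
    by (rule orthonormal_matrix_transpose[OF \<open>finite P\<close> uu]) (use that \<open>\<mu> \<in> P\<close> in auto)
  have "(\<Sum>\<kappa>\<in>P. (\<Sum>\<nu>\<in>P. f \<nu> * J \<kappa> \<nu> * c \<nu>) / N \<kappa> * J \<kappa> \<mu>) =
    (\<Sum>\<kappa>\<in>P. \<Sum>\<nu>\<in>P. f \<nu> * sqrt (c \<nu>) / sqrt (c \<mu>) * (u \<kappa> \<nu> * u \<kappa> \<mu>))"
    unfolding sum_divide_distrib sum_distrib_right
  proof (intro sum.cong refl)
    fix \<kappa> \<nu> assume k: "\<kappa> \<in> P" and n: "\<nu> \<in> P"
    have s: "sqrt (c \<nu>) * sqrt (c \<nu>) = c \<nu>" "sqrt (N \<kappa>) * sqrt (N \<kappa>) = N \<kappa>"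
      using c[OF n] N[OF k] by simp_all
    have "sqrt (c \<mu>) \<noteq> 0" using c[OF \<open>\<mu> \<in> P\<close>] by simp
    then have "f \<nu> * sqrt (c \<nu>) / sqrt (c \<mu>) * (u \<kappa> \<nu> * u \<kappa> \<mu>) =
      f \<nu> * J \<kappa> \<nu> * (sqrt (c \<nu>) * sqrt (c \<nu>)) / (sqrt (N \<kappa>) * sqrt (N \<kappa>)) * J \<kappa> \<mu>"
      by (simp add: u_def)
    then show "f \<nu> * J \<kappa> \<nu> * c \<nu> / N \<kappa> * J \<kappa> \<mu> = f \<nu> * sqrt (c \<nu>) / sqrt (c \<mu>) * (u \<kappa> \<nu> * u \<kappa> \<mu>)"
      by (simp only: s)
  qed
  also have "\<dots> = (\<Sum>\<nu>\<in>P. f \<nu> * sqrt (c \<nu>) / sqrt (c \<mu>) * (if \<nu> = \<mu> then 1 else 0))"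
    by (subst sum.swap) (simp only: sum_distrib_left[symmetric] tr cong: sum.cong)
  also have "\<dots> = (\<Sum>\<nu>\<in>P. if \<nu> = \<mu> then f \<mu> else 0)"
    using c[OF \<open>\<mu> \<in> P\<close>] by (intro sum.cong) auto
  also have "\<dots> = f \<mu>"
    using \<open>finite P\<close> \<open>\<mu> \<in> P\<close> by simp
  finally show ?thesis by (simp add: N_def)
qed

lemma sum_lookup_Sym_deg:
  assumes "f \<in> Sym_deg n"
  shows "(\<Sum>\<mu>\<in>Poly_Mapping.keys f. Poly_Mapping.lookup f \<mu> * b \<mu>) =
    (\<Sum>\<mu>\<in>partitions n. Poly_Mapping.lookup f \<mu> * (b \<mu> :: real))"
  using assms finite_partitions
  by (intro sum.mono_neutral_left) (auto simp: Sym_deg_def in_keys_iff)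

lemma z_coeff_pos: "0 \<notin># \<mu> \<Longrightarrow> z_coeff \<mu> > 0"
  unfolding z_coeff_def by (intro prod_pos ballI mult_pos_pos zero_less_power) (auto intro: Nat.gr0I)

text \<open>The dominance inequality for k = 1 compares the largest parts.\<close>

lemma dominated_by_part:
  assumes \<nu>: "\<nu> \<in> dominated_by \<kappa>" and m: "m \<in># \<nu>" "m > 0"
  shows "\<exists>k\<in>#\<kappa>. m \<le> k"
proof -
  define s where "s = sorted_list_of_multiset \<nu>"
  define t where "t = sorted_list_of_multiset \<kappa>"
  have "m \<in> set s" using m by (simp add: s_def)
  then have sne: "s \<noteq> []" by auto
  have "m \<le> last s"
    using \<open>m \<in> set s\<close> sorted_sorted_list_of_multiset[of \<nu>]
    unfolding s_def[symmetric] by (cases s rule: rev_cases) (auto simp: sorted_append)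
  moreover have "largest_parts_sum 1 \<nu> = last s"
    using sne by (cases s rule: rev_cases) (auto simp: largest_parts_sum_def s_def[symmetric])
  moreover have "largest_parts_sum 1 \<nu> \<le> largest_parts_sum 1 \<kappa>"
    using \<nu> unfolding dominated_by_def by blast
  ultimately have le: "m \<le> largest_parts_sum 1 \<kappa>" by linarith
  then have tne: "t \<noteq> []" using m(2) by (auto simp: largest_parts_sum_def t_def)
  then have "largest_parts_sum 1 \<kappa> = last t"
    by (cases t rule: rev_cases) (auto simp: largest_parts_sum_def t_def[symmetric])
  moreover have "last t \<in># \<kappa>" using tne by (metis last_in_set set_sorted_list_of_multiset t_def)
  ultimately show ?thesis using le by auto
qed

lemma partitions_part_full:
  assumes k: "\<kappa> \<in> partitions n" "k \<in># \<kappa>" "n \<le> k"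
  shows "\<kappa> = {#n#}"
proof -
  obtain r where r: "\<kappa> = add_mset k r" using k by (metis multi_member_split)
  have "sum_mset r = 0" "0 \<notin># r" "k = n" using k r by (auto simp: partitions_def)
  moreover have "r = {#}" if "sum_mset r = 0" "0 \<notin># r" for r :: "nat multiset"
    using that by (cases r) auto
  ultimately show ?thesis using r by simp
qed

lemma partitions_one: "\<kappa> \<in> partitions 1 \<Longrightarrow> \<kappa> = {#1#}"
proof -
  assume k: "\<kappa> \<in> partitions 1"
  then have "\<kappa> \<noteq> {#}" by (auto simp: partitions_def)
  then obtain j where j: "j \<in># \<kappa>" by blast
  then have "1 \<le> j" using k by (cases j) (auto simp: partitions_def)
  then show ?thesis using k j partitions_part_full by blast
qed

lemma partitions_part_almost_full:
  assumes "\<kappa> \<in> partitions n" "k \<in># \<kappa>" "n - 1 \<le> k" "n \<ge> 1"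
  shows "\<kappa> = {#n#} \<or> \<kappa> = {#n - 1, 1#}"
proof (cases "n \<le> k")
  case True then show ?thesis using partitions_part_full assms by blast
next
  case False
  obtain r where r: "\<kappa> = add_mset k r" using assms(2) by (metis multi_member_split)
  have k: "k = n - 1" using False assms by linarith
  then have "r \<in> partitions 1" using assms r by (auto simp: partitions_def)
  then show ?thesis using r k partitions_one by auto
qed

section \<open>Monomial positivity of the specialization\<close>

text \<open>At e = 0 all power sums of the variables 1 and e equal 1, and only p_1 has a first-order
  term, so each part 1 of \<mu> contributes 1. For n \<ge> 2 the derivative reads off the
  coefficient of m_(n-1,1).\<close>

lemma specialize_derivative:
  assumes "f \<in> Sym_deg n"
  shows "((\<lambda>e. specialize (\<lambda>k. 1 + e ^ k) f) has_real_derivative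
    (\<Sum>\<mu>\<in>partitions n. Poly_Mapping.lookup f \<mu> * real (count \<mu> 1))) (at 0)"
proof -
  have "((\<lambda>e::real. \<Prod>k\<in>#\<mu>. 1 + e ^ k) has_real_derivative real (count \<mu> 1)) (at 0)"
    if "0 \<notin># \<mu>" for \<mu>
    using that
  proof (induction \<mu>)
    case (add k \<mu>)
    have k: "k > 0" and m: "0 \<notin># \<mu>" using add.prems by auto
    have p: "(\<Prod>k\<in>#\<mu>. 1 + (0::real) ^ k) = 1" using m by (induction \<mu>) auto
    have "((\<lambda>e::real. 1 + e ^ k) has_real_derivative (if k = 1 then 1 else 0)) (at 0)"
      using k by (auto intro!: derivative_eq_intros)
    from DERIV_mult[OF this add.IH[OF m]] show ?case using k p by (auto simp: power_0_left)
  qed auto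
  then have "((\<lambda>e. \<Sum>\<mu>\<in>partitions n. Poly_Mapping.lookup f \<mu> * (\<Prod>k\<in>#\<mu>. 1 + e ^ k))
      has_real_derivative (\<Sum>\<mu>\<in>partitions n. Poly_Mapping.lookup f \<mu> * real (count \<mu> 1))) (at 0)"
    by (intro DERIV_sum DERIV_cmult) (auto simp: partitions_def)
  then show ?thesis
    unfolding specialize_def sum_lookup_Sym_deg[OF assms] .
qed

lemma monomial_sf_one_variable:
  assumes "\<nu> \<in> partitions n" "n \<ge> 1" "\<nu> \<noteq> {#n#}"
  shows "monomial_sf \<nu> 1 x = 0"
proof -
  have "{\<beta>. (\<forall>i\<ge>1. \<beta> i = 0) \<and> filter_mset (\<lambda>b. b \<noteq> 0) (image_mset \<beta> (mset_set {..<1::nat})) = \<nu>} = {}"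
    using assms by (auto simp: partitions_def lessThan_Suc split: if_splits)
  then show ?thesis unfolding monomial_sf_def by (simp only: sum.empty)
qed

lemma monomial_sf_two_variables_derivative:
  assumes "\<nu> \<in> partitions n" "n \<ge> 2" "\<nu> \<noteq> {#n - 1, 1#}"
  shows "((\<lambda>e. monomial_sf \<nu> 2 (\<lambda>i. if i = 0 then 1 else e)) has_real_derivative 0) (at 0)"
proof -
  define B where "B = {\<beta>. (\<forall>i\<ge>2. \<beta> i = 0) \<and>
    filter_mset (\<lambda>b. b \<noteq> 0) (image_mset \<beta> (mset_set {..<2::nat})) = \<nu>}"
  have two: "{..<2::nat} = {0, 1}" by auto
  \<comment> \<open>A second exponent 1 would force the first to be n - 1; n \<ge> 2 rules out that
    the first one vanishes.\<close>
  have b1: "\<beta> 1 \<noteq> 1" if "\<beta> \<in> B" for \<beta>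
    using that assms by (auto simp: B_def two partitions_def split: if_splits)
  have pw: "((\<lambda>e::real. e ^ k) has_real_derivative 0) (at 0)" if "k \<noteq> 1" for k :: nat
    using that by (cases k) (auto intro!: derivative_eq_intros simp: power_0_left)
  have "((\<lambda>e::real. e ^ \<beta> 1) has_real_derivative 0) (at 0)" if "\<beta> \<in> B" for \<beta>
    by (rule pw[OF b1[OF that]])
  then have "((\<lambda>e::real. \<Sum>\<beta>\<in>B. e ^ \<beta> 1) has_real_derivative (\<Sum>\<beta>\<in>B. 0)) (at 0)"
    by (intro DERIV_sum)
  moreover have "monomial_sf \<nu> 2 (\<lambda>i. if i = 0 then 1 else e) = (\<Sum>\<beta>\<in>B. e ^ \<beta> 1)" for e
    unfolding monomial_sf_def B_def by (rule sum.cong[OF refl]) (simp add: two)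
  ultimately show ?thesis by simp
qed

lemma jack_familyD:
  assumes "jack_family \<alpha> J" "\<kappa> \<in> partitions n"
  shows "J \<kappa> \<in> Sym_deg n" "in_monomial_span (dominated_by \<kappa>) (J \<kappa>)"
    "Poly_Mapping.lookup (J \<kappa>) (replicate_mset n 1) = 1"
    "\<And>\<mu>. \<mu> \<in> partitions n \<Longrightarrow> \<kappa> \<noteq> \<mu> \<Longrightarrow> (\<Sum>\<nu>\<in>partitions n. Poly_Mapping.lookup (J \<kappa>) \<nu> *
      Poly_Mapping.lookup (J \<mu>) \<nu> * (\<alpha> ^ size \<nu> * z_coeff \<nu>)) = 0"
proof -
  show *: "J \<kappa> \<in> Sym_deg n" "in_monomial_span (dominated_by \<kappa>) (J \<kappa>)"
    "Poly_Mapping.lookup (J \<kappa>) (replicate_mset n 1) = 1"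
    using assms by (auto simp: jack_family_def)
  fix \<mu> assume "\<mu> \<in> partitions n" "\<kappa> \<noteq> \<mu>"
  then have "jack_inner \<alpha> (J \<kappa>) (J \<mu>) = 0" using assms by (auto simp: jack_family_def)
  then show "(\<Sum>\<nu>\<in>partitions n. Poly_Mapping.lookup (J \<kappa>) \<nu> *
      Poly_Mapping.lookup (J \<mu>) \<nu> * (\<alpha> ^ size \<nu> * z_coeff \<nu>)) = 0"
    unfolding jack_inner_def using sum_lookup_Sym_deg[OF *(1)] by (simp add: mult.assoc)
qed

text \<open>All power sums of the single variable 1 equal 1, so the sum is the value there. It reads
  off the coefficient of m_(n), absent from J_\<kappa> because (n) is dominated only by
  itself.\<close>

lemma jack_coefficient_sum:
  assumes "jack_family \<alpha> J" "\<kappa> \<in> partitions n" "\<kappa> \<noteq> {#n#}" "n \<ge> 1"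
  shows "(\<Sum>\<mu>\<in>partitions n. Poly_Mapping.lookup (J \<kappa>) \<mu>) = 0"
proof -
  note J = jack_familyD[OF assms(1,2)]
  obtain c where c: "\<And>N x. specialize (power_sum N x) (J \<kappa>) =
      (\<Sum>\<nu>\<in>dominated_by \<kappa>. c \<nu> * monomial_sf \<nu> N x)"
    using J(2) by (auto simp: in_monomial_span_def)
  have "monomial_sf \<nu> 1 (\<lambda>_. 1) = 0" if \<nu>: "\<nu> \<in> dominated_by \<kappa>" for \<nu>
  proof (rule monomial_sf_one_variable)
    show "\<nu> \<in> partitions n" using that assms(2) by (auto simp: dominated_by_def partitions_def)
    show "\<nu> \<noteq> {#n#}"
      using dominated_by_part[OF \<nu>, of n] partitions_part_full[OF assms(2)] assms by auto
  qed fact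
  then have "specialize (power_sum 1 (\<lambda>_. 1)) (J \<kappa>) = 0" unfolding c by simp
  moreover have "power_sum 1 (\<lambda>_. 1) = (\<lambda>_. 1)" by (auto simp: power_sum_def)
  ultimately have "specialize (\<lambda>_. 1) (J \<kappa>) = 0" by simp
  then show ?thesis unfolding specialize_def sum_lookup_Sym_deg[OF J(1)] by simp
qed

text \<open>The first-order term at the variables 1 and e reads off the coefficient of m_(n-1,1),
  and (n-1,1) is dominated only by itself and (n).\<close>

lemma jack_coefficient_sum_ones:
  assumes "jack_family \<alpha> J" "\<kappa> \<in> partitions n" "\<kappa> \<noteq> {#n#}" "\<kappa> \<noteq> {#n - 1, 1#}" "n \<ge> 2"
  shows "(\<Sum>\<mu>\<in>partitions n. Poly_Mapping.lookup (J \<kappa>) \<mu> * real (count \<mu> 1)) = 0"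
proof -
  note J = jack_familyD[OF assms(1,2)]
  obtain c where c: "\<And>N x. specialize (power_sum N x) (J \<kappa>) =
      (\<Sum>\<nu>\<in>dominated_by \<kappa>. c \<nu> * monomial_sf \<nu> N x)"
    using J(2) by (auto simp: in_monomial_span_def)
  have "((\<lambda>e. monomial_sf \<nu> 2 (\<lambda>i. if i = 0 then 1 else e)) has_real_derivative 0) (at 0)"
    if \<nu>: "\<nu> \<in> dominated_by \<kappa>" for \<nu>
  proof (rule monomial_sf_two_variables_derivative)
    show "\<nu> \<in> partitions n" using that assms(2) by (auto simp: dominated_by_def partitions_def)
    show "\<nu> \<noteq> {#n - 1, 1#}"
      using dominated_by_part[OF \<nu>, of "n - 1"] partitions_part_almost_full[OF assms(2)] assms by auto
  qed fact
  then have "((\<lambda>e. specialize (power_sum 2 (\<lambda>i. if i = 0 then 1 else e)) (J \<kappa>))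
      has_real_derivative (\<Sum>\<nu>\<in>dominated_by \<kappa>. c \<nu> * 0)) (at 0)"
    unfolding c by (intro DERIV_sum DERIV_cmult)
  moreover have "power_sum 2 (\<lambda>i. if i = 0 then 1 else e) = (\<lambda>k. 1 + e ^ k)" for e :: real
    by (auto simp: power_sum_def numeral_2_eq_2 fun_eq_iff)
  ultimately have "((\<lambda>e. specialize (\<lambda>k. 1 + e ^ k) (J \<kappa>)) has_real_derivative 0) (at 0)"
    by simp
  from DERIV_unique[OF this specialize_derivative[OF J(1)]] show ?thesis by simp
qed

text \<open>
  \<open>w\<close> represents, for the Jack scalar product, the coefficient of \<open>m\<^bsub>(n)\<^esub>\<close>, and
  \<open>\<mu> \<mapsto> count \<mu> 1 * w \<mu>\<close> that of \<open>m\<^bsub>(n-1,1)\<^esub>\<close>. These functionals vanish on every other \<open>J\<^sub>\<kappa>\<close>, so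
  \<open>J\<^bsub>(n)\<^esub>\<close> and \<open>J\<^bsub>(n-1,1)\<^esub>\<close> arise from them by orthogonalization.
\<close>

lemma totally_jack_positive_forms:
  assumes "totally_jack_positive v" "\<alpha> > 0" "n \<ge> 1"
  defines "w \<equiv> \<lambda>\<mu>. 1 / (\<alpha> ^ size \<mu> * z_coeff \<mu>)"
  shows "(\<Sum>\<mu>\<in>partitions n. (\<Prod>k\<in>#\<mu>. v k) * w \<mu>) \<ge> 0"
    and "n \<ge> 2 \<Longrightarrow> (\<Sum>\<mu>\<in>partitions n. (\<Prod>k\<in>#\<mu>. v k) * real (count \<mu> 1) * w \<mu>) *
      (\<Sum>\<mu>\<in>partitions n. w \<mu>) -
      (\<Sum>\<mu>\<in>partitions n. (\<Prod>k\<in>#\<mu>. v k) * w \<mu>) * (\<Sum>\<mu>\<in>partitions n. real (count \<mu> 1) * w \<mu>) \<ge> 0"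
proof -
  define P where "P = partitions n"
  have fin: "finite P" by (simp add: P_def finite_partitions)
  define c where "c \<mu> = \<alpha> ^ size \<mu> * z_coeff \<mu>" for \<mu>
  have cpos: "c \<mu> > 0" if "\<mu> \<in> P" for \<mu>
    using that assms(2) z_coeff_pos by (auto simp: c_def P_def partitions_def)
  have w: "w = (\<lambda>\<mu>. 1 / c \<mu>)" by (simp add: w_def c_def)
  obtain J where J: "jack_family \<alpha> J" and pos: "\<And>\<kappa>. \<kappa> \<in> P \<Longrightarrow> specialize v (J \<kappa>) \<ge> 0"
    using assms(1,2) unfolding totally_jack_positive_def P_def by blast
  define j where "j \<kappa> \<mu> = Poly_Mapping.lookup (J \<kappa>) \<mu>" for \<kappa> \<mu>
  define ones where "ones = replicate_mset n (1::nat)"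
  have ones: "ones \<in> P" by (auto simp: ones_def P_def partitions_def in_replicate_mset)
  have j1: "j \<kappa> ones = 1" if "\<kappa> \<in> P" for \<kappa>
    using jack_familyD(3)[OF J] that by (auto simp: j_def P_def ones_def)
  have orth: "(\<Sum>\<mu>\<in>P. j \<kappa> \<mu> * j \<kappa>' \<mu> * c \<mu>) = 0" if "\<kappa> \<in> P" "\<kappa>' \<in> P" "\<kappa> \<noteq> \<kappa>'" for \<kappa> \<kappa>'
    using jack_familyD(4)[OF J] that by (auto simp: j_def c_def P_def)
  have spec: "specialize v (J \<kappa>) = (\<Sum>\<mu>\<in>P. j \<kappa> \<mu> * (\<Prod>k\<in>#\<mu>. v k))" if "\<kappa> \<in> P" for \<kappa>
    using sum_lookup_Sym_deg[OF jack_familyD(1)[OF J]] that by (simp add: specialize_def P_def j_def)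
  have expand: "f \<mu> = (\<Sum>\<kappa>\<in>P. (\<Sum>\<nu>\<in>P. f \<nu> * j \<kappa> \<nu> * c \<nu>) /
      (\<Sum>\<nu>\<in>P. j \<kappa> \<nu> * j \<kappa> \<nu> * c \<nu>) * j \<kappa> \<mu>)" if "\<mu> \<in> P" for f \<mu>
    using that j1 ones
    by (intro orthogonal_basis_expansion fin cpos orth) (auto intro!: bexI[of _ ones])
  define top where "top = {#n#}"
  have top: "top \<in> P" using assms(3) by (auto simp: top_def P_def partitions_def)
  define sj where "sj = specialize v (J top)"
  define t where "t = (\<Sum>\<nu>\<in>P. w \<nu> * j top \<nu> * c \<nu>) / (\<Sum>\<nu>\<in>P. j top \<nu> * j top \<nu> * c \<nu>)"
  \<comment> \<open>\<open>w\<close> is the reciprocal weight, so pairing with it gives the plain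
    sum of coefficients.\<close>
  have wc: "(\<Sum>\<nu>\<in>P. w \<nu> * f \<nu> * c \<nu>) = (\<Sum>\<nu>\<in>P. f \<nu>)" for f
    using cpos by (intro sum.cong refl) (force simp: w)
  have wj: "w \<mu> = t * j top \<mu>" if "\<mu> \<in> P" for \<mu>
  proof -
    have "w \<mu> = (\<Sum>\<kappa>\<in>P. if \<kappa> = top then t * j top \<mu> else 0)"
      unfolding expand[OF that, of w]
    proof (intro sum.cong refl)
      fix \<kappa> assume k: "\<kappa> \<in> P"
      have "(\<Sum>\<nu>\<in>P. w \<nu> * j \<kappa> \<nu> * c \<nu>) = 0" if "\<kappa> \<noteq> top"
        unfolding wc using jack_coefficient_sum[OF J, of \<kappa> n] k that assms(3)
        by (simp add: j_def P_def top_def)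
      then show "(\<Sum>\<nu>\<in>P. w \<nu> * j \<kappa> \<nu> * c \<nu>) / (\<Sum>\<nu>\<in>P. j \<kappa> \<nu> * j \<kappa> \<nu> * c \<nu>) * j \<kappa> \<mu> =
          (if \<kappa> = top then t * j top \<mu> else 0)" by (auto simp: t_def)
    qed
    then show ?thesis using fin top by simp
  qed
  \<comment> \<open>Compared at p_1^n, where every Jack function has coefficient 1.\<close>
  have "t = 1 / c ones" using wj[OF ones] j1[OF top] by (simp add: w)
  then have tpos: "t > 0" using cpos[OF ones] by simp
  have "(\<Sum>\<mu>\<in>P. (\<Prod>k\<in>#\<mu>. v k) * w \<mu>) = t * specialize v (J top)"
    unfolding spec[OF top] sum_distrib_left by (intro sum.cong) (auto simp: wj)
  then show "(\<Sum>\<mu>\<in>partitions n. (\<Prod>k\<in>#\<mu>. v k) * w \<mu>) \<ge> 0"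
    using tpos pos[OF top] by (simp add: P_def)
  assume n2: "n \<ge> 2"
  define nxt where "nxt = {#n - 1, 1#}"
  have nxt: "nxt \<in> P" using n2 by (auto simp: nxt_def P_def partitions_def)
  have ne: "nxt \<noteq> top" by (auto simp: nxt_def top_def)
  define h where "h \<mu> = real (count \<mu> 1) * w \<mu>" for \<mu>
  define A where "A = (\<Sum>\<nu>\<in>P. h \<nu> * j nxt \<nu> * c \<nu>) / (\<Sum>\<nu>\<in>P. j nxt \<nu> * j nxt \<nu> * c \<nu>)"
  define B where "B = (\<Sum>\<nu>\<in>P. h \<nu> * j top \<nu> * c \<nu>) / (\<Sum>\<nu>\<in>P. j top \<nu> * j top \<nu> * c \<nu>) / t"
  have hc: "(\<Sum>\<nu>\<in>P. h \<nu> * f \<nu> * c \<nu>) = (\<Sum>\<nu>\<in>P. f \<nu> * real (count \<nu> 1))" for f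
    using cpos by (intro sum.cong refl) (force simp: w h_def)
  have hj: "h \<mu> = A * j nxt \<mu> + B * w \<mu>" if "\<mu> \<in> P" for \<mu>
  proof -
    have "h \<mu> = (\<Sum>\<kappa>\<in>P. (if \<kappa> = nxt then A * j nxt \<mu> else 0) + (if \<kappa> = top then B * t * j top \<mu> else 0))"
      unfolding expand[OF that, of h]
    proof (intro sum.cong refl)
      fix \<kappa> assume k: "\<kappa> \<in> P"
      have "(\<Sum>\<nu>\<in>P. h \<nu> * j \<kappa> \<nu> * c \<nu>) = 0" if "\<kappa> \<noteq> top" "\<kappa> \<noteq> nxt"
        unfolding hc using jack_coefficient_sum_ones[OF J, of \<kappa> n] k that n2
        by (simp add: j_def P_def top_def nxt_def)
      then show "(\<Sum>\<nu>\<in>P. h \<nu> * j \<kappa> \<nu> * c \<nu>) / (\<Sum>\<nu>\<in>P. j \<kappa> \<nu> * j \<kappa> \<nu> * c \<nu>) * j \<kappa> \<mu> =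
          (if \<kappa> = nxt then A * j nxt \<mu> else 0) + (if \<kappa> = top then B * t * j top \<mu> else 0)"
        using ne tpos by (auto simp: A_def B_def)
    qed
    then show ?thesis using fin top nxt by (simp add: sum.distrib wj[OF that])
  qed
  define G where "G = (\<Sum>\<mu>\<in>P. w \<mu>)"
  define H where "H = (\<Sum>\<mu>\<in>P. h \<mu>)"
  have Gpos: "G > 0" unfolding G_def using fin top cpos by (intro sum_pos) (auto simp: w)
  have j0: "(\<Sum>\<mu>\<in>P. j nxt \<mu>) = 0"
    using jack_coefficient_sum[OF J, of nxt n] nxt ne n2 by (simp add: j_def P_def top_def)
  have HB: "H = B * G"
    unfolding H_def G_def using j0 by (simp add: hj sum.distrib flip: sum_distrib_left)
  \<comment> \<open>B = H / G is the \<open>w\<close>-average of the number of parts 1. It is below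
    n because the partition (n), with n \<ge> 2, has no such part; this makes the factor A
    positive.\<close>
  have "H < real n * G"
    unfolding H_def G_def sum_distrib_left
  proof (rule sum_strict_mono_ex1[OF fin])
    have "count \<mu> 1 \<le> n" if "\<mu> \<in> P" for \<mu>
    proof -
      have "count \<mu> 1 \<le> sum_mset \<mu>" for \<mu> :: "nat multiset" by (induction \<mu>) auto
      then show ?thesis using that by (auto simp: P_def partitions_def)
    qed
    moreover have "w \<mu> \<ge> 0" if "\<mu> \<in> P" for \<mu> using cpos[OF that] by (simp add: w)
    ultimately show "\<forall>\<mu>\<in>P. h \<mu> \<le> real n * w \<mu>"
      unfolding h_def by (intro ballI mult_right_mono) auto
    show "\<exists>\<mu>\<in>P. h \<mu> < real n * w \<mu>"
      using cpos[OF top] top n2 by (intro bexI[of _ top]) (auto simp: h_def w top_def)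
  qed
  then have Bn: "B < real n" using HB Gpos by simp
  have Apos: "A > 0"
  proof -
    have "A = (real n - B) * w ones"
      using hj[OF ones] j1[OF nxt] by (simp add: h_def ones_def algebra_simps)
    then show ?thesis using Bn cpos[OF ones] by (simp add: w)
  qed
  have "(\<Sum>\<mu>\<in>P. (\<Prod>k\<in>#\<mu>. v k) * h \<mu>) = A * specialize v (J nxt) + B * (\<Sum>\<mu>\<in>P. (\<Prod>k\<in>#\<mu>. v k) * w \<mu>)"
    unfolding spec[OF nxt] sum_distrib_left sum.distrib[symmetric]
    by (intro sum.cong) (auto simp: hj algebra_simps)
  then have "(\<Sum>\<mu>\<in>P. (\<Prod>k\<in>#\<mu>. v k) * h \<mu>) * G - (\<Sum>\<mu>\<in>P. (\<Prod>k\<in>#\<mu>. v k) * w \<mu>) * H = A * specialize v (J nxt) * G"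
    by (simp add: HB algebra_simps)
  moreover have "A * specialize v (J nxt) * G \<ge> 0"
    using Apos pos[OF nxt] Gpos by simp
  ultimately show "(\<Sum>\<mu>\<in>partitions n. (\<Prod>k\<in>#\<mu>. v k) * real (count \<mu> 1) * w \<mu>) *
      (\<Sum>\<mu>\<in>partitions n. w \<mu>) -
      (\<Sum>\<mu>\<in>partitions n. (\<Prod>k\<in>#\<mu>. v k) * w \<mu>) * (\<Sum>\<mu>\<in>partitions n. real (count \<mu> 1) * w \<mu>) \<ge> 0"
    by (simp add: G_def H_def P_def h_def mult.assoc)
qed

text \<open>A partition is weighted by \<alpha> to the power minus its number of parts, so
  multiplication by \<alpha>^k keeps exactly those with k parts in the limit, provided fewer parts
  contribute 0.\<close>

lemma partition_sum_leading_order: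
  assumes "k \<ge> 1" "\<And>\<mu>. \<mu> \<in> partitions n \<Longrightarrow> size \<mu> < k \<Longrightarrow> f \<mu> = 0"
  shows "((\<lambda>\<alpha>. \<alpha> ^ k * (\<Sum>\<mu>\<in>partitions n. f \<mu> * (1 / (\<alpha> ^ size \<mu> * z_coeff \<mu>)))) \<longlongrightarrow>
    (\<Sum>\<mu>\<in>partitions n. if size \<mu> = k then f \<mu> / z_coeff \<mu> else 0)) at_top"
proof -
  have "((\<lambda>\<alpha>. \<alpha> ^ k * (f \<mu> * (1 / (\<alpha> ^ size \<mu> * z_coeff \<mu>)))) \<longlongrightarrow>
      (if size \<mu> = k then f \<mu> / z_coeff \<mu> else 0)) at_top" if "\<mu> \<in> partitions n" for \<mu>
  proof (cases "size \<mu> < k")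
    case True then show ?thesis using assms(2)[OF that] by simp
  next
    case False
    define d where "d = size \<mu> - k"
    have sz: "size \<mu> = k + d" using False by (simp add: d_def)
    have "((\<lambda>\<alpha>::real. inverse \<alpha> ^ d * (f \<mu> / z_coeff \<mu>)) \<longlongrightarrow> 0 ^ d * (f \<mu> / z_coeff \<mu>)) at_top"
      by (intro tendsto_intros tendsto_inverse_0_at_top filterlim_ident)
    moreover have "\<forall>\<^sub>F \<alpha> in at_top. inverse \<alpha> ^ d * (f \<mu> / z_coeff \<mu>) =
        \<alpha> ^ k * (f \<mu> * (1 / (\<alpha> ^ size \<mu> * z_coeff \<mu>)))"
      using eventually_gt_at_top[of 0]
      by eventually_elim (simp add: sz power_add field_simps)
    ultimately have "((\<lambda>\<alpha>. \<alpha> ^ k * (f \<mu> * (1 / (\<alpha> ^ size \<mu> * z_coeff \<mu>)))) \<longlongrightarrow> 0 ^ d * (f \<mu> / z_coeff \<mu>)) at_top"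
      by (rule Lim_transform_eventually)
    then show ?thesis using sz by (auto simp: power_0_left split: if_splits)
  qed
  then show ?thesis unfolding sum_distrib_left by (intro tendsto_sum) auto
qed

text \<open>The first form is of order 1 / \<alpha> and sees only (n). The second, taken in degree n
  + 1, is of order \<alpha>^(-3): the factor \<open>count \<mu> 1\<close> removes the one-part
  partition, and the next partition (n,1) has the value v n because v 1 = 1.\<close>

lemma totally_jack_positive_bounds:
  assumes v: "totally_jack_positive v" and v1: "v 1 = 1" and "n \<ge> 1"
  shows "0 \<le> v n" "v (Suc n) \<le> v n"
proof -
  define w where "w \<alpha> \<mu> = 1 / (\<alpha> ^ size \<mu> * z_coeff \<mu>)" for \<alpha> :: real and \<mu>
  have size_pos: "size \<mu> > 0" if "\<mu> \<in> partitions n" "n \<ge> 1" for \<mu> n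
    using that by (auto simp: partitions_def intro!: Nat.gr0I)
  have sum1: "(\<Sum>\<mu>\<in>partitions n. if size \<mu> = 1 then f \<mu> / z_coeff \<mu> else 0) = f {#n#} / real n"
    if "n \<ge> 1" for n and f :: "nat multiset \<Rightarrow> real"
  proof -
    have "(\<Sum>\<mu>\<in>partitions n. if size \<mu> = 1 then f \<mu> / z_coeff \<mu> else 0) =
        (\<Sum>\<mu>\<in>partitions n. if \<mu> = {#n#} then f \<mu> / z_coeff \<mu> else 0)"
    proof (intro sum.cong refl)
      fix \<mu> assume \<mu>: "\<mu> \<in> partitions n"
      have "size \<mu> = 1 \<longleftrightarrow> \<mu> = {#n#}"
      proof
        assume "size \<mu> = 1"
        then obtain k where "\<mu> = {#k#}" using size_1_singleton_mset by blast
        then show "\<mu> = {#n#}" using \<mu> by (simp add: partitions_def)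
      qed simp
      then show "(if size \<mu> = 1 then f \<mu> / z_coeff \<mu> else 0) = (if \<mu> = {#n#} then f \<mu> / z_coeff \<mu> else 0)"
        by simp
    qed
    then show ?thesis using that finite_partitions by (auto simp: partitions_def z_coeff_def)
  qed
  have lim1: "((\<lambda>\<alpha>. \<alpha> * (\<Sum>\<mu>\<in>partitions n. f \<mu> * w \<alpha> \<mu>)) \<longlongrightarrow> f {#n#} / real n) at_top"
    if "n \<ge> 1" for n f
  proof -
    have "f \<mu> = 0" if "\<mu> \<in> partitions n" "size \<mu> < 1" for \<mu>
      using size_pos[OF that(1) \<open>n \<ge> 1\<close>] that(2) by simp
    from partition_sum_leading_order[of 1 n f, OF _ this] sum1[OF that, of f]
    show ?thesis by (simp add: w_def)
  qed
  have nonneg: "0 \<le> v n" if n: "n \<ge> 1" for n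
  proof -
    have "0 \<le> v n / real n"
    proof (rule tendsto_lowerbound)
      show "((\<lambda>\<alpha>. \<alpha> * (\<Sum>\<mu>\<in>partitions n. (\<Prod>k\<in>#\<mu>. v k) * w \<alpha> \<mu>)) \<longlongrightarrow> v n / real n) at_top"
        using lim1[OF n, of "\<lambda>\<mu>. \<Prod>k\<in>#\<mu>. v k"] by simp
      show "\<forall>\<^sub>F \<alpha> in at_top. 0 \<le> \<alpha> * (\<Sum>\<mu>\<in>partitions n. (\<Prod>k\<in>#\<mu>. v k) * w \<alpha> \<mu>)"
        using eventually_gt_at_top[of 0]
        by eventually_elim (use totally_jack_positive_forms(1)[OF v _ n] in \<open>simp add: w_def\<close>)
    qed simp
    then show ?thesis using n by (simp add: zero_le_divide_iff)
  qed
  then show "0 \<le> v n" using assms(3) .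
  define N where "N = Suc n"
  have N: "N \<ge> 2" using assms(3) by (simp add: N_def)
  have sum2: "(\<Sum>\<mu>\<in>partitions N. if size \<mu> = 2 then f \<mu> * real (count \<mu> 1) / z_coeff \<mu> else 0) =
      f {#N - 1, 1#} / real (N - 1)" for f
  proof -
    have e2: "\<mu> = {#N - 1, 1#}" if "\<mu> \<in> partitions N" "size \<mu> = 2" "count \<mu> 1 \<noteq> 0" for \<mu>
    proof -
      have "1 \<in># \<mu>" using that(3) by (simp add: count_eq_zero_iff)
      then obtain r where r: "\<mu> = add_mset 1 r" by (metis multi_member_split)
      then have "size r = 1" using that by simp
      then obtain k where "r = {#k#}" using size_1_singleton_mset by blast
      then show ?thesis using r that(1) by (auto simp: partitions_def)
    qed
    have "(\<Sum>\<mu>\<in>partitions N. if size \<mu> = 2 then f \<mu> * real (count \<mu> 1) / z_coeff \<mu> else 0) =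
        (\<Sum>\<mu>\<in>partitions N. if \<mu> = {#N - 1, 1#} then f \<mu> * real (count \<mu> 1) / z_coeff \<mu> else 0)"
    proof (intro sum.cong refl)
      fix \<mu> assume \<mu>: "\<mu> \<in> partitions N"
      consider "count \<mu> 1 = 0" "\<mu> \<noteq> {#N - 1, 1#}" | "\<mu> = {#N - 1, 1#}" | "size \<mu> \<noteq> 2" "\<mu> \<noteq> {#N - 1, 1#}"
        using e2[OF \<mu>] by blast
      then show "(if size \<mu> = 2 then f \<mu> * real (count \<mu> 1) / z_coeff \<mu> else 0) =
          (if \<mu> = {#N - 1, 1#} then f \<mu> * real (count \<mu> 1) / z_coeff \<mu> else 0)"
        by cases simp_all
    qed
    also have "\<dots> = f {#N - 1, 1#} * (real (count {#N - 1, 1#} 1) / z_coeff {#N - 1, 1#})"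
      using N finite_partitions by (simp add: partitions_def)
    also have "real (count {#N - 1, 1#} 1) / z_coeff {#N - 1, 1#} = 1 / real (N - 1)"
      using N by (cases "N = 2") (auto simp: z_coeff_def)
    finally show ?thesis by simp
  qed
  have lim2: "((\<lambda>\<alpha>. \<alpha>\<^sup>2 * (\<Sum>\<mu>\<in>partitions N. f \<mu> * real (count \<mu> 1) * w \<alpha> \<mu>)) \<longlongrightarrow>
      f {#N - 1, 1#} / real (N - 1)) at_top" for f
  proof -
    have "f \<mu> * real (count \<mu> 1) = 0" if "\<mu> \<in> partitions N" "size \<mu> < 2" for \<mu>
    proof -
      have "size \<mu> = 1" using that size_pos[of \<mu> N] N by linarith
      then obtain k where "\<mu> = {#k#}" using size_1_singleton_mset by blast
      then show ?thesis using that N by (auto simp: partitions_def)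
    qed
    from partition_sum_leading_order[of 2 N "\<lambda>\<mu>. f \<mu> * real (count \<mu> 1)", OF _ this] sum2[of f]
    show ?thesis by (simp add: w_def)
  qed
  let ?V = "\<lambda>\<alpha>. \<Sum>\<mu>\<in>partitions N. (\<Prod>k\<in>#\<mu>. v k) * w \<alpha> \<mu>"
  let ?V1 = "\<lambda>\<alpha>. \<Sum>\<mu>\<in>partitions N. (\<Prod>k\<in>#\<mu>. v k) * real (count \<mu> 1) * w \<alpha> \<mu>"
  let ?G = "\<lambda>\<alpha>. \<Sum>\<mu>\<in>partitions N. w \<alpha> \<mu>"
  let ?H = "\<lambda>\<alpha>. \<Sum>\<mu>\<in>partitions N. real (count \<mu> 1) * w \<alpha> \<mu>"
  have "0 \<le> v (N - 1) / real (N - 1) * (1 / real N) - v N / real N * (1 / real (N - 1))"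
  proof (rule tendsto_lowerbound)
    have "((\<lambda>\<alpha>. \<alpha>\<^sup>2 * ?V1 \<alpha> * (\<alpha> * ?G \<alpha>) - \<alpha> * ?V \<alpha> * (\<alpha>\<^sup>2 * ?H \<alpha>)) \<longlongrightarrow>
      v (N - 1) / real (N - 1) * (1 / real N) - v N / real N * (1 / real (N - 1))) at_top"
      using lim2[of "\<lambda>\<mu>. \<Prod>k\<in>#\<mu>. v k"] lim1[of N "\<lambda>\<mu>. \<Prod>k\<in>#\<mu>. v k"] lim1[of N "\<lambda>_. 1"] lim2[of "\<lambda>_. 1"] N v1
      by (intro tendsto_intros) auto
    then show "((\<lambda>\<alpha>. \<alpha> ^ 3 * (?V1 \<alpha> * ?G \<alpha> - ?V \<alpha> * ?H \<alpha>)) \<longlongrightarrow>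
      v (N - 1) / real (N - 1) * (1 / real N) - v N / real N * (1 / real (N - 1))) at_top"
      by (simp add: algebra_simps power2_eq_square power3_eq_cube)
    show "\<forall>\<^sub>F \<alpha> in at_top. 0 \<le> \<alpha> ^ 3 * (?V1 \<alpha> * ?G \<alpha> - ?V \<alpha> * ?H \<alpha>)"
      using eventually_gt_at_top[of 0]
      by eventually_elim (use totally_jack_positive_forms(2)[OF v, of _ N] N in \<open>simp add: w_def\<close>)
  qed simp
  then have "0 \<le> (v n - v (Suc n)) / (real (N - 1) * real N)"
    by (simp add: N_def diff_divide_distrib algebra_simps)
  moreover have "real (N - 1) * real N > 0" using N by simp
  ultimately show "v (Suc n) \<le> v n" unfolding zero_le_divide_iff by linarith
qed

section \<open>Path recursion\<close>

text \<open>The weight of a single step from height i to height j. The formula gives weight 0 to a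
  level step at height 0, in agreement with the exclusion of such steps.\<close>

definition luk_weight :: "real \<Rightarrow> (nat \<Rightarrow> real) \<Rightarrow> nat \<Rightarrow> nat \<Rightarrow> real" where
  "luk_weight g v i j = (if j = i then real i * g else if j > i then v (j - i) else if Suc j = i then 1 else 0)"

text \<open>The weighted sum over paths of l steps from height j to 0, by the first step. Rises
  beyond l may be left out: from there height 0 is out of reach in the remaining steps.\<close>

fun luk_sum :: "real \<Rightarrow> (nat \<Rightarrow> real) \<Rightarrow> nat \<Rightarrow> nat \<Rightarrow> real" where
  "luk_sum g v 0 j = (if j = 0 then 1 else 0)"
| "luk_sum g v (Suc l) j = (if j = 0 then 0 else luk_sum g v l (j - 1)) + real j * g * luk_sum g v l j
     + (\<Sum>k=1..l. v k * luk_sum g v l (j + k))"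

definition luk_paths_from :: "nat \<Rightarrow> nat \<Rightarrow> nat list set" where
  "luk_paths_from l i = {y. length y = Suc l \<and> y ! 0 = i \<and> y ! l = 0 \<and>
     (\<forall>j<l. y ! j \<le> Suc (y ! Suc j)) \<and> \<not> (\<exists>j<l. y ! j = 0 \<and> y ! Suc j = 0)}"

definition path_weight :: "real \<Rightarrow> (nat \<Rightarrow> real) \<Rightarrow> nat list \<Rightarrow> real" where
  "path_weight g v y = (\<Prod>j<length y - 1. luk_weight g v (y ! j) (y ! Suc j))"

lemma luk_paths_eq: "luk_paths l = luk_paths_from l 0"
proof -
  have *: "{1..l} = Suc ` {..<l}" by (simp add: image_Suc_lessThan)
  have "(- 1 \<le> int b - int a) = (a \<le> Suc b)" for a b by linarith
  then show ?thesis
    unfolding luk_paths_def luk_paths_from_def * ball_simps bex_simps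
    by (auto simp: Ball_def Bex_def)
qed

lemma luk_paths_from_height:
  assumes "y \<in> luk_paths_from l i" "j \<le> l"
  shows "y ! j \<le> l - j"
  using \<open>j \<le> l\<close>
proof (induction rule: inc_induct)
  case base then show ?case using assms by (simp add: luk_paths_from_def)
next
  case (step n)
  then have "y ! n \<le> Suc (y ! Suc n)" using assms by (simp add: luk_paths_from_def)
  then show ?case using step by linarith
qed

lemma finite_luk_paths_from: "finite (luk_paths_from l i)"
proof (rule finite_subset)
  show "luk_paths_from l i \<subseteq> {y. set y \<subseteq> {..l} \<and> length y = Suc l}"
  proof
    fix y assume y: "y \<in> luk_paths_from l i"
    have "y ! j \<le> l" if "j < length y" for j
      using luk_paths_from_height[OF y, of j] that y by (simp add: luk_paths_from_def)
    then show "y \<in> {y. set y \<subseteq> {..l} \<and> length y = Suc l}"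
      using y by (auto simp: luk_paths_from_def in_set_conv_nth)
  qed
  show "finite {y. set y \<subseteq> {..l} \<and> length y = Suc l}" by (rule finite_lists_length_eq) simp
qed

lemma luk_paths_from_Suc:
  "luk_paths_from (Suc l) i = (\<Union>k\<in>{k. i \<le> Suc k \<and> k \<le> l \<and> \<not> (i = 0 \<and> k = 0)}. (#) i ` luk_paths_from l k)"
  (is "?L = ?R")
proof (intro equalityI subsetI)
  fix y assume y: "y \<in> ?L"
  then obtain z where z: "y = i # z" by (cases y) (auto simp: luk_paths_from_def)
  have zl: "length z = Suc l" "z ! l = 0" using y z by (auto simp: luk_paths_from_def)
  have st: "y ! j \<le> Suc (y ! Suc j)" "\<not> (y ! j = 0 \<and> y ! Suc j = 0)" if "j < Suc l" for j
    using y that by (auto simp: luk_paths_from_def)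
  have "z \<in> luk_paths_from l (z ! 0)"
    using zl st[of "Suc j" for j] z by (fastforce simp: luk_paths_from_def)
  moreover have "i \<le> Suc (z ! 0)" "\<not> (i = 0 \<and> z ! 0 = 0)" using st[of 0] z by auto
  moreover have "z ! 0 \<le> l" using luk_paths_from_height[OF y, of 1] z by simp
  ultimately show "y \<in> ?R" using z by blast
next
  fix y assume "y \<in> ?R"
  then obtain k z where k: "i \<le> Suc k" "\<not> (i = 0 \<and> k = 0)" and z: "z \<in> luk_paths_from l k" and y: "y = i # z"
    by blast
  then show "y \<in> ?L" by (auto simp: luk_paths_from_def nth_Cons split: nat.splits)
qed

lemma path_weight_Cons:
  assumes "y \<in> luk_paths_from l k"
  shows "path_weight g v (i # y) = luk_weight g v i k * path_weight g v y"
proof -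
  have l: "length y = Suc l" "y ! 0 = k" using assms by (auto simp: luk_paths_from_def)
  show ?thesis unfolding path_weight_def using l by (simp add: prod.lessThan_Suc_shift del: prod.lessThan_Suc)
qed

lemma luk_paths_from_high: "l < i \<Longrightarrow> luk_paths_from l i = {}"
  using luk_paths_from_height[of _ l i 0] by (fastforce simp: luk_paths_from_def)

lemma sum_path_weight: "(\<Sum>y\<in>luk_paths_from l i. path_weight g v y) = luk_sum g v l i"
proof (induction l arbitrary: i)
  case 0
  have "luk_paths_from 0 i = (if i = 0 then {[0]} else {})"
    by (auto simp: luk_paths_from_def length_Suc_conv)
  then show ?case by (simp add: path_weight_def)
next
  case (Suc l)
  define K where "K = {k. i \<le> Suc k \<and> k \<le> l \<and> \<not> (i = 0 \<and> k = 0)}"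
  have "finite K" by (rule finite_subset[of _ "{..l}"]) (auto simp: K_def)
  have inj: "inj_on ((#) i) A" for A by (auto simp: inj_on_def)
  have "(\<Sum>y\<in>luk_paths_from (Suc l) i. path_weight g v y) =
      (\<Sum>k\<in>K. \<Sum>y\<in>(#) i ` luk_paths_from l k. path_weight g v y)"
    unfolding luk_paths_from_Suc K_def[symmetric]
  proof (rule sum.UNION_disjoint[OF \<open>finite K\<close>])
    show "\<forall>k\<in>K. finite ((#) i ` luk_paths_from l k)" by (simp add: finite_luk_paths_from)
    show "\<forall>k\<in>K. \<forall>k'\<in>K. k \<noteq> k' \<longrightarrow> (#) i ` luk_paths_from l k \<inter> (#) i ` luk_paths_from l k' = {}"
      by (auto simp: luk_paths_from_def)
  qed
  also have "\<dots> = (\<Sum>k\<in>K. luk_weight g v i k * luk_sum g v l k)"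
    by (intro sum.cong refl)
      (simp add: sum.reindex[OF inj] path_weight_Cons sum_distrib_left[symmetric] Suc.IH)
  \<comment> \<open>The added terms vanish: either the step has weight 0, which includes the level
    step at height 0, or k > l and no path leads down from k.\<close>
  also have "\<dots> = (\<Sum>k\<le>i + l. luk_weight g v i k * luk_sum g v l k)"
  proof (rule sum.mono_neutral_left)
    have z: "luk_sum g v l k = 0" if "l < k" for k
      using Suc.IH[of k] luk_paths_from_high[OF that] by simp
    show "\<forall>k\<in>{..i + l} - K. luk_weight g v i k * luk_sum g v l k = 0"
    proof
      fix k assume "k \<in> {..i + l} - K"
      then have "luk_weight g v i k = 0 \<or> l < k" by (auto simp: K_def luk_weight_def)
      then show "luk_weight g v i k * luk_sum g v l k = 0" using z by auto
    qed
  qed (auto simp: K_def)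
  also have "{..i + l} = {..<i} \<union> {i} \<union> {i + 1..i + l}" by auto
  also have "(\<Sum>k\<in>\<dots>. luk_weight g v i k * luk_sum g v l k) =
     (\<Sum>k<i. luk_weight g v i k * luk_sum g v l k) + real i * g * luk_sum g v l i +
     (\<Sum>k\<in>{i + 1..i + l}. luk_weight g v i k * luk_sum g v l k)"
    by (subst sum.union_disjoint; auto simp: luk_weight_def)+
  also have "(\<Sum>k\<in>{i + 1..i + l}. luk_weight g v i k * luk_sum g v l k) =
     (\<Sum>k=1..l. v k * luk_sum g v l (i + k))"
    by (rule sum.reindex_bij_witness[of _ "\<lambda>k. i + k" "\<lambda>k. k - i"]) (auto simp: luk_weight_def)
  also have "(\<Sum>k<i. luk_weight g v i k * luk_sum g v l k) = (if i = 0 then 0 else luk_sum g v l (i - 1))"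
  proof (cases i)
    case (Suc j)
    have "(\<Sum>k<j. luk_weight g v i k * luk_sum g v l k) = 0"
      by (intro sum.neutral) (auto simp: luk_weight_def Suc)
    then show ?thesis by (simp add: Suc luk_weight_def)
  qed simp
  finally show ?case by simp
qed

text \<open>Exchanging the products regroups the factors by steps. A level step at height a
  contributes only to i = a, a rise by s only to i = s, a descent to none; as i starts at 1, level
  steps are not counted as rises.\<close>

lemma path_weight_eq:
  assumes y: "y \<in> luk_paths l"
  shows "(\<Prod>i=1..l. (real i * g) ^ card (horizontal_steps i y) * v i ^ card (up_steps i y)) = path_weight g v y"
proof -
  have y': "y \<in> luk_paths_from l 0" using y luk_paths_eq by simp
  have len: "length y = Suc l" using y by (simp add: luk_paths_def)
  define w where "w i j = (if y ! j = i \<and> y ! Suc j = i then real i * g else 1) *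
    (if y ! Suc j = y ! j + i then v i else 1)" for i j
  have card_pow: "c ^ card (Suc ` {j. j < l \<and> Q j}) = (\<Prod>j<l. if Q j then c else 1)" for Q and c :: real
  proof -
    have "(\<Prod>j<l. if Q j then c else 1) = (\<Prod>j\<in>{..<l} \<inter> {j. Q j}. c)"
      by (simp add: prod.If_cases)
    also have "{..<l} \<inter> {j. Q j} = {j. j < l \<and> Q j}" by auto
    finally show ?thesis by (simp add: card_image)
  qed
  have h: "horizontal_steps i y = Suc ` {j. j < l \<and> y ! j = i \<and> y ! Suc j = i}" for i
    unfolding horizontal_steps_def len by (auto simp: image_iff less_Suc_eq_0_disj)
  have u: "up_steps i y = Suc ` {j. j < l \<and> y ! Suc j = y ! j + i}" for i
    unfolding up_steps_def len by (auto simp: image_iff less_Suc_eq_0_disj)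
  have "(\<Prod>i=1..l. (real i * g) ^ card (horizontal_steps i y) * v i ^ card (up_steps i y)) =
      (\<Prod>i=1..l. \<Prod>j<l. w i j)"
    unfolding h u card_pow prod.distrib[symmetric] w_def ..
  also have "\<dots> = (\<Prod>j<l. \<Prod>i=1..l. w i j)" by (rule prod.swap)
  also have "\<dots> = (\<Prod>j<l. luk_weight g v (y ! j) (y ! Suc j))"
  proof (intro prod.cong refl)
    fix j assume j: "j \<in> {..<l}"
    let ?a = "y ! j" and ?b = "y ! Suc j"
    have st: "?a \<le> Suc ?b" "\<not> (?a = 0 \<and> ?b = 0)" using y' j by (auto simp: luk_paths_from_def)
    have ab: "?a \<le> l" "?b \<le> l"
      using luk_paths_from_height[OF y', of j] luk_paths_from_height[OF y', of "Suc j"] j by auto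
    consider "?a = ?b" | "?a < ?b" | "?a = Suc ?b" using st by linarith
    then show "(\<Prod>i=1..l. w i j) = luk_weight g v ?a ?b"
    proof cases
      case 1
      then have "(\<Prod>i=1..l. w i j) = (\<Prod>i=1..l. if i = ?a then real ?a * g else 1)"
        by (intro prod.cong) (auto simp: w_def)
      then show ?thesis using 1 st ab by (auto simp: luk_weight_def)
    next
      case 2
      then have "(\<Prod>i=1..l. w i j) = (\<Prod>i=1..l. if i = ?b - ?a then v (?b - ?a) else 1)"
        by (intro prod.cong) (auto simp: w_def)
      then show ?thesis using 2 st ab by (auto simp: luk_weight_def)
    next
      case 3
      then have "(\<Prod>i=1..l. w i j) = (\<Prod>i=1..l. 1)"
        by (intro prod.cong) (auto simp: w_def)
      then show ?thesis using 3 by (auto simp: luk_weight_def)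
    qed
  qed
  finally show ?thesis by (simp add: path_weight_def len)
qed

lemma path_moment_eq_luk_sum: "path_moment g v l = luk_sum g v l 0"
  unfolding path_moment_def sum_path_weight[symmetric] luk_paths_eq[symmetric]
  by (intro sum.cong refl path_weight_eq)

lemma luk_sum_high: "l < j \<Longrightarrow> luk_sum g v l j = 0"
  using sum_path_weight[of g v l j] luk_paths_from_high by simp

section \<open>Moment functionals\<close>

lemma alternating_sum_bounds:
  fixes t :: "nat \<Rightarrow> real"
  assumes "\<And>m. t m \<ge> 0" "\<And>m. t (Suc m) \<le> t m"
  shows "0 \<le> (\<Sum>m\<le>j. (-1) ^ m * t m) \<and> (\<Sum>m\<le>j. (-1) ^ m * t m) \<le> t 0 \<and> t 0 - t 1 \<le> (\<Sum>m\<le>j. (-1) ^ m * t m)"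
  using assms
proof (induction j arbitrary: t)
  case (Suc j)
  have "(\<Sum>m\<le>Suc j. (-1) ^ m * t m) = t 0 - (\<Sum>m\<le>j. (-1) ^ m * t (Suc m))"
    by (subst sum.atMost_Suc_shift) (simp add: sum_negf)
  moreover note Suc.IH[of "\<lambda>m. t (Suc m)", OF Suc.prems]
  ultimately show ?case using Suc.prems(2)[of 0] Suc.prems(1)[of "Suc (Suc 0)"] Suc.prems(2)[of 1]
    by (simp del: sum.atMost_Suc)
qed simp

text \<open>Induction on the integer part of y by Pascal's rule: each unit of y doubles the bound.
  For 0 \<le> y < 1 the factors y - i of the numerator are at most i + 1 in absolute value.\<close>

lemma abs_gbinomial_le:
  fixes y :: real
  assumes "y \<ge> 0"
  shows "\<bar>y gchoose n\<bar> \<le> 2 powr y"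
proof -
  have "\<bar>y gchoose n\<bar> \<le> 2 powr y" if "real k \<le> y" "y < real k + 1" for k
    using that
  proof (induction k arbitrary: y n)
    case 0
    have "\<bar>\<Prod>i=0..<n. y - real i\<bar> \<le> (\<Prod>i=0..<n. real (Suc i))"
      unfolding abs_prod using 0 by (intro prod_mono) auto
    also have "(\<Prod>i=0..<n. real (Suc i)) = fact n"
      by (simp add: fact_prod_Suc)
    finally have "\<bar>y gchoose n\<bar> \<le> 1"
      by (simp add: gbinomial_prod_rev divide_le_eq)
    also have "1 \<le> 2 powr y" using 0 by (simp add: ge_one_powr_ge_zero)
    finally show ?case .
  next
    case (Suc k)
    have IH: "\<bar>(y - 1) gchoose n\<bar> \<le> 2 powr (y - 1)" for n using Suc by (intro Suc.IH) auto
    have p: "2 powr y = 2 powr (y - 1) + 2 powr (y - 1)" by (simp add: powr_diff)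
    show ?case
    proof (cases n)
      case 0 then show ?thesis using Suc.prems by (simp add: ge_one_powr_ge_zero)
    next
      case (Suc m)
      have "y gchoose n = ((y - 1) gchoose m) + ((y - 1) gchoose Suc m)"
        using gbinomial_Suc_Suc[of "y - 1" m] by (simp add: Suc)
      then show ?thesis using IH[of m] IH[of "Suc m"] p by linarith
    qed
  qed
  moreover have "real (nat \<lfloor>y\<rfloor>) \<le> y" "y < real (nat \<lfloor>y\<rfloor>) + 1" using assms by linarith+
  ultimately show ?thesis by blast
qed

text \<open>For m \<le> y the product is a binomial coefficient of y - m times a factorial; for m >
  y each factor is at most i. The case m = 0 splits off a factor y. The rate 4/5 is 7/10 + 1/10: ln
  2 \<le> 25/36 < 7/10 bounds 2 powr y, and 1 + y \<le> 10 exp (y / 10).\<close>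

lemma abs_shifted_product_le:
  fixes y :: real
  assumes "y \<ge> 0" "m \<le> j"
  shows "\<bar>\<Prod>i=m..j. y - real i\<bar> * fact (m - 1) \<le> 10 * exp (4 / 5 * y) * fact j"
proof -
  have pw: "2 powr z \<le> exp (7 / 10 * z)" if "z \<ge> 0" for z :: real
  proof -
    have "ln 2 * z \<le> 7 / 10 * z" using that ln2_le_25_over_36 by (intro mult_right_mono) auto
    then show ?thesis by (simp add: powr_def mult.commute)
  qed
  have key: "1 + y \<le> 10 * exp (y / 10)" using exp_ge_add_one_self[of "y / 10"] assms by linarith
  have ex: "exp (4 / 5 * y) = exp (y / 10) * exp (7 / 10 * y)" by (simp flip: exp_add)
  have main: "(1 + y) * 2 powr y \<le> 10 * exp (4 / 5 * y)"
  proof -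
    have "(1 + y) * 2 powr y \<le> (10 * exp (y / 10)) * exp (7 / 10 * y)"
      using key pw[OF assms(1)] assms by (intro mult_mono) auto
    then show ?thesis by (simp only: ex mult.assoc)
  qed
  have one: "1 \<le> (1 + y) * 2 powr y"
    using assms ge_one_powr_ge_zero[of 2 y] mult_mono[of 1 "1 + y" 1 "2 powr y"] by simp
  have gb: "\<bar>\<Prod>i=m..j. y - real i\<bar> \<le> 2 powr y * fact (Suc j - m)" if "real m \<le> y" for m y
  proof (cases "m \<le> j")
    case True
    have "(\<Prod>i=m..j. y - real i) = (\<Prod>i=0..<Suc j - m. y - real m - real i)"
      by (rule prod.reindex_bij_witness[of _ "\<lambda>i. i + m" "\<lambda>i. i - m"]) (use True in auto)
    also have "\<dots> = ((y - real m) gchoose (Suc j - m)) * fact (Suc j - m)"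
      by (simp add: gbinomial_prod_rev)
    finally have "\<bar>\<Prod>i=m..j. y - real i\<bar> = \<bar>(y - real m) gchoose (Suc j - m)\<bar> * fact (Suc j - m)"
      by (simp add: abs_mult)
    also have "\<dots> \<le> 2 powr (y - real m) * fact (Suc j - m)"
      using that by (intro mult_right_mono abs_gbinomial_le) auto
    also have "\<dots> \<le> 2 powr y * fact (Suc j - m)" by (intro mult_right_mono) auto
    finally show ?thesis .
  next
    case False
    then have "Suc j - m = 0 \<and> {m..j} = {}" by auto
    then show ?thesis using that ge_one_powr_ge_zero[of 2 y] by simp
  qed
  have small: "\<bar>\<Prod>i=m..j. y - real i\<bar> * fact (m - 1) \<le> fact j" if "y < real m" "m \<ge> 1" "m \<le> j" for m
  proof -
    have "\<bar>\<Prod>i=m..j. y - real i\<bar> \<le> (\<Prod>i=m..j. real i)"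
      unfolding abs_prod using that assms by (intro prod_mono) auto
    moreover have "fact (m - 1) * (\<Prod>i=m..j. real i) = (fact j :: real)"
    proof -
      have "{1..j} = {1..m - 1} \<union> {m..j}" using that by auto
      then have "(\<Prod>i=1..j. real i) = (\<Prod>i=1..m - 1. real i) * (\<Prod>i=m..j. real i)"
        using that by (simp add: prod.union_disjoint)
      then show ?thesis by (simp add: fact_prod)
    qed
    ultimately show ?thesis
      by (metis fact_ge_zero mult.commute mult_left_mono)
  qed
  have "\<bar>\<Prod>i=m..j. y - real i\<bar> * fact (m - 1) \<le> (1 + y) * 2 powr y * fact j"
  proof (cases "m = 0")
    case True
    have split: "{0..j} = insert 0 {1..j}" by auto
    have "\<bar>\<Prod>i=0..j. y - real i\<bar> = y * \<bar>\<Prod>i=1..j. y - real i\<bar>"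
      unfolding split using assms by (simp add: abs_mult)
    also have "\<bar>\<Prod>i=1..j. y - real i\<bar> \<le> 2 powr y * fact j"
    proof (cases "y \<ge> 1")
      case False
      show ?thesis
      proof (cases "j = 0")
        case True then show ?thesis using assms by (simp add: ge_one_powr_ge_zero)
      next
        case j: False
        have "1 * fact j \<le> 2 powr y * (fact j :: real)"
          using assms by (intro mult_right_mono) (auto simp: ge_one_powr_ge_zero)
        moreover have "\<bar>\<Prod>i=1..j. y - real i\<bar> \<le> fact j" using small[of 1] False j by simp
        ultimately show ?thesis by linarith
      qed
    qed (use gb[of 1 y] in simp)
    then have "y * \<bar>\<Prod>i=1..j. y - real i\<bar> \<le> y * (2 powr y * fact j)"
      using assms by (intro mult_left_mono)
    also have "\<dots> \<le> (1 + y) * 2 powr y * fact j" by (simp add: algebra_simps)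
    finally show ?thesis using True by simp
  next
    case False
    show ?thesis
    proof (cases "real m \<le> y")
      case True
      have "fact (Suc j - m) * fact (m - 1) \<le> (fact j :: nat)"
      proof -
        have "Suc j - m + (m - 1) = j" using False assms(2) by simp
        then show ?thesis by (metis fact_fact_dvd_fact dvd_imp_le fact_gt_zero)
      qed
      then have f: "fact (Suc j - m) * fact (m - 1) \<le> (fact j :: real)"
        by (metis of_nat_fact of_nat_le_iff of_nat_mult)
      have "\<bar>\<Prod>i=m..j. y - real i\<bar> * fact (m - 1) \<le> 2 powr y * fact (Suc j - m) * fact (m - 1)"
        using gb[OF True] by (intro mult_right_mono) auto
      also have "\<dots> \<le> 2 powr y * fact j" using f by (simp add: mult.assoc)
      also have "\<dots> \<le> (1 + y) * 2 powr y * fact j"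
        using assms by (intro mult_right_mono) (auto simp: algebra_simps)
      finally show ?thesis .
    next
      case F: False
      have "1 * fact j \<le> (1 + y) * 2 powr y * (fact j :: real)" using one by (intro mult_right_mono) auto
      moreover have "\<bar>\<Prod>i=m..j. y - real i\<bar> * fact (m - 1) \<le> fact j"
        by (rule small) (use F False assms in auto)
      ultimately show ?thesis by linarith
    qed
  qed
  also have "\<dots> \<le> 10 * exp (4 / 5 * y) * fact j" using main by (intro mult_right_mono) auto
  finally show ?thesis .
qed

text \<open>By the product formula for the reciprocal Gamma function the ratio behaves like Gamma b
  / Gamma a * n^(a - b).\<close>

lemma pochhammer_ratio_tendsto_0:
  fixes a b :: real
  assumes "0 < a" "a < b"
  shows "(\<lambda>n. pochhammer a (Suc n) / pochhammer b (Suc n)) \<longlonglongrightarrow> 0"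
proof -
  have "(\<lambda>n. rGamma_series a n / rGamma_series b n * exp ((a - b) * ln (real n))) \<longlonglongrightarrow>
      rGamma a / rGamma b * 0"
  proof (intro tendsto_intros rGamma_series_LIMSEQ)
    show "rGamma b \<noteq> 0" using assms by (simp add: rGamma_eq_zero_iff nonpos_Ints_def)
    have "filterlim (\<lambda>n. (a - b) * ln (real n)) at_bot sequentially"
      using assms by (intro filterlim_tendsto_neg_mult_at_bot[OF tendsto_const]
        filterlim_compose[OF ln_at_top] filterlim_real_sequentially) auto
    then show "(\<lambda>n. exp ((a - b) * ln (real n))) \<longlonglongrightarrow> 0"
      by (rule filterlim_compose[OF exp_at_bot])
  qed
  moreover have "\<forall>\<^sub>F n in sequentially. rGamma_series a n / rGamma_series b n * exp ((a - b) * ln (real n)) =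
      pochhammer a (Suc n) / pochhammer b (Suc n)"
  proof (intro always_eventually allI)
    fix n
    have "pochhammer b (Suc n) > 0" using assms by (intro pochhammer_pos) auto
    then show "rGamma_series a n / rGamma_series b n * exp ((a - b) * ln (real n)) =
      pochhammer a (Suc n) / pochhammer b (Suc n)"
      by (simp add: rGamma_series_def field_simps exp_diff left_diff_distrib)
  qed
  ultimately show ?thesis by (auto dest: Lim_transform_eventually)
qed

text \<open>The coefficients of \<open>exp (\<Sum> v\<^sub>k z\<^sup>k / (k g))\<close>, through its logarithmic derivative.\<close>

fun exp_coeff :: "real \<Rightarrow> (nat \<Rightarrow> real) \<Rightarrow> nat \<Rightarrow> real" where
  "exp_coeff g v 0 = 1"
| "exp_coeff g v (Suc m) = (\<Sum>k\<le>m. v (Suc k) * exp_coeff g v (m - k)) / (g * real (Suc m))"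

text \<open>In closed form F_j times the sum of e_m / F_m over m \<le> j. The constant added at each
  stage supplies the entry at height 0 that multiplication by x - j g leaves empty.\<close>

fun Y_poly :: "real \<Rightarrow> (nat \<Rightarrow> real) \<Rightarrow> nat \<Rightarrow> real poly" where
  "Y_poly g v 0 = 1"
| "Y_poly g v (Suc j) = [:- (real j * g), 1:] * Y_poly g v j + [:exp_coeff g v (Suc j):]"

definition T_poly :: "real \<Rightarrow> (nat \<Rightarrow> real) \<Rightarrow> nat \<Rightarrow> real poly" where
  "T_poly g v j = [:- (real j * g), 1:] * Y_poly g v j"

text \<open>
  The weighted number of ways down to height 0 from height \<open>i\<close>, extended linearly from monomials \<open>x\<^sup>l\<close>
  (paths of length \<open>l\<close>); its value at \<open>i = 0\<close> is the integral.
\<close>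

definition luk_functional :: "real \<Rightarrow> (nat \<Rightarrow> real) \<Rightarrow> real poly \<Rightarrow> nat \<Rightarrow> real" where
  "luk_functional g v p i = (\<Sum>l\<le>degree p. coeff p l * luk_sum g v l i)"

lemma luk_functional_alt:
  "degree p \<le> N \<Longrightarrow> luk_functional g v p i = (\<Sum>l\<le>N. coeff p l * luk_sum g v l i)"
  unfolding luk_functional_def by (rule sum.mono_neutral_left) (auto simp: coeff_eq_0)

lemma luk_functional_add:
  "luk_functional g v (p + q) i = luk_functional g v p i + luk_functional g v q i"
proof -
  let ?N = "max (degree p) (degree q)"
  show ?thesis using degree_add_le_max[of p q]
    by (simp add: luk_functional_alt[of p ?N] luk_functional_alt[of q ?N] luk_functional_alt[of "p + q" ?N]
      algebra_simps sum.distrib)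
qed

lemma luk_functional_smult: "luk_functional g v (smult c p) i = c * luk_functional g v p i"
  using degree_smult_le[of c p]
  by (simp add: luk_functional_alt[of "smult c p" "degree p"] luk_functional_def sum_distrib_left mult.assoc)

lemma luk_functional_const: "luk_functional g v [:c:] i = (if i = 0 then c else 0)"
  by (simp add: luk_functional_def)

text \<open>Multiplication by x lengthens all paths by one step, so the recursion of
  \<open>luk_sum\<close> becomes an operator on sequences of heights. The common range 1..K works
  for all lengths because the extra values of \<open>luk_sum\<close> are 0.\<close>

lemma luk_functional_shift:
  assumes "degree p \<le> K"
  shows "luk_functional g v (pCons 0 p) i = (if i = 0 then 0 else luk_functional g v p (i - 1)) +
    real i * g * luk_functional g v p i + (\<Sum>k=1..K. v k * luk_functional g v p (i + k))"
proof -
  have "luk_functional g v (pCons 0 p) i = (\<Sum>l\<le>Suc K. coeff (pCons 0 p) l * luk_sum g v l i)"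
    using assms by (intro luk_functional_alt) (auto intro: order_trans[OF degree_pCons_le])
  also have "\<dots> = (\<Sum>l\<le>K. coeff p l * luk_sum g v (Suc l) i)"
    by (subst sum.atMost_Suc_shift) (simp del: luk_sum.simps)
  also have "\<dots> = (\<Sum>l\<le>K. coeff p l * ((if i = 0 then 0 else luk_sum g v l (i - 1)) +
      real i * g * luk_sum g v l i + (\<Sum>k=1..K. v k * luk_sum g v l (i + k))))"
  proof (intro sum.cong refl arg_cong2[where f = "(*)"])
    fix l assume "l \<in> {..K}"
    then have "(\<Sum>k=1..l. v k * luk_sum g v l (i + k)) = (\<Sum>k=1..K. v k * luk_sum g v l (i + k))"
      by (intro sum.mono_neutral_left) (auto simp: luk_sum_high)
    then show "luk_sum g v (Suc l) i = (if i = 0 then 0 else luk_sum g v l (i - 1)) +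
      real i * g * luk_sum g v l i + (\<Sum>k=1..K. v k * luk_sum g v l (i + k))" by simp
  qed
  also have "\<dots> = (if i = 0 then 0 else luk_functional g v p (i - 1)) +
    real i * g * luk_functional g v p i + (\<Sum>k=1..K. v k * luk_functional g v p (i + k))"
  proof -
    have "(\<Sum>l\<le>K. coeff p l * (\<Sum>k=1..K. v k * luk_sum g v l (i + k))) =
        (\<Sum>k=1..K. v k * luk_functional g v p (i + k))"
      unfolding luk_functional_alt[OF assms] sum_distrib_left
      by (subst sum.swap) (simp add: mult_ac)
    then show ?thesis
      by (auto simp: luk_functional_alt[OF assms] distrib_left sum.distrib sum_distrib_left mult_ac)
  qed
  finally show ?thesis .
qed

text \<open>These inequalities are all that the sequel retains from the Jack functions.\<close>

locale jack_sequence =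
  fixes g :: real and v :: "nat \<Rightarrow> real"
  assumes g_pos: "g > 0" and v_nonneg: "k \<ge> 1 \<Longrightarrow> 0 \<le> v k"
    and v_Suc_le: "k \<ge> 1 \<Longrightarrow> v (Suc k) \<le> v k" and v_1: "v 1 = 1"
begin

lemma v_le_1: "k \<ge> 1 \<Longrightarrow> v k \<le> 1"
proof (induction k rule: dec_induct)
  case base then show ?case using v_1 by simp
next
  case (step k) then show ?case using v_Suc_le[of k] by linarith
qed

abbreviation e :: "nat \<Rightarrow> real" where "e \<equiv> exp_coeff g v"

lemma e_rec: "real m * g * e m = (\<Sum>k=1..m. v k * e (m - k))"
proof (cases m)
  case (Suc n)
  have "real m * g * e m = (\<Sum>k\<le>n. v (Suc k) * e (n - k))"
    using g_pos Suc by (simp del: of_nat_Suc)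
  also have "\<dots> = (\<Sum>k=1..m. v k * e (m - k))"
    by (rule sum.reindex_bij_witness[of _ "\<lambda>k. k - 1" Suc]) (auto simp: Suc)
  finally show ?thesis .
qed simp

lemma e_nonneg: "e m \<ge> 0"
proof (induction m rule: less_induct)
  case (less m)
  show ?case
  proof (cases m)
    case (Suc n)
    have "(\<Sum>k\<le>n. v (Suc k) * e (n - k)) \<ge> 0"
      by (intro sum_nonneg mult_nonneg_nonneg v_nonneg less) (auto simp: Suc)
    then show ?thesis using g_pos by (simp add: Suc)
  qed simp
qed

text \<open>In the recurrence for e (m + 1), replacing v (k + 1) by v k reproduces the recurrence
  for e m; the leading term v 1 = 1 adds e m once more.\<close>

lemma e_Suc_le: "real (Suc m) * e (Suc m) \<le> (1 / g + real m) * e m"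
proof -
  have "real (Suc m) * g * e (Suc m) = (\<Sum>k=0..m. v (Suc k) * e (m - k))"
    unfolding e_rec by (rule sum.reindex_bij_witness[of _ Suc "\<lambda>k. k - 1"]) auto
  also have "\<dots> = e m + (\<Sum>k=1..m. v (Suc k) * e (m - k))"
    using v_1 by (simp add: sum.atLeast_Suc_atMost)
  also have "\<dots> \<le> e m + (\<Sum>k=1..m. v k * e (m - k))"
    by (intro add_left_mono sum_mono mult_right_mono v_Suc_le e_nonneg) auto
  also have "\<dots> = e m + real m * g * e m" by (simp add: e_rec)
  finally show ?thesis using g_pos by (simp add: field_simps)
qed

lemma e_le_power: "e m \<le> (1 + 1 / g) ^ m"
proof (induction m)
  case (Suc m)
  have "real (Suc m) * e (Suc m) \<le> (1 / g + real m) * e m" by (rule e_Suc_le)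
  also have "\<dots> \<le> (real (Suc m) * (1 + 1 / g)) * e m"
    using g_pos by (intro mult_right_mono e_nonneg) (auto simp: algebra_simps)
  finally have "e (Suc m) \<le> (1 + 1 / g) * e m" by (simp del: exp_coeff.simps of_nat_Suc)
  also have "\<dots> \<le> (1 + 1 / g) * (1 + 1 / g) ^ m"
    using Suc g_pos by (intro mult_left_mono) auto
  finally show ?case by simp
qed simp

text \<open>The sequence i |-> e (j - i) is almost an eigenvector of the operator in
  \<open>luk_functional_shift\<close>: level steps give i g e (j - i), rises give (j - i) g e (j -
  i) by \<open>e_rec\<close>, together j g e (j - i). Subtracting j g leaves the descents, that is e
  (j + 1 - i) for i \<ge> 1 and 0 at height 0. The latter is why \<open>T_poly\<close> integrates to
  0; adding the constant e (j + 1) restores the pattern for j + 1.\<close>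

lemma Y_poly_functional:
  "luk_functional g v (Y_poly g v j) i = (if i \<le> j then e (j - i) else 0)"
  and T_poly_functional:
  "luk_functional g v (T_poly g v j) i = (if 1 \<le> i \<and> i \<le> Suc j then e (Suc j - i) else 0)"
proof -
  have T: "luk_functional g v (T_poly g v j) i = (if 1 \<le> i \<and> i \<le> Suc j then e (Suc j - i) else 0)"
    if Y: "\<And>i. luk_functional g v (Y_poly g v j) i = (if i \<le> j then e (j - i) else 0)" for i j
  proof -
    define K where "K = max (degree (Y_poly g v j)) j"
    have "T_poly g v j = pCons 0 (Y_poly g v j) + smult (- (real j * g)) (Y_poly g v j)"
      by (simp add: T_poly_def)
    then have "luk_functional g v (T_poly g v j) i = luk_functional g v (pCons 0 (Y_poly g v j)) i
        + - (real j * g) * luk_functional g v (Y_poly g v j) i"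
      by (simp only: luk_functional_add luk_functional_smult)
    then have "luk_functional g v (T_poly g v j) i =
      (if i = 0 then 0 else luk_functional g v (Y_poly g v j) (i - 1)) + (real i - real j) * g * luk_functional g v (Y_poly g v j) i
      + (\<Sum>k=1..K. v k * luk_functional g v (Y_poly g v j) (i + k))"
      using luk_functional_shift[of "Y_poly g v j" K g v i]
      by (simp add: K_def algebra_simps)
    also have "(\<Sum>k=1..K. v k * luk_functional g v (Y_poly g v j) (i + k)) =
        (\<Sum>k=1..j - i. v k * e (j - i - k))"
      by (intro sum.mono_neutral_cong_right) (auto simp: Y K_def intro!: arg_cong[where f = e])
    also have "\<dots> = real (j - i) * g * e (j - i)" by (simp add: e_rec)
    finally have *: "luk_functional g v (T_poly g v j) i =
      (if i = 0 then 0 else luk_functional g v (Y_poly g v j) (i - 1)) +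
      (real i - real j) * g * luk_functional g v (Y_poly g v j) i + real (j - i) * g * e (j - i)" .
    consider "i = 0" | "1 \<le> i" "i \<le> j" | "i = Suc j" | "i > Suc j" by linarith
    then show ?thesis
    proof cases
      case 2
      then have "j - (i - 1) = Suc j - i" by simp
      then show ?thesis unfolding * Y using 2 by (simp add: of_nat_diff algebra_simps)
    qed (unfold * Y, simp_all)
  qed
  have Y: "\<forall>i. luk_functional g v (Y_poly g v j) i = (if i \<le> j then e (j - i) else 0)" for j
  proof (induction j)
    case 0 then show ?case by (simp add: luk_functional_const one_pCons)
  next
    case (Suc j)
    have "Y_poly g v (Suc j) = T_poly g v j + [:e (Suc j):]" by (simp add: T_poly_def)
    then show ?case using Suc by (auto simp: luk_functional_add luk_functional_const T simp del: exp_coeff.simps Y_poly.simps)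
  qed
  then show "luk_functional g v (Y_poly g v j) i = (if i \<le> j then e (j - i) else 0)" by blast
  show "luk_functional g v (T_poly g v j) i = (if 1 \<le> i \<and> i \<le> Suc j then e (Suc j - i) else 0)"
    using Y by (intro T) blast
qed

abbreviation T :: "nat \<Rightarrow> real \<Rightarrow> real" where "T j x \<equiv> poly (T_poly g v j) x"

lemma T_0: "T 0 x = x" by (simp add: T_poly_def)

lemma T_Suc: "T (Suc j) x = (x - real (Suc j) * g) * (T j x + e (Suc j))"
  by (simp add: T_poly_def algebra_simps del: exp_coeff.simps)

lemma T_eq: "T j x = (\<Sum>m\<le>j. e m * (\<Prod>i=m..j. x - real i * g))"
proof (induction j)
  case (Suc j)
  have "(\<Sum>m\<le>j. e m * (\<Prod>i=m..Suc j. x - real i * g)) = (x - real (Suc j) * g) * T j x"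
    unfolding Suc sum_distrib_left by (intro sum.cong) (auto simp: mult_ac)
  then show ?case by (simp add: T_Suc algebra_simps del: exp_coeff.simps)
qed (simp add: T_0)

definition F :: "nat \<Rightarrow> 'a::real_normed_field \<Rightarrow> 'a" where
  "F m u = (\<Prod>i<m. u - of_real (real i * g))"

lemma F_Suc: "F (Suc m) u = F m u * (u - of_real (real m * g))"
  by (simp add: F_def)

lemma F_neg: "F m (- (r * g)) = (- g) ^ m * pochhammer r m"
  by (induction m) (simp_all add: F_def pochhammer_Suc algebra_simps)

lemma T_eq_F:
  assumes "x < 0"
  shows "T j x = F (Suc j) x * (\<Sum>m\<le>j. e m / F m x)"
  unfolding T_eq sum_distrib_left
proof (intro sum.cong refl)
  fix m assume m: "m \<in> {..j}"
  have nz: "x - real i * g \<noteq> 0" for i using assms g_pos by (smt (verit) mult_nonneg_nonneg of_nat_0_le_iff)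
  then have "F m x \<noteq> 0" by (simp add: F_def)
  moreover have "{..<Suc j} = {..<m} \<union> {m..j}" using m by auto
  then have "F (Suc j) x = F m x * (\<Prod>i=m..j. x - real i * g)"
    unfolding F_def by (simp add: prod.union_disjoint ivl_disj_int)
  ultimately show "e m * (\<Prod>i=m..j. x - real i * g) = F (Suc j) x * (e m / F m x)" by simp
qed

text \<open>The threshold in units of the step: \<open>- (1 / g)\<close> is
  \<open>- (\<rho> * g)\<close>.\<close>

definition \<rho> :: real where "\<rho> = 1 / g\<^sup>2"

lemma \<rho>_pos: "\<rho> > 0" using g_pos by (simp add: \<rho>_def)

lemma \<rho>_g: "\<rho> * g = 1 / g" using g_pos by (simp add: \<rho>_def power2_eq_square)

text \<open>To the left of \<open>- 1 / g\<close> the sum of \<open>e m / F m x\<close> alternates and its terms decrease.\<close>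

lemma alternating_e_sum:
  assumes "r \<ge> \<rho>"
  shows "1 - \<rho> / r \<le> (\<Sum>m\<le>j. e m / F m (- (r * g)))"
proof -
  have r: "r > 0" using assms \<rho>_pos by linarith
  define t where "t m = e m / (g ^ m * pochhammer r m)" for m
  have pos: "pochhammer r m > 0" for m using r by (intro pochhammer_pos)
  have t0: "t m \<ge> 0" for m using g_pos pos[of m] e_nonneg[of m] by (simp add: t_def)
  have t1: "t (Suc m) \<le> t m" for m
  proof -
    \<comment> \<open>1 / g \<le> g r accounts for 1 / g, and also for m / g after multiplication by
      m; the summand m is then covered by the inequality 1 / g + g \<ge> 2 of arithmetic and
      geometric means.\<close>
    have "1 / g + real m \<le> real (Suc m) * (g * (r + real m))"
    proof -
      have "1 / g \<le> g * r" using assms g_pos \<rho>_g by (metis mult.commute mult_le_cancel_left_pos)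
      moreover have "real m \<le> real m * (1 / g + g * (real m + 1))"
      proof -
        have "2 \<le> 1 / g + g" using g_pos sum_squares_bound[of 1 g] by (simp add: field_simps power2_eq_square)
        moreover have "g * (real m + 1) \<ge> g" using g_pos by simp
        ultimately have "1 \<le> 1 / g + g * (real m + 1)" by linarith
        from mult_left_mono[OF this, of "real m"] show ?thesis by simp
      qed
      moreover have "real m * (1 / g) \<le> real m * (g * r)" using calculation(1) by (intro mult_left_mono) auto
      ultimately show ?thesis by (simp add: algebra_simps)
    qed
    then have "real (Suc m) * e (Suc m) \<le> real (Suc m) * (g * (r + real m)) * e m"
      using e_Suc_le[of m] mult_right_mono[OF _ e_nonneg[of m]] by (meson order_trans)
    then have le: "e (Suc m) \<le> g * (r + real m) * e m" by (simp add: mult.assoc del: exp_coeff.simps of_nat_Suc)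
    have "t (Suc m) \<le> g * (r + real m) * e m / (g ^ Suc m * pochhammer r (Suc m))"
      unfolding t_def using le g_pos pos[of "Suc m"] by (intro divide_right_mono) auto
    also have "\<dots> = (g * (r + real m)) * e m / ((g * (r + real m)) * (g ^ m * pochhammer r m))"
      by (simp add: pochhammer_Suc mult_ac)
    also have "\<dots> = t m" using r g_pos unfolding t_def by (subst mult_divide_mult_cancel_left) auto
    finally show ?thesis .
  qed
  have "e m / F m (- (r * g)) = (-1) ^ m * t m" for m
    unfolding F_neg t_def by (simp add: power_minus[of g] divide_simps)
  moreover have "t 0 = 1" "t 1 = \<rho> / r" using g_pos r v_1 by (auto simp: t_def \<rho>_def power2_eq_square field_simps)
  ultimately show ?thesis using alternating_sum_bounds[of t j, OF t0 t1] by simp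
qed

text \<open>At x = - (s g) the factor F_(j+1) equals (-g)^(j+1) times a rising factorial of s, and
  both this rising factorial and the bound 1 - \<rho> / s grow with s \<ge> r.\<close>

lemma T_left:
  assumes "r > 0" "\<rho> \<le> r" "x \<le> - (r * g)"
  shows "(-1) ^ Suc j * T j x \<ge> g ^ Suc j * pochhammer r (Suc j) * (1 - \<rho> / r)"
proof -
  define s where "s = - x / g"
  have s: "s \<ge> r" "x = - (s * g)" using assms g_pos by (auto simp: s_def field_simps)
  have x: "x < 0" using s assms g_pos by (simp add: mult_pos_pos)
  have sgn: "(-1) ^ Suc j * (- g) ^ Suc j = g ^ Suc j" by (subst power_mult_distrib[symmetric]) simp
  have "(-1) ^ Suc j * T j x = (g ^ Suc j * pochhammer s (Suc j)) * (\<Sum>m\<le>j. e m / F m (- (s * g)))"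
    unfolding T_eq_F[OF x] by (simp only: s(2) F_neg mult.assoc[symmetric] sgn)
  moreover have "\<dots> \<ge> (g ^ Suc j * pochhammer r (Suc j)) * (1 - \<rho> / r)"
  proof (intro mult_mono mult_left_mono)
    show "pochhammer r (Suc j) \<le> pochhammer s (Suc j)"
      unfolding pochhammer_prod using assms s by (intro prod_mono) auto
    have "\<rho> / s \<le> \<rho> / r" using s assms \<rho>_pos by (intro divide_left_mono) (auto intro: mult_pos_pos)
    then show "1 - \<rho> / r \<le> (\<Sum>m\<le>j. e m / F m (- (s * g)))"
      using alternating_e_sum[of s j] s assms by linarith
    show "0 \<le> 1 - \<rho> / r" using assms by simp
  qed (use g_pos s assms in \<open>auto intro!: less_imp_le mult_pos_pos pochhammer_pos\<close>)
  ultimately show ?thesis by linarith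
qed

text \<open>The termwise constants of \<open>abs_T_le\<close>, summed. The part 1 / \<rho> serves m
  \<ge> 1 through fact (m - 1) * \<rho> \<le> pochhammer \<rho> m; the part 1 serves m = 0, where
  \<open>m - 1\<close> is 0.\<close>

definition T_const :: real where
  "T_const = suminf (\<lambda>m. e m / g ^ m * ((1 / \<rho> + 1) / fact (m - 1)))"

lemma T_const_summable: "summable (\<lambda>m. e m / g ^ m * ((1 / \<rho> + 1) / fact (m - 1)))"
proof -
  define D where "D = (1 + 1 / g) / g"
  have D: "D > 0" using g_pos by (simp add: D_def field_simps)
  have "summable (\<lambda>m. D * (1 / \<rho> + 1) * (D ^ m / fact m))"
    using summable_exp[of D] by (intro summable_mult) (simp add: field_simps)
  then have "summable (\<lambda>m. D ^ Suc m * ((1 / \<rho> + 1) / fact (Suc m - 1)))" by (simp add: field_simps)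
  then have "summable (\<lambda>m. D ^ m * ((1 / \<rho> + 1) / fact (m - 1)))"
    by (subst (asm) summable_Suc_iff)
  then show ?thesis
  proof (rule summable_comparison_test'[where N = 0])
    fix m
    have "e m / g ^ m \<le> D ^ m"
      using e_le_power[of m] g_pos by (simp add: D_def power_divide divide_right_mono)
    then have "e m / g ^ m * ((1 / \<rho> + 1) / fact (m - 1)) \<le> D ^ m * ((1 / \<rho> + 1) / fact (m - 1))"
      using \<rho>_pos by (intro mult_right_mono) auto
    moreover have "e m / g ^ m * ((1 / \<rho> + 1) / fact (m - 1)) \<ge> 0"
      using e_nonneg[of m] g_pos \<rho>_pos by simp
    ultimately show "norm (e m / g ^ m * ((1 / \<rho> + 1) / fact (m - 1))) \<le> D ^ m * ((1 / \<rho> + 1) / fact (m - 1))"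
      by simp
  qed
qed

lemma T_const_nonneg: "T_const \<ge> 0"
  unfolding T_const_def using e_nonneg g_pos \<rho>_pos by (intro suminf_nonneg T_const_summable) auto

text \<open>Everything is measured against g^(j+1) * pochhammer \<rho> (j+1), the size of F_(j+1) at
  \<open>- (1 / g)\<close>. With y = x / g, for y < 0 each factor satisfies |y - i| \<le> \<rho> +
  i; for y \<ge> 0 \<open>abs_shifted_product_le\<close> applies. Compared with
  \<open>T_left\<close> for r > \<rho> this is smaller by a ratio of rising factorials that tends to
  0.\<close>

lemma abs_T_le:
  assumes x: "x \<ge> - (1 / g)"
  shows "\<bar>T j x\<bar> \<le> g ^ Suc j * pochhammer \<rho> (Suc j) * T_const * (10 * exp (4 / (5 * g) * max x 0))"
proof -
  define B where "B = 10 * exp (4 / (5 * g) * max x 0)"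
  have B: "B \<ge> 1"
  proof -
    have "0 \<le> 4 / (5 * g) * max x 0" using g_pos by simp
    then have "exp (4 / (5 * g) * max x 0) \<ge> 1" by (simp only: one_le_exp_iff)
    then show ?thesis unfolding B_def by linarith
  qed
  have pp: "pochhammer \<rho> n > 0" for n using \<rho>_pos by (intro pochhammer_pos)
  have split: "pochhammer \<rho> (Suc j) = pochhammer \<rho> m * (\<Prod>i=m..j. \<rho> + real i)" if "m \<le> Suc j" for m j
  proof -
    have "{0..<Suc j} = {0..<m} \<union> {m..j}" using that by auto
    then show ?thesis unfolding pochhammer_prod by (simp add: prod.union_disjoint ivl_disj_int)
  qed
  have factp: "fact (m - 1) * \<rho> \<le> pochhammer \<rho> m" if "m \<ge> 1" for m
  proof -
    define n where "n = m - 1"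
    have n: "m = Suc n" using that by (simp add: n_def)
    have "(\<Prod>i=1..n. real i) \<le> (\<Prod>i=1..n. \<rho> + real i)" using \<rho>_pos by (intro prod_mono) auto
    then show ?thesis using split[of 1 n] \<rho>_pos by (simp add: n fact_prod mult.commute mult_right_mono)
  qed
  have bound: "\<bar>\<Prod>i=m..j. x - real i * g\<bar> \<le> g ^ Suc j * pochhammer \<rho> (Suc j) * B * (((1 / \<rho> + 1) / fact (m - 1)) / g ^ m)"
    if m: "m \<le> j" for m
  proof -
    define y where "y = x / g"
    have "\<bar>\<Prod>i=m..j. y - real i\<bar> * fact (m - 1) \<le> pochhammer \<rho> (Suc j) * B * (1 / \<rho> + 1)"
    proof (cases "y \<ge> 0")
      case True
      have "\<bar>\<Prod>i=m..j. y - real i\<bar> * fact (m - 1) \<le> 10 * exp (4 / 5 * y) * fact j"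
        using abs_shifted_product_le[OF True m] .
      also have "10 * exp (4 / 5 * y) = B" using True g_pos by (simp add: B_def y_def zero_le_divide_iff max_def)
      also have "B * fact j \<le> B * (pochhammer \<rho> (Suc j) * (1 / \<rho>))"
        using factp[of "Suc j"] \<rho>_pos B by (intro mult_left_mono) (auto simp: field_simps)
      also have "\<dots> \<le> pochhammer \<rho> (Suc j) * B * (1 / \<rho> + 1)"
        using B pp[of "Suc j"] by (simp add: algebra_simps)
      finally show ?thesis .
    next
      case False
      have "- y \<le> \<rho>" using x g_pos by (simp add: y_def \<rho>_def power2_eq_square field_simps)
      then have "\<bar>\<Prod>i=m..j. y - real i\<bar> \<le> (\<Prod>i=m..j. \<rho> + real i)"
        unfolding abs_prod using False by (intro prod_mono) auto
      then have "\<bar>\<Prod>i=m..j. y - real i\<bar> * fact (m - 1) \<le> (\<Prod>i=m..j. \<rho> + real i) * fact (m - 1)"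
        by (intro mult_right_mono) auto
      also have "\<dots> \<le> pochhammer \<rho> (Suc j) * (1 / \<rho> + 1)"
      proof (cases "m = 0")
        case True then show ?thesis using \<rho>_pos pp[of "Suc j"] split[of 0 j] by (simp add: algebra_simps)
      next
        case False
        have "fact (m - 1) \<le> pochhammer \<rho> m * (1 / \<rho>)" using factp[of m] False \<rho>_pos by (simp add: field_simps)
        then have "(\<Prod>i=m..j. \<rho> + real i) * fact (m - 1) \<le> (\<Prod>i=m..j. \<rho> + real i) * (pochhammer \<rho> m * (1 / \<rho>))"
          using \<rho>_pos by (intro mult_left_mono prod_nonneg) auto
        also have "\<dots> = pochhammer \<rho> (Suc j) * (1 / \<rho>)" using split[of m j] m by simp
        also have "\<dots> \<le> pochhammer \<rho> (Suc j) * (1 / \<rho> + 1)" using pp[of "Suc j"] by (intro mult_left_mono) auto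
        finally show ?thesis .
      qed
      also have "\<dots> \<le> pochhammer \<rho> (Suc j) * (1 / \<rho> + 1) * B"
      proof -
        have "pochhammer \<rho> (Suc j) * (1 / \<rho> + 1) \<ge> 0" using pp[of "Suc j"] \<rho>_pos by simp
        from mult_left_mono[OF B this] show ?thesis by simp
      qed
      finally show ?thesis by (simp add: mult_ac)
    qed
    then have le: "\<bar>\<Prod>i=m..j. y - real i\<bar> \<le> pochhammer \<rho> (Suc j) * B * ((1 / \<rho> + 1) / fact (m - 1))"
      by (simp add: pos_le_divide_eq)
    have "(\<Prod>i=m..j. x - real i * g) = (\<Prod>i=m..j. g * (y - real i))"
      using g_pos by (intro prod.cong) (auto simp: y_def field_simps)
    also have "\<dots> = g ^ (Suc j - m) * (\<Prod>i=m..j. y - real i)" by (simp add: prod.distrib)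
    finally have "\<bar>\<Prod>i=m..j. x - real i * g\<bar> = g ^ (Suc j - m) * \<bar>\<Prod>i=m..j. y - real i\<bar>"
      using g_pos by (simp add: abs_mult)
    also have "\<dots> \<le> g ^ (Suc j - m) * (pochhammer \<rho> (Suc j) * B * ((1 / \<rho> + 1) / fact (m - 1)))"
      using g_pos by (intro mult_left_mono le) auto
    also have "g ^ (Suc j - m) = g ^ Suc j / g ^ m" using g_pos m by (simp add: power_diff)
    finally show ?thesis by (simp add: mult_ac)
  qed
  have "\<bar>T j x\<bar> \<le> (\<Sum>m\<le>j. e m * \<bar>\<Prod>i=m..j. x - real i * g\<bar>)"
    unfolding T_eq by (rule order_trans[OF sum_abs]) (simp add: abs_mult e_nonneg)
  also have "\<dots> \<le> (\<Sum>m\<le>j. e m * (g ^ Suc j * pochhammer \<rho> (Suc j) * B * (((1 / \<rho> + 1) / fact (m - 1)) / g ^ m)))"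
    by (intro sum_mono mult_left_mono bound e_nonneg) auto
  also have "\<dots> = g ^ Suc j * pochhammer \<rho> (Suc j) * B * (\<Sum>m\<le>j. e m / g ^ m * ((1 / \<rho> + 1) / fact (m - 1)))"
    unfolding sum_distrib_left by (intro sum.cong) (auto simp: mult_ac)
  also have "\<dots> \<le> g ^ Suc j * pochhammer \<rho> (Suc j) * B * T_const"
    unfolding T_const_def using g_pos pp[of "Suc j"] B e_nonneg \<rho>_pos
    by (intro mult_left_mono sum_le_suminf T_const_summable) auto
  finally show ?thesis by (simp add: B_def mult_ac)
qed
end

section \<open>Exponential moments\<close>

lemma sum_power_div_fact_le_exp:
  fixes q :: real assumes "q \<ge> 0" "finite A"
  shows "(\<Sum>k\<in>A. q ^ k / fact k) \<le> exp q"
proof -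
  have "(\<Sum>k\<in>A. q ^ k /\<^sub>R fact k) \<le> suminf (\<lambda>k. q ^ k /\<^sub>R fact k)"
    using assms by (intro sum_le_suminf summable_exp_generic) auto
  then show ?thesis by (simp add: exp_def field_simps)
qed

context jack_sequence begin

text \<open>Made for an induction with the ansatz luk_bound l * q^j / j!, q = 10 / g. From height j
  \<le> l + 1 a descent costs the factor j g / 10, a level step j g, and all rises together at most
  exp q because v k \<le> 1. A large q makes descents cheap, so that the rate 11/10 g is close to
  the g of level steps alone.\<close>

definition luk_bound :: "nat \<Rightarrow> real" where
  "luk_bound l = (\<Prod>i<l. 11 / 10 * g * real (Suc i) + exp (10 / g))"

lemma abs_luk_sum_le: "\<bar>luk_sum g v l j\<bar> \<le> luk_bound l * ((10 / g) ^ j / fact j)"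
proof (induction l arbitrary: j)
  case 0 then show ?case using g_pos by (simp add: luk_bound_def)
next
  case (Suc l)
  define q where "q = 10 / g"
  have q: "q > 0" using g_pos by (simp add: q_def)
  define B where "B j = luk_bound l * (q ^ j / fact j)" for j
  have D: "luk_bound l \<ge> 0" unfolding luk_bound_def using g_pos by (intro prod_nonneg) auto
  have B0: "B j \<ge> 0" for j using D q by (simp add: B_def)
  have IH: "\<bar>luk_sum g v l j\<bar> \<le> B j" for j using Suc.IH[of j] by (simp add: B_def q_def)
  show ?case
  proof (cases "j \<le> Suc l")
    case False
    then show ?thesis using luk_sum_high[of "Suc l" j g v] g_pos
      by (simp add: luk_bound_def prod_nonneg del: luk_sum.simps)
  next
    case True
    have 1: "\<bar>if j = 0 then 0 else luk_sum g v l (j - 1)\<bar> \<le> real j * (g / 10) * B j"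
    proof (cases j)
      case (Suc i)
      have "B i = real (Suc i) * (g / 10) * B (Suc i)"
        using g_pos by (simp add: B_def q_def field_simps del: of_nat_Suc)
      then show ?thesis using IH[of i] Suc by simp
    qed simp
    have 2: "\<bar>real j * g * luk_sum g v l j\<bar> \<le> real j * g * B j"
      using g_pos IH[of j] by (simp add: abs_mult mult_left_mono)
    have "\<bar>\<Sum>k=1..l. v k * luk_sum g v l (j + k)\<bar> \<le> (\<Sum>k=1..l. B (j + k))"
    proof (rule order_trans[OF sum_abs], rule sum_mono)
      fix k assume "k \<in> {1..l}"
      then have "0 \<le> v k" "v k \<le> 1" using v_nonneg v_le_1 by auto
      then have "\<bar>v k\<bar> * \<bar>luk_sum g v l (j + k)\<bar> \<le> 1 * B (j + k)"
        by (intro mult_mono IH) auto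
      then show "\<bar>v k * luk_sum g v l (j + k)\<bar> \<le> B (j + k)" by (simp add: abs_mult)
    qed
    also have "\<dots> \<le> (\<Sum>k=1..l. B j * (q ^ k / fact k))"
    proof (rule sum_mono)
      fix k
      have "fact j * fact k \<le> (fact (j + k) :: nat)" by (rule dvd_imp_le[OF fact_fact_dvd_fact]) simp
      then have "fact j * fact k \<le> (fact (j + k) :: real)" by (metis of_nat_fact of_nat_le_iff of_nat_mult)
      then have "q ^ (j + k) / fact (j + k) \<le> q ^ (j + k) / (fact j * fact k)"
        using q by (intro divide_left_mono) auto
      then have "luk_bound l * (q ^ (j + k) / fact (j + k)) \<le> luk_bound l * (q ^ (j + k) / (fact j * fact k))"
        using D by (rule mult_left_mono)
      then show "B (j + k) \<le> B j * (q ^ k / fact k)" by (simp add: B_def power_add)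
    qed
    also have "\<dots> \<le> B j * exp q"
      unfolding sum_distrib_left[symmetric] using B0 q by (intro mult_left_mono sum_power_div_fact_le_exp) auto
    finally have 3: "\<bar>\<Sum>k=1..l. v k * luk_sum g v l (j + k)\<bar> \<le> B j * exp q" .
    have "\<bar>luk_sum g v (Suc l) j\<bar> \<le> real j * (g / 10) * B j + real j * g * B j + B j * exp q"
      using 1 2 3 by (simp only: luk_sum.simps)
    also have "\<dots> = (11 / 10 * g * real j + exp q) * B j" by (simp add: algebra_simps)
    also have "\<dots> \<le> (11 / 10 * g * real (Suc l) + exp q) * B j"
      using True g_pos by (intro mult_right_mono B0 add_right_mono mult_left_mono) auto
    also have "\<dots> = luk_bound (Suc l) * (q ^ j / fact j)" by (simp add: luk_bound_def B_def q_def)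
    finally show ?thesis by (simp add: q_def)
  qed
qed

text \<open>The ratio of consecutive terms is s (11/10 g) plus a term of order 1 / n;
  \<open>c\<close> is the midpoint between its limit and 1.\<close>

lemma luk_bound_summable:
  assumes "s \<ge> 0" "s * (11 / 10 * g) < 1"
  shows "summable (\<lambda>l. luk_bound l * (s ^ l / fact l))"
proof -
  define a where "a = s * (11 / 10 * g)"
  define c where "c = (1 + a) / 2"
  define E where "E = s * exp (10 / g)"
  have a: "a < 1" "a \<ge> 0" using assms g_pos by (auto simp: a_def)
  obtain N where N: "E / ((1 - a) / 2) < real N" using reals_Archimedean2 by blast
  show ?thesis
  proof (rule summable_ratio_test)
    show "c < 1" using a by (simp add: c_def)
    fix n assume "n \<ge> N"
    then have "E / ((1 - a) / 2) < real (Suc n)" using N by (simp add: less_le_trans)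
    then have "E \<le> real (Suc n) * ((1 - a) / 2)" using a by (simp add: pos_divide_less_eq del: of_nat_Suc)
    then have "a + E / real (Suc n) \<le> c"
      by (simp add: c_def field_simps del: of_nat_Suc)
    have pos: "luk_bound n * (s ^ n / fact n) \<ge> 0" for n
      unfolding luk_bound_def using g_pos assms by (intro mult_nonneg_nonneg prod_nonneg) auto
    have "luk_bound (Suc n) * (s ^ Suc n / fact (Suc n)) = (a + E / real (Suc n)) * (luk_bound n * (s ^ n / fact n))"
    proof -
      have "(a + E / real (Suc n)) = (11 / 10 * g * real (Suc n) + exp (10 / g)) * (s / real (Suc n))"
        by (simp add: a_def E_def field_simps del: of_nat_Suc)
      then show ?thesis by (simp add: luk_bound_def)
    qed
    also have "\<dots> \<le> c * (luk_bound n * (s ^ n / fact n))"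
      by (intro mult_right_mono pos) fact
    finally show "norm (luk_bound (Suc n) * (s ^ Suc n / fact (Suc n))) \<le> c * norm (luk_bound n * (s ^ n / fact n))"
      by (simp only: real_norm_def abs_of_nonneg[OF pos])
  qed
qed

text \<open>A telescoping identity. Divided by u - x, its right side is a combination of the
  \<open>T j\<close> and integrates to 0, while the left side turns into partial sums for the
  transform at u and a remainder with \<open>T n\<close>.\<close>

lemma T_expansion:
  assumes "u < 0"
  shows "(\<Sum>m\<le>n. e m * (x - real m * g) / F (Suc m) u) - T n x / F (Suc n) u =
    (u - x) * (\<Sum>j<n. T j x / F (Suc (Suc j)) u)"
proof (induction n)
  case 0 then show ?case by (simp add: T_0 F_def)
next
  case (Suc n)
  have nz: "u - real i * g \<noteq> 0" for i using assms g_pos by (smt (verit) mult_nonneg_nonneg of_nat_0_le_iff)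
  then have F: "F k u \<noteq> 0" for k by (simp add: F_def)
  have "T n x / F (Suc n) u = T n x * (u - real (Suc n) * g) / F (Suc (Suc n)) u"
    unfolding F_Suc[of "Suc n"] using nz[of "Suc n"] by (simp del: of_nat_Suc)
  then have "e (Suc n) * (x - real (Suc n) * g) / F (Suc (Suc n)) u - T (Suc n) x / F (Suc (Suc n)) u
    + T n x / F (Suc n) u = (u - x) * (T n x / F (Suc (Suc n)) u)"
    unfolding T_Suc by (simp add: diff_divide_distrib[symmetric] add_divide_distrib[symmetric] algebra_simps
      del: exp_coeff.simps of_nat_Suc)
  then show ?case using Suc.IH by (simp add: algebra_simps del: exp_coeff.simps of_nat_Suc)
qed
end

text \<open>The transform on the real line. At an atom the convention 1 / 0 = 0 drops the singular
  part, so zeros of \<open>Gr\<close> are always taken off the support.\<close>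

definition (in real_distribution) Gr :: "real \<Rightarrow> real" where "Gr u = (\<integral>x. 1 / (u - x) \<partial>M)"

locale jack_measure = jack_sequence + real_distribution M for M +
  assumes moments: "l \<ge> 1 \<Longrightarrow> has_bochner_integral M (\<lambda>x. x ^ l) (path_moment g v l)"
begin

section \<open>Vanishing integrals and confinement of the mass\<close>

lemma has_moment: "has_bochner_integral M (\<lambda>x. x ^ l) (luk_sum g v l 0)"
proof (cases "l = 0")
  case True
  then show ?thesis using prob_space by (simp add: has_bochner_integral_iff)
qed (use moments[of l] in \<open>simp add: path_moment_eq_luk_sum\<close>)

lemma has_poly_moment: "has_bochner_integral M (poly p) (luk_functional g v p 0)"
proof -
  have "has_bochner_integral M (\<lambda>x. \<Sum>l\<le>degree p. coeff p l * x ^ l)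
    (\<Sum>l\<le>degree p. coeff p l * luk_sum g v l 0)"
    by (intro has_bochner_integral_sum has_bochner_integral_mult_right has_moment)
  then show ?thesis by (simp add: luk_functional_def poly_altdef[abs_def])
qed

lemma integrable_T: "integrable M (T j)" and integral_T: "(\<integral>x. T j x \<partial>M) = 0"
  using has_poly_moment[of "T_poly g v j"] T_poly_functional[of j 0]
  by (auto simp: has_bochner_integral_iff)

text \<open>Even powers are nonnegative, so the series can be integrated term by term once its
  moments are summable; exp itself would bring in odd moments without sign control.\<close>

lemma integrable_cosh:
  assumes "s \<ge> 0" "s * (11 / 10 * g) < 1"
  shows "integrable M (\<lambda>x. cosh (s * x))"
proof -
  define f where "f i x = (if even i then (s * x) ^ i /\<^sub>R fact i else 0)" for i and x :: real
  have f: "has_bochner_integral M (f i) (if even i then s ^ i / fact i * luk_sum g v i 0 else 0)" for i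
  proof (cases "even i")
    case True
    have "f i = (\<lambda>x. (s ^ i / fact i) * x ^ i)"
      using True by (simp add: f_def power_mult_distrib fun_eq_iff field_simps)
    then show ?thesis using has_bochner_integral_mult_right[OF has_moment, of "s ^ i / fact i" i] True by simp
  qed (simp add: f_def[abs_def] has_bochner_integral_zero)
  have fpos: "f i x \<ge> 0" for i x by (auto simp: f_def zero_le_even_power)
  have sums: "(\<lambda>i. f i x) sums cosh (s * x)" for x
    using cosh_converges[of "s * x"] by (simp add: f_def)
  have "integrable M (\<lambda>x. suminf (\<lambda>i. f i x))"
  proof (rule integrable_suminf)
    show "integrable M (f i)" for i using f[of i] by (auto simp: has_bochner_integral_iff)
    show "AE x in M. summable (\<lambda>i. norm (f i x))"
      using sums fpos by (auto simp: sums_iff)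
    show "summable (\<lambda>i. \<integral>x. norm (f i x) \<partial>M)"
    proof (rule summable_comparison_test'[OF luk_bound_summable[OF assms], of 0])
      fix i
      have "(\<integral>x. norm (f i x) \<partial>M) = (\<integral>x. f i x \<partial>M)" using fpos by simp
      also have "\<dots> = (if even i then s ^ i / fact i * luk_sum g v i 0 else 0)"
        using f[of i] by (simp add: has_bochner_integral_iff)
      finally have eq: "(\<integral>x. norm (f i x) \<partial>M) = (if even i then s ^ i / fact i * luk_sum g v i 0 else 0)" .
      have b: "\<bar>luk_sum g v i 0\<bar> \<le> luk_bound i" using abs_luk_sum_le[of i 0] by simp
      then have "luk_bound i \<ge> 0" by linarith
      then show "norm (\<integral>x. norm (f i x) \<partial>M) \<le> luk_bound i * (s ^ i / fact i)"
        unfolding eq using b assms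
        by (auto simp: abs_mult mult.commute[of "luk_bound i"] intro!: divide_right_mono mult_left_mono)
    qed
  qed
  then show ?thesis using sums by (simp add: sums_iff)
qed

definition growth :: "real \<Rightarrow> real" where "growth x = 10 * exp (4 / (5 * g) * max x 0)"

lemma growth_nonneg: "growth x \<ge> 0" by (simp add: growth_def)

lemma integrable_growth: "integrable M growth"
proof (rule Bochner_Integration.integrable_bound)
  \<comment> \<open>The rate is within range: 4/5 * 11/10 = 22/25 < 1.\<close>
  show "integrable M (\<lambda>x. 20 * cosh (4 / (5 * g) * x))"
    using g_pos by (intro integrable_mult_right integrable_cosh) auto
  show "growth \<in> borel_measurable M" unfolding growth_def[abs_def] by measurable
  have "growth x \<le> 20 * cosh (4 / (5 * g) * x)" for x
  proof -
    let ?a = "4 / (5 * g)"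
    have "exp (?a * max x 0) \<le> exp (?a * x) + exp (- (?a * x))"
    proof (cases "x \<ge> 0")
      case False
      then have "x \<le> 0" by simp
      moreover have "0 \<le> ?a" using g_pos by simp
      ultimately have "?a * x \<le> 0" by (intro mult_nonneg_nonpos)
      then have "exp (- (?a * x)) \<ge> 1" by (subst one_le_exp_iff) simp
      moreover have "exp (?a * x) > 0" by simp
      moreover have "exp (?a * max x 0) = 1" using False by simp
      ultimately show ?thesis by linarith
    qed (auto simp: max_def)
    then show ?thesis by (simp add: growth_def cosh_def)
  qed
  then show "AE x in M. norm (growth x) \<le> norm (20 * cosh (4 / (5 * g) * x))"
    using growth_nonneg by (auto simp: abs_mult)
qed

text \<open>The integral 0 of (-1)^(j+1) * T j balances the mass of the half-line, weighted by
  pochhammer r (j+1), against a fixed integral weighted by pochhammer \<rho> (j+1); the quotient of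
  the weights tends to 0.\<close>

lemma prob_left:
  assumes "r > \<rho>"
  shows "prob {..- (r * g)} = 0"
proof -
  define A where "A = {..- (r * g)}"
  define K where "K = T_const * (\<integral>x. growth x \<partial>M)"
  have r: "r > 0" using assms \<rho>_pos by linarith
  have pr: "pochhammer r (Suc j) > 0" for j using r by (intro pochhammer_pos)
  have ineq: "prob A * (1 - \<rho> / r) \<le> K * (pochhammer \<rho> (Suc j) / pochhammer r (Suc j))" for j
  proof -
    define c where "c = g ^ Suc j * pochhammer r (Suc j) * (1 - \<rho> / r)"
    define b where "b = g ^ Suc j * pochhammer \<rho> (Suc j) * T_const"
    have b: "b \<ge> 0" using g_pos \<rho>_pos T_const_nonneg by (auto simp: b_def intro!: mult_nonneg_nonneg pochhammer_nonneg)
    \<comment> \<open>Three zones: \<open>T_left\<close> for r on the half-line, its sign statement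
      for \<rho> up to \<open>- (\<rho> * g)\<close>, and \<open>abs_T_le\<close> beyond.\<close>
    have pt: "c * indicator A x - b * growth x \<le> (-1) ^ Suc j * T j x" for x
    proof -
      have bg: "b * growth x \<ge> 0" using b growth_nonneg by simp
      consider "x \<in> A" | "x \<notin> A" "x \<le> - (\<rho> * g)" | "x \<notin> A" "x > - (\<rho> * g)" by linarith
      then show ?thesis
      proof cases
        case 1
        then show ?thesis using T_left[of r x j] r assms bg by (simp add: A_def c_def)
      next
        case 2
        then have "(-1) ^ Suc j * T j x \<ge> 0" using T_left[of \<rho> x j] \<rho>_pos by simp
        then show ?thesis using 2 bg by (simp del: power_Suc)
      next
        case 3
        then have "\<bar>T j x\<bar> \<le> b * growth x" using abs_T_le[of x j] by (simp add: b_def growth_def \<rho>_g)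
        moreover have "\<bar>(-1) ^ Suc j * T j x\<bar> = \<bar>T j x\<bar>" by (simp add: abs_mult power_abs)
        ultimately show ?thesis using 3 by (simp del: power_Suc)
      qed
    qed
    have iA: "integrable M (\<lambda>x. c * indicator A x)" by (intro integrable_mult_right integrable_real_indicator) (auto simp: A_def emeasure_eq_measure)
    have "(\<integral>x. c * indicator A x - b * growth x \<partial>M) \<le> (\<integral>x. (-1) ^ Suc j * T j x \<partial>M)"
      using pt iA integrable_growth integrable_T by (intro integral_mono) auto
    also have "\<dots> = 0" using integral_T[of j] by simp
    also have "(\<integral>x. c * indicator A x - b * growth x \<partial>M) = c * prob A - b * (\<integral>x. growth x \<partial>M)"
      using iA integrable_growth by (simp add: A_def)
    finally have "g ^ Suc j * (pochhammer r (Suc j) * (prob A * (1 - \<rho> / r))) \<le> g ^ Suc j * (pochhammer \<rho> (Suc j) * K)"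
      by (simp add: c_def b_def K_def mult_ac)
    then have "pochhammer r (Suc j) * (prob A * (1 - \<rho> / r)) \<le> pochhammer \<rho> (Suc j) * K"
      using g_pos by (subst (asm) mult_le_cancel_left_pos) auto
    then show ?thesis using pr[of j] by (simp add: pos_le_divide_eq mult_ac)
  qed
  have "(\<lambda>j. K * (pochhammer \<rho> (Suc j) / pochhammer r (Suc j))) \<longlonglongrightarrow> K * 0"
    by (intro tendsto_intros pochhammer_ratio_tendsto_0 \<rho>_pos assms)
  then have "prob A * (1 - \<rho> / r) \<le> K * 0"
    by (rule LIMSEQ_le_const) (use ineq in auto)
  moreover have "1 - \<rho> / r > 0" using assms r by simp
  ultimately have "prob A \<le> 0" by (simp add: mult_le_0_iff)
  then show ?thesis unfolding A_def by (intro antisym measure_nonneg)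
qed

text \<open>\<open>prob_left\<close> asks for r > \<rho>; the half-lines with r = \<rho> + 1 / (n +
  1) exhaust the open one.\<close>

lemma AE_right: "AE x in M. x \<ge> - (1 / g)"
proof -
  have "AE x in M. \<not> x \<le> - ((\<rho> + 1 / real (Suc n)) * g)" for n
  proof (rule AE_I)
    show "emeasure M {..- ((\<rho> + 1 / real (Suc n)) * g)} = 0"
      using prob_left[of "\<rho> + 1 / real (Suc n)"] by (simp add: emeasure_eq_measure)
  qed auto
  then have "AE x in M. \<forall>n. \<not> x \<le> - ((\<rho> + 1 / real (Suc n)) * g)" by (simp add: AE_all_countable)
  then show ?thesis
  proof eventually_elim
    case (elim x)
    show ?case
    proof (rule ccontr)
      assume "\<not> x \<ge> - (1 / g)"
      then have "0 < (- (1 / g) - x) / g" using g_pos by simp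
      then obtain n where "inverse (real (Suc n)) < (- (1 / g) - x) / g" using reals_Archimedean by blast
      then have "x \<le> - ((\<rho> + 1 / real (Suc n)) * g)"
        using g_pos \<rho>_g by (simp add: pos_less_divide_eq inverse_eq_divide algebra_simps)
      then show False using elim by blast
    qed
  qed
qed

text \<open>Integrate \<open>T_expansion\<close> divided by u - x. Only the remainder with
  \<open>T n\<close> survives, and the distance of u from the support together with
  \<open>abs_T_le\<close> bounds it by a ratio of rising factorials. Formally, Gr u is the quotient
  of the series of e_m / F_(m+1) and e_m / F_m at u.\<close>

lemma Gr_partial_sums:
  assumes u: "u < - (1 / g)"
  shows "(\<lambda>n. \<Sum>m\<le>n. e m / F m u * Gr u - e m / F (Suc m) u) \<longlonglongrightarrow> 0"
proof -
  define \<delta> where "\<delta> = - (1 / g) - u"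
  define r where "r = - u / g"
  have d: "\<delta> > 0" using u by (simp add: \<delta>_def)
  have u0: "u < 0" using u g_pos by (smt (verit) divide_pos_pos)
  have ur: "u = - (r * g)" using g_pos by (simp add: r_def)
  have r: "r > \<rho>" using u g_pos by (simp add: r_def \<rho>_def power2_eq_square field_simps)
  then have "r > 0" using \<rho>_pos by linarith
  then have pr: "pochhammer r n > 0" for n by (intro pochhammer_pos)
  have nz: "u - real i * g \<noteq> 0" for i using u0 g_pos by (smt (verit) mult_nonneg_nonneg of_nat_0_le_iff)
  then have Fnz: "F k u \<noteq> 0" for k by (simp add: F_def)
  have AE: "AE x in M. x - u \<ge> \<delta>" using AE_right by eventually_elim (simp add: \<delta>_def)
  have bd: "AE x in M. norm (1 / (u - x)) \<le> 1 / \<delta>"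
    using AE
  proof eventually_elim
    case (elim x)
    then have "\<bar>u - x\<bar> \<ge> \<delta>" by linarith
    then show ?case using d by (simp add: abs_divide frac_le)
  qed
  have int1: "integrable M (\<lambda>x. 1 / (u - x))"
    by (rule integrable_const_bound[OF bd]) measurable
  have intT: "integrable M (\<lambda>x. T n x / (u - x))" for n
  proof (rule Bochner_Integration.integrable_bound)
    show "integrable M (\<lambda>x. T n x * (1 / \<delta>))" using integrable_T by simp
    show "(\<lambda>x. T n x / (u - x)) \<in> borel_measurable M"
      using borel_measurable_integrable[OF integrable_T[of n]] by measurable
    show "AE x in M. norm (T n x / (u - x)) \<le> norm (T n x * (1 / \<delta>))"
      using bd
    proof eventually_elim
      case (elim x)
      have "norm (T n x / (u - x)) = norm (T n x) * norm (1 / (u - x))" by (simp add: abs_divide)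
      also have "\<dots> \<le> norm (T n x) * (1 / \<delta>)" using elim by (intro mult_left_mono) auto
      finally show ?case using d by (simp add: abs_mult)
    qed
  qed
  have alg: "c / f * (1 / b) - c / (f * a) = c * (a - b) / (f * a) / b" if "f \<noteq> 0" "a \<noteq> 0" "b \<noteq> 0" for a b c f :: real
    using that by (simp add: field_simps)
  have id: "(\<Sum>m\<le>n. e m / F m u * Gr u - e m / F (Suc m) u) = (\<integral>x. T n x / (u - x) \<partial>M) / F (Suc n) u" for n
  proof -
    have i: "integrable M (\<lambda>x. e m / F m u * (1 / (u - x)))" for m using int1 by (rule integrable_mult_right)
    have i2: "integrable M (\<lambda>x. e m / F m u * (1 / (u - x)) - e m / F (Suc m) u)" for m
      using i[of m] by (intro Bochner_Integration.integrable_diff) auto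
    have "AE x in M. (\<Sum>m\<le>n. e m / F m u * (1 / (u - x)) - e m / F (Suc m) u) - T n x / (u - x) / F (Suc n) u =
        (\<Sum>j<n. T j x / F (Suc (Suc j)) u)"
      using AE
    proof eventually_elim
      case (elim x)
      then have ux: "u - x \<noteq> 0" using d by auto
      have "e m / F m u * (1 / (u - x)) - e m / F (Suc m) u = e m * (x - real m * g) / F (Suc m) u / (u - x)" for m
        unfolding F_Suc using alg[OF Fnz[of m] nz[of m] ux, of "e m"] by simp
      then have "(\<Sum>m\<le>n. e m / F m u * (1 / (u - x)) - e m / F (Suc m) u) - T n x / (u - x) / F (Suc n) u =
        ((\<Sum>m\<le>n. e m * (x - real m * g) / F (Suc m) u) - T n x / F (Suc n) u) / (u - x)"
        by (simp add: sum_divide_distrib diff_divide_distrib)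
      then show ?case unfolding T_expansion[OF u0] using ux by simp
    qed
    then have "(\<integral>x. (\<Sum>m\<le>n. e m / F m u * (1 / (u - x)) - e m / F (Suc m) u) - T n x / (u - x) / F (Suc n) u \<partial>M) =
      (\<integral>x. (\<Sum>j<n. T j x / F (Suc (Suc j)) u) \<partial>M)"
      using borel_measurable_integrable[OF integrable_T] borel_measurable_integrable[OF intT]
        borel_measurable_integrable[OF int1]
      by (intro integral_cong_AE borel_measurable_sum borel_measurable_diff borel_measurable_divide borel_measurable_const
          borel_measurable_times) auto
    also have "\<dots> = 0" using integrable_T integral_T by (simp add: Bochner_Integration.integral_sum)
    also have "(\<integral>x. (\<Sum>m\<le>n. e m / F m u * (1 / (u - x)) - e m / F (Suc m) u) - T n x / (u - x) / F (Suc n) u \<partial>M) =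
      (\<integral>x. (\<Sum>m\<le>n. e m / F m u * (1 / (u - x)) - e m / F (Suc m) u) \<partial>M) - (\<integral>x. T n x / (u - x) / F (Suc n) u \<partial>M)"
      by (intro Bochner_Integration.integral_diff Bochner_Integration.integrable_sum i2 integrable_divide intT)
    also have "(\<integral>x. (\<Sum>m\<le>n. e m / F m u * (1 / (u - x)) - e m / F (Suc m) u) \<partial>M) =
      (\<Sum>m\<le>n. e m / F m u * Gr u - e m / F (Suc m) u)"
    proof -
      have "(\<integral>x. e m / F m u * (1 / (u - x)) - e m / F (Suc m) u \<partial>M) = e m / F m u * Gr u - e m / F (Suc m) u" for m
        using Bochner_Integration.integral_diff[OF i[of m] integrable_const[of "e m / F (Suc m) u"]] prob_space
        by (simp only: integral_mult_right_zero Gr_def lebesgue_integral_const scaleR_one)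
      then show ?thesis using i2 by (simp only: Bochner_Integration.integral_sum)
    qed
    finally show ?thesis unfolding integral_divide_zero by (simp only: right_minus_eq)
  qed
  define K where "K = T_const * (\<integral>x. growth x \<partial>M) / \<delta>"
  have le: "norm (\<Sum>m\<le>n. e m / F m u * Gr u - e m / F (Suc m) u) \<le> K * (pochhammer \<rho> (Suc n) / pochhammer r (Suc n))" for n
  proof -
    define b where "b = g ^ Suc n * pochhammer \<rho> (Suc n) * T_const"
    have "norm (\<integral>x. T n x / (u - x) \<partial>M) \<le> (\<integral>x. norm (T n x / (u - x)) \<partial>M)"
      by (rule integral_norm_bound)
    also have "\<dots> \<le> (\<integral>x. b * growth x / \<delta> \<partial>M)"
    proof (rule integral_mono_AE)
      show "integrable M (\<lambda>x. b * growth x / \<delta>)" using integrable_growth by simp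
      show "AE x in M. norm (T n x / (u - x)) \<le> b * growth x / \<delta>"
        using bd AE_right
      proof eventually_elim
        case (elim x)
        have le: "norm (T n x) \<le> b * growth x" using elim abs_T_le[of x n] by (simp add: b_def growth_def)
        have "norm (T n x / (u - x)) = norm (T n x) * norm (1 / (u - x))" by (simp add: abs_divide)
        also have "\<dots> \<le> (b * growth x) * (1 / \<delta>)"
          using elim le order_trans[OF norm_ge_zero le] by (intro mult_mono) auto
        finally show ?case by simp
      qed
    qed (intro integrable_norm intT)
    also have "\<dots> = g ^ Suc n * pochhammer \<rho> (Suc n) * K" by (simp add: b_def K_def)
    finally have *: "\<bar>\<integral>x. T n x / (u - x) \<partial>M\<bar> \<le> g ^ Suc n * pochhammer \<rho> (Suc n) * K" by simp
    have "\<bar>F (Suc n) u\<bar> = g ^ Suc n * pochhammer r (Suc n)"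
      unfolding ur F_neg using g_pos pr[of "Suc n"] by (simp add: abs_mult power_abs)
    then have "norm (\<Sum>m\<le>n. e m / F m u * Gr u - e m / F (Suc m) u) =
        \<bar>\<integral>x. T n x / (u - x) \<partial>M\<bar> / (g ^ Suc n * pochhammer r (Suc n))"
      unfolding id by (simp add: abs_divide)
    also have "\<dots> \<le> g ^ Suc n * pochhammer \<rho> (Suc n) * K / (g ^ Suc n * pochhammer r (Suc n))"
      using g_pos pr[of "Suc n"] * by (intro divide_right_mono) auto
    also have "\<dots> = K * (pochhammer \<rho> (Suc n) / pochhammer r (Suc n))" using g_pos by simp
    finally show ?thesis .
  qed
  show ?thesis
  proof (rule Lim_null_comparison)
    show "\<forall>\<^sub>F n in sequentially. norm (\<Sum>m\<le>n. e m / F m u * Gr u - e m / F (Suc m) u) \<le>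
        K * (pochhammer \<rho> (Suc n) / pochhammer r (Suc n))" using le by simp
    show "(\<lambda>n. K * (pochhammer \<rho> (Suc n) / pochhammer r (Suc n))) \<longlonglongrightarrow> 0"
      using tendsto_mult_right_zero[OF pochhammer_ratio_tendsto_0[OF \<rho>_pos r]] .
  qed
qed
end

section \<open>The entire function behind the Stieltjes transform\<close>

definition stieltjes :: "real measure \<Rightarrow> complex \<Rightarrow> complex" where
  "stieltjes M z = (\<integral>x. 1 / (z - complex_of_real x) \<partial>M)"

context real_distribution begin

lemma stieltjes_integrable:
  assumes "\<delta> > 0" "AE x in M. norm (z - complex_of_real x) \<ge> \<delta>"
  shows "integrable M (\<lambda>x. 1 / (z - complex_of_real x))"
proof (rule integrable_const_bound)
  show "AE x in M. norm (1 / (z - complex_of_real x)) \<le> 1 / \<delta>"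
    using assms(2) by eventually_elim (use \<open>\<delta> > 0\<close> in \<open>simp add: norm_divide frac_le\<close>)
qed measurable

text \<open>Differentiation under the integral: the difference quotient minus its expected limit has
  the integrand (z - z0) / ((z - x) (z0 - x)^2), and |z - x| \<ge> \<delta> / 2 for z within
  \<delta> / 2 of z0.\<close>

lemma stieltjes_differentiable:
  assumes "\<delta> > 0" "AE x in M. norm (z0 - complex_of_real x) \<ge> \<delta>"
  shows "stieltjes M field_differentiable at z0"
proof -
  define D where "D = - (\<integral>x. 1 / (z0 - complex_of_real x)\<^sup>2 \<partial>M)"
  have i2: "integrable M (\<lambda>x. 1 / (z0 - complex_of_real x)\<^sup>2)"
  proof (rule integrable_const_bound)
    show "AE x in M. norm (1 / (z0 - complex_of_real x)\<^sup>2) \<le> 1 / \<delta>\<^sup>2"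
      using assms(2)
      by eventually_elim (use \<open>\<delta> > 0\<close> in \<open>simp add: norm_divide norm_power frac_le power_mono\<close>)
  qed measurable
  have bound: "norm ((stieltjes M z - stieltjes M z0) / (z - z0) - D) \<le> 2 / \<delta> ^ 3 * norm (z - z0)"
    if z: "z \<noteq> z0" "norm (z - z0) < \<delta> / 2" for z
  proof -
    have AEz: "AE x in M. norm (z - complex_of_real x) \<ge> \<delta> / 2"
      using assms(2)
    proof eventually_elim
      case (elim x)
      have "norm (z0 - complex_of_real x) \<le> norm (z - complex_of_real x) + norm (z - z0)"
        using norm_triangle_ineq4[of "z - complex_of_real x" "z - z0"] by simp
      then show ?case using elim z by linarith
    qed
    have iz: "integrable M (\<lambda>x. 1 / (z - complex_of_real x))" "integrable M (\<lambda>x. 1 / (z0 - complex_of_real x))"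
      using stieltjes_integrable[OF _ AEz] stieltjes_integrable[OF assms] assms(1) by auto
    define q where "q x = (1 / (z - complex_of_real x) - 1 / (z0 - complex_of_real x)) / (z - z0)
      + 1 / (z0 - complex_of_real x)\<^sup>2" for x
    have iq: "integrable M q"
      unfolding q_def[abs_def] by (intro Bochner_Integration.integrable_add Bochner_Integration.integrable_diff integrable_divide iz i2)
    have "(stieltjes M z - stieltjes M z0) / (z - z0) - D = integral\<^sup>L M q"
    proof -
      have "integral\<^sup>L M q = (\<integral>x. (1 / (z - complex_of_real x) - 1 / (z0 - complex_of_real x)) / (z - z0) \<partial>M)
          + (\<integral>x. 1 / (z0 - complex_of_real x)\<^sup>2 \<partial>M)"
        unfolding q_def[abs_def]
        by (intro Bochner_Integration.integral_add Bochner_Integration.integrable_diff integrable_divide iz i2)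
      also have "(\<integral>x. (1 / (z - complex_of_real x) - 1 / (z0 - complex_of_real x)) / (z - z0) \<partial>M) =
          (stieltjes M z - stieltjes M z0) / (z - z0)"
        unfolding integral_divide_zero stieltjes_def by (subst Bochner_Integration.integral_diff[OF iz]) (rule refl)
      finally show ?thesis by (simp add: D_def)
    qed
    also have "norm \<dots> \<le> (\<integral>x. norm (q x) \<partial>M)" by (rule integral_norm_bound)
    also have "\<dots> \<le> (\<integral>x. 2 / \<delta> ^ 3 * norm (z - z0) \<partial>M)"
    proof (rule integral_mono_AE)
      show "AE x in M. norm (q x) \<le> 2 / \<delta> ^ 3 * norm (z - z0)"
        using assms(2) AEz
      proof eventually_elim
        case (elim x)
        let ?a = "z - complex_of_real x" and ?b = "z0 - complex_of_real x"
        have nz: "?a \<noteq> 0" "?b \<noteq> 0" using elim \<open>\<delta> > 0\<close> by auto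
        have zz: "z - z0 = ?a - ?b" by simp
        have alg: "(1 / a - 1 / b) / (a - b) + 1 / b\<^sup>2 = (a - b) / (a * b\<^sup>2)"
          if "a \<noteq> 0" "b \<noteq> 0" "a \<noteq> b" for a b :: complex
        proof -
          have "(1 / a - 1 / b) / (a - b) = - 1 / (a * b)" using that by (simp add: field_simps)
          then show ?thesis using that by (simp add: field_simps power2_eq_square)
        qed
        have "q x = (z - z0) / (?a * ?b\<^sup>2)"
          unfolding q_def zz using z nz by (intro alg) auto
        then have "norm (q x) = norm (z - z0) / (norm ?a * norm ?b ^ 2)"
          by (simp add: norm_divide norm_mult norm_power)
        also have "\<dots> \<le> norm (z - z0) / (\<delta> / 2 * \<delta>\<^sup>2)"
          using elim \<open>\<delta> > 0\<close> by (intro divide_left_mono mult_mono power_mono mult_pos_pos) auto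
        also have "\<dots> = 2 / \<delta> ^ 3 * norm (z - z0)"
          using \<open>\<delta> > 0\<close> by (simp add: field_simps power2_eq_square power3_eq_cube)
        finally show ?case .
      qed
    qed (use iq in auto)
    moreover have "prob UNIV = 1" using prob_space by simp
    ultimately show ?thesis by simp
  qed
  have "((\<lambda>z. (stieltjes M z - stieltjes M z0) / (z - z0) - D) \<longlongrightarrow> 0) (at z0)"
  proof (rule Lim_null_comparison)
    have "\<forall>\<^sub>F z in at z0. z \<noteq> z0 \<and> dist z z0 < \<delta> / 2"
      using \<open>\<delta> > 0\<close> by (auto simp: eventually_at intro!: exI[of _ "\<delta> / 2"])
    then show "\<forall>\<^sub>F z in at z0. norm ((stieltjes M z - stieltjes M z0) / (z - z0) - D) \<le> 2 / \<delta> ^ 3 * norm (z - z0)"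
      by eventually_elim (use bound in \<open>auto simp: dist_norm\<close>)
    have "((\<lambda>z. 2 / \<delta> ^ 3 * norm (z - z0)) \<longlongrightarrow> 2 / \<delta> ^ 3 * norm (z0 - z0)) (at z0)"
      by (intro tendsto_intros)
    then show "((\<lambda>z. 2 / \<delta> ^ 3 * norm (z - z0)) \<longlongrightarrow> 0) (at z0)" by simp
  qed
  then have "(stieltjes M has_field_derivative D) (at z0)"
    unfolding has_field_derivative_iff by (rule LIM_zero_cancel)
  then show ?thesis unfolding field_differentiable_def by blast
qed

lemma Im_stieltjes:
  assumes "Im z \<noteq> 0"
  shows "integrable M (\<lambda>x. Im z / ((Re z - x)\<^sup>2 + (Im z)\<^sup>2))"
    and "Im (stieltjes M z) = - (\<integral>x. Im z / ((Re z - x)\<^sup>2 + (Im z)\<^sup>2) \<partial>M)"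
proof -
  have n: "norm (z - complex_of_real x) \<ge> \<bar>Im z\<bar>" for x using abs_Im_le_cmod[of "z - complex_of_real x"] by simp
  have i: "integrable M (\<lambda>x. 1 / (z - complex_of_real x))"
    using assms n by (intro stieltjes_integrable[of "\<bar>Im z\<bar>"]) auto
  have eq: "Im (1 / (z - complex_of_real x)) = - (Im z / ((Re z - x)\<^sup>2 + (Im z)\<^sup>2))" for x
    by (simp add: Im_divide)
  have "integrable M (\<lambda>x. - Im (1 / (z - complex_of_real x)))" using i by simp
  then show "integrable M (\<lambda>x. Im z / ((Re z - x)\<^sup>2 + (Im z)\<^sup>2))" unfolding eq by simp
  have "Im (stieltjes M z) = (\<integral>x. Im (1 / (z - complex_of_real x)) \<partial>M)"
    unfolding stieltjes_def using i by simp
  then show "Im (stieltjes M z) = - (\<integral>x. Im z / ((Re z - x)\<^sup>2 + (Im z)\<^sup>2) \<partial>M)" unfolding eq by simp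
qed
end

section \<open>The entire function \<open>X\<close>\<close>

context jack_sequence begin

text \<open>
  Up to the factor \<open>rGamma (1 - z / g)\<close>, which makes it entire, \<open>X z\<close> is \<open>\<Sum> e m / F m (z - g)\<close>.
\<close>

definition X_term :: "nat \<Rightarrow> complex \<Rightarrow> complex" where
  "X_term m z = of_real ((- 1 / g) ^ m * e m) * rGamma (of_nat (Suc m) - z / of_real g)"

definition X :: "complex \<Rightarrow> complex" where "X z = suminf (\<lambda>m. X_term m z)"

definition D :: real where "D = (1 + 1 / g) / g"

lemma D_pos: "D > 0" using g_pos by (simp add: D_def field_simps)

lemma X_coeff_bound: "norm (complex_of_real ((- 1 / g) ^ m * e m)) \<le> D ^ m"
proof -
  have "norm (complex_of_real ((- 1 / g) ^ m * e m)) = e m / g ^ m"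
    using g_pos e_nonneg[of m] by (simp add: norm_mult norm_power norm_divide power_divide abs_mult power_abs)
  also have "\<dots> \<le> D ^ m" using e_le_power[of m] g_pos by (simp add: D_def power_divide divide_right_mono)
  finally show ?thesis .
qed

lemma norm_pochhammer_ge:
  fixes w :: complex
  assumes "c \<ge> 0" "Re w \<ge> c"
  shows "c ^ n \<le> norm (pochhammer w n)"
proof -
  have "(\<Prod>i<n. c) \<le> (\<Prod>i<n. norm (w + of_nat i))"
  proof (rule prod_mono)
    fix i
    have "c \<le> Re (w + of_nat i)" using assms by simp
    also have "\<dots> \<le> norm (w + of_nat i)" by (rule complex_Re_le_cmod)
    finally show "0 \<le> c \<and> c \<le> norm (w + of_nat i)" using assms by simp
  qed
  then show ?thesis by (simp add: pochhammer_prod prod_norm atLeast0LessThan)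
qed

text \<open>The coefficients grow at most like D^m. From the index N on, the recurrence of
  \<open>rGamma\<close> divides by a factor of norm at least 2 D per step throughout the disc, so
  the bounds halve each time.\<close>

lemma X_uniform: "uniform_limit (cball 0 R) (\<lambda>n z. \<Sum>m<n. X_term m z) X sequentially"
proof -
  obtain N :: nat where N: "real N \<ge> 2 * D + \<bar>R\<bar> / g" using real_arch_simple by blast
  have "compact ((\<lambda>z :: complex. rGamma (of_nat (Suc N) - z / of_real g)) ` cball 0 R)"
    using g_pos by (intro compact_continuous_image compact_cball holomorphic_on_imp_continuous_on holomorphic_intros) auto
  then obtain B where Ball: "\<forall>y\<in>(\<lambda>z :: complex. rGamma (of_nat (Suc N) - z / of_real g)) ` cball 0 R. norm y \<le> B"
    by (auto dest!: compact_imp_bounded simp only: bounded_iff)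
  have B: "norm (rGamma (of_nat (Suc N) - z / of_real g)) \<le> B" if "z \<in> cball 0 R" for z :: complex
    by (rule bspec[OF Ball imageI[OF that]])
  define b where "b n = D ^ N * B * (1 / 2) ^ (n - N)" for n
  have "norm (X_term n z) \<le> b n" if "n \<ge> N" and z: "z \<in> cball 0 R" for n z
  proof -
    define k where "k = n - N"
    have n: "n = N + k" using that by (simp add: k_def)
    define w where "w = of_nat (Suc N) - z / of_real g"
    have "\<bar>Re (z / of_real g)\<bar> \<le> norm (z / of_real g)" by (rule abs_Re_le_cmod)
    also have "\<dots> \<le> \<bar>R\<bar> / g" using z g_pos by (simp add: norm_divide divide_right_mono)
    finally have "\<bar>Re (z / of_real g)\<bar> \<le> \<bar>R\<bar> / g" .
    moreover have "Re w = 1 + real N - Re (z / of_real g)" by (simp add: w_def)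
    ultimately have "Re w \<ge> 2 * D" using N by linarith
    then have p: "(2 * D) ^ k \<le> norm (pochhammer w k)" using D_pos by (intro norm_pochhammer_ge) auto
    have weq: "w + of_nat k = of_nat (Suc n) - z / of_real g" by (simp add: w_def n)
    have rG: "rGamma w = pochhammer w k * rGamma (of_nat (Suc n) - z / of_real g)"
      using pochhammer_rGamma[of w k] by (simp only: weq)
    have "norm (rGamma w) \<le> B" using B[OF z] by (simp only: w_def)
    then have "norm (rGamma (of_nat (Suc n) - z / of_real g)) * norm (pochhammer w k) \<le> B"
      unfolding rG norm_mult by (simp only: mult.commute)
    moreover have "norm (rGamma (of_nat (Suc n) - z / of_real g)) * (2 * D) ^ k \<le>
       norm (rGamma (of_nat (Suc n) - z / of_real g)) * norm (pochhammer w k)"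
      using p by (rule mult_left_mono) simp
    ultimately have rg: "norm (rGamma (of_nat (Suc n) - z / of_real g)) \<le> B / (2 * D) ^ k"
      using D_pos by (simp add: pos_le_divide_eq)
    have "norm (X_term n z) \<le> D ^ n * (B / (2 * D) ^ k)"
      unfolding X_term_def norm_mult[of "complex_of_real _"]
      using D_pos by (intro mult_mono X_coeff_bound rg) auto
    also have "\<dots> = b n" using D_pos by (simp add: b_def n power_add power_mult_distrib power_divide)
    finally show ?thesis .
  qed
  then have "\<forall>\<^sub>F n in sequentially. \<forall>z\<in>cball 0 R. norm (X_term n z) \<le> b n"
    unfolding eventually_sequentially by blast
  moreover have "summable (\<lambda>k. D ^ N * B * (1 / 2) ^ k)" by (intro summable_mult summable_geometric) auto
  then have "summable (\<lambda>k. b (k + N))" by (simp add: b_def)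
  then have "summable b" by (rule summable_iff_shift[THEN iffD1])
  ultimately show ?thesis unfolding X_def[abs_def] by (rule Weierstrass_m_test_ev)
qed

lemma X_sums: "(\<lambda>m. X_term m z) sums X z"
  using tendsto_uniform_limitI[OF X_uniform[of "norm z"], of z] by (simp add: sums_def)

lemma X_holomorphic: "X holomorphic_on UNIV"
proof (rule holomorphic_uniform_sequence)
  show "(\<lambda>z. \<Sum>m<n. X_term m z) holomorphic_on UNIV" for n
    unfolding X_term_def using g_pos by (intro holomorphic_intros) auto
  fix z
  have "uniform_limit (cball z 1) (\<lambda>n z. \<Sum>m<n. X_term m z) X sequentially"
  proof (rule uniform_limit_on_subset[OF X_uniform[of "norm z + 1"]], rule subsetI)
    fix x assume "x \<in> cball z 1"
    then show "x \<in> cball 0 (norm z + 1)"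
      using norm_triangle_ineq2[of x z] by (simp add: dist_norm norm_minus_commute)
  qed
  then show "\<exists>d>0. cball z d \<subseteq> UNIV \<and> uniform_limit (cball z d) (\<lambda>n z. \<Sum>m<n. X_term m z) X sequentially"
    by (intro exI[of _ 1]) auto
qed simp

text \<open>For Re z \<le> - 4 D g the m-th term is at most 4^(-m) times the leading term
  \<open>rGamma w\<close>, so the others add up to at most a third of it.\<close>

lemma X_nonzero_left: "\<exists>R>0. \<forall>z. Re z \<le> - R \<longrightarrow> X z \<noteq> 0"
proof (intro exI conjI allI impI)
  show "4 * D * g > 0" using D_pos g_pos by simp
  fix z assume z: "Re z \<le> - (4 * D * g)"
  define w where "w = 1 - z / of_real g"
  have "Re z / g \<le> - (4 * D)" using z g_pos by (simp add: pos_divide_le_eq)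
  then have w: "Re w \<ge> 4 * D" by (simp add: w_def)
  then have wn: "rGamma w \<noteq> 0" using D_pos
    by (auto simp: rGamma_eq_zero_iff elim!: nonpos_Ints_cases)
  have norm_t: "norm (X_term m z) \<le> norm (rGamma w) * (1 / 4) ^ m" for m
  proof -
    have p: "(4 * D) ^ m \<le> norm (pochhammer w m)" using D_pos w by (intro norm_pochhammer_ge) auto
    have "rGamma w = pochhammer w m * rGamma (w + of_nat m)" by (rule pochhammer_rGamma)
    moreover have "w + of_nat m = of_nat (Suc m) - z / of_real g" by (simp add: w_def)
    ultimately have "norm (rGamma (of_nat (Suc m) - z / of_real g)) * norm (pochhammer w m) = norm (rGamma w)"
      by (simp add: norm_mult mult.commute)
    moreover have "norm (rGamma (of_nat (Suc m) - z / of_real g)) * (4 * D) ^ m \<le>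
       norm (rGamma (of_nat (Suc m) - z / of_real g)) * norm (pochhammer w m)"
      using p by (rule mult_left_mono) simp
    ultimately have rg: "norm (rGamma (of_nat (Suc m) - z / of_real g)) \<le> norm (rGamma w) / (4 * D) ^ m"
      using D_pos by (simp add: pos_le_divide_eq)
    have "norm (X_term m z) \<le> D ^ m * (norm (rGamma w) / (4 * D) ^ m)"
      unfolding X_term_def norm_mult[of "complex_of_real _"]
      using D_pos by (intro mult_mono X_coeff_bound rg) auto
    then show ?thesis using D_pos by (simp add: power_mult_distrib power_divide)
  qed
  have s: "summable (\<lambda>m. norm (rGamma w) * (1 / 4) ^ Suc m)"
    by (intro summable_mult) (simp add: summable_Suc_iff summable_geometric)
  have "(\<lambda>m. X_term (Suc m) z) sums (X z - X_term 0 z)"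
    using X_sums[of z] by (subst sums_Suc_iff) simp
  moreover have "X_term 0 z = rGamma w" by (simp add: X_term_def w_def)
  ultimately have "norm (X z - rGamma w) \<le> suminf (\<lambda>m. norm (rGamma w) * (1 / 4) ^ Suc m)"
    using norm_suminf_le[OF norm_t[of "Suc m" for m] s] by (simp add: sums_iff)
  also have "\<dots> = norm (rGamma w) * (1 / 3)"
  proof -
    have "(\<lambda>m. (1 / 4 :: real) ^ Suc m) sums (1 / (1 - 1 / 4) - 1)"
      using geometric_sums[of "1 / 4 :: real"] by (subst sums_Suc_iff) simp
    then have "suminf (\<lambda>m. (1 / 4 :: real) ^ Suc m) = 1 / 3" "summable (\<lambda>m. (1 / 4 :: real) ^ Suc m)"
      by (simp_all add: sums_iff)
    then show ?thesis by (simp add: suminf_mult del: power_Suc)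
  qed
  finally show "X z \<noteq> 0" using wn by auto
qed
end

section \<open>The difference equation between \<open>X\<close> and the transform\<close>

context jack_measure begin

text \<open>With r = - u / g the term of index m is rGamma r times e_m / F_m at u + g, and - g
  rGamma r times e_m / F_(m+1) at u. The combination is thus rGamma r times the sequence of
  \<open>Gr_partial_sums\<close>.\<close>

lemma X_equation_left:
  assumes u: "u < - (1 / g)"
  shows "X (of_real u + of_real g) * of_real (Gr u) + X (of_real u) / of_real g = 0"
proof -
  define r where "r = - u / g"
  have ur: "u = - (r * g)" using g_pos by (simp add: r_def)
  have u0: "u < 0" using u g_pos by (smt (verit) divide_pos_pos)
  then have "r > 0" using g_pos by (simp add: r_def divide_neg_pos)
  then have pr: "pochhammer r n > 0" for n by (intro pochhammer_pos)
  have rg: "rGamma (complex_of_real r) = of_real (pochhammer r n) * rGamma (of_real r + of_nat n)" for n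
    using pochhammer_rGamma[of "complex_of_real r" n] by (simp add: pochhammer_of_real)
  have 1: "X_term m (of_real u + of_real g) = rGamma (of_real r) * of_real (e m / F m u)" for m
  proof -
    have "of_nat (Suc m) - (of_real u + of_real g) / of_real g = complex_of_real r + of_nat m"
      using g_pos by (simp add: r_def add_divide_distrib)
    moreover have "(- 1 / g) ^ m * e m = pochhammer r m * (e m / F m u)"
      unfolding ur F_neg using g_pos pr[of m] by (simp add: power_divide field_simps flip: power_mult_distrib)
    ultimately have "X_term m (of_real u + of_real g) =
        of_real (pochhammer r m * (e m / F m u)) * rGamma (of_real r + of_nat m)"
      unfolding X_term_def by (simp only:)
    then show ?thesis unfolding rg[of m] by simp
  qed
  have 2: "X_term m (of_real u) / of_real g = - rGamma (of_real r) * of_real (e m / F (Suc m) u)" for m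
  proof -
    have "of_nat (Suc m) - of_real u / of_real g = complex_of_real r + of_nat (Suc m)"
      using g_pos by (simp add: r_def)
    moreover have "(- 1 / g) ^ m * e m / g = - (pochhammer r (Suc m) * (e m / F (Suc m) u))"
      unfolding ur F_neg using g_pos pr[of "Suc m"] by (simp add: power_divide field_simps flip: power_mult_distrib)
    then have "complex_of_real ((- 1 / g) ^ m * e m / g) = of_real (- (pochhammer r (Suc m) * (e m / F (Suc m) u)))"
      by (simp only:)
    moreover have "X_term m (of_real u) / of_real g =
        of_real ((- 1 / g) ^ m * e m / g) * rGamma (of_nat (Suc m) - of_real u / of_real g)"
      unfolding X_term_def by (simp only: of_real_divide times_divide_eq_left)
    ultimately have "X_term m (of_real u) / of_real g =
        of_real (- (pochhammer r (Suc m) * (e m / F (Suc m) u))) * rGamma (of_real r + of_nat (Suc m))"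
      by (simp only:)
    then show ?thesis unfolding rg[of "Suc m"] by simp
  qed
  have "(\<lambda>m. X_term m (of_real u + of_real g) * of_real (Gr u) + X_term m (of_real u) / of_real g) sums
    (X (of_real u + of_real g) * of_real (Gr u) + X (of_real u) / of_real g)"
    by (intro sums_add sums_mult2 sums_divide X_sums)
  then have "(\<lambda>n. \<Sum>m\<le>n. X_term m (of_real u + of_real g) * of_real (Gr u) + X_term m (of_real u) / of_real g) \<longlonglongrightarrow>
    X (of_real u + of_real g) * of_real (Gr u) + X (of_real u) / of_real g"
    by (simp add: sums_def_le)
  moreover have "(\<Sum>m\<le>n. X_term m (of_real u + of_real g) * of_real (Gr u) + X_term m (of_real u) / of_real g) =
    rGamma (of_real r) * of_real (\<Sum>m\<le>n. e m / F m u * Gr u - e m / F (Suc m) u)" for n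
    unfolding 1 2 of_real_sum sum_distrib_left by (intro sum.cong refl) (simp add: algebra_simps)
  moreover have "(\<lambda>n. rGamma (of_real r) * of_real (\<Sum>m\<le>n. e m / F m u * Gr u - e m / F (Suc m) u)) \<longlonglongrightarrow>
    rGamma (of_real r) * complex_of_real 0"
    by (intro tendsto_intros Gr_partial_sums u)
  ultimately show ?thesis using LIMSEQ_unique by fastforce
qed

text \<open>The plane without the real ray that carries the mass; it is star-shaped about real
  points to the left of the ray, hence connected.\<close>

definition slit :: "complex set" where "slit = {z. Im z \<noteq> 0 \<or> Re z < - (1 / g)}"

lemma slit_dist: "z \<in> slit \<Longrightarrow> \<exists>\<delta>>0. AE x in M. norm (z - complex_of_real x) \<ge> \<delta>"
proof (cases "Im z = 0")
  case True
  assume "z \<in> slit"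
  then have r: "Re z < - (1 / g)" using True by (simp add: slit_def)
  have "AE x in M. norm (z - complex_of_real x) \<ge> - (1 / g) - Re z"
    using AE_right
  proof eventually_elim
    case (elim x)
    then show ?case using abs_Re_le_cmod[of "z - complex_of_real x"] by simp
  qed
  then show ?thesis using r by (intro exI[of _ "- (1 / g) - Re z"]) simp
next
  case False
  have "norm (z - complex_of_real x) \<ge> \<bar>Im z\<bar>" for x using abs_Im_le_cmod[of "z - complex_of_real x"] by simp
  then show ?thesis using False by (intro exI[of _ "\<bar>Im z\<bar>"]) auto
qed

lemma slit_open: "open slit"
proof -
  have "slit = {z. Im z < 0} \<union> {z. Im z > 0} \<union> {z. Re z < - (1 / g)}" by (auto simp: slit_def)
  then show ?thesis by (simp add: open_halfspace_Im_lt open_halfspace_Im_gt open_halfspace_Re_lt open_Un)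
qed

lemma slit_connected: "connected slit"
proof (rule starlike_imp_connected)
  define a where "a = - (1 / g) - 1"
  have "closed_segment (of_real a) z \<subseteq> slit" if "z \<in> slit" for z
  proof
    fix y assume "y \<in> closed_segment (complex_of_real a) z"
    then obtain t where t: "0 \<le> t" "t \<le> 1" and y: "y = (1 - t) *\<^sub>R complex_of_real a + t *\<^sub>R z"
      by (auto simp: in_segment)
    show "y \<in> slit"
    proof (cases "Im z = 0 \<or> t = 0")
      case False then show ?thesis by (simp add: slit_def y)
    next
      case True
      have "(1 - t) * a + t * Re z < - (1 / g)"
      proof (cases "t = 0")
        case False
        then have "Re z < - (1 / g)" using True \<open>z \<in> slit\<close> by (auto simp: slit_def)
        then have "t * Re z < t * - (1 / g)" using False t by (intro mult_strict_left_mono) auto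
        moreover have "(1 - t) * a \<le> (1 - t) * - (1 / g)" using t by (intro mult_left_mono) (auto simp: a_def)
        moreover have "t * - (1 / g) + (1 - t) * - (1 / g) = - (1 / g)" by (simp add: diff_divide_distrib)
        ultimately show ?thesis by linarith
      qed (simp add: a_def)
      then show ?thesis by (simp add: slit_def y)
    qed
  qed
  moreover have "of_real a \<in> slit" by (simp add: slit_def a_def)
  ultimately show "starlike slit" unfolding starlike_def by blast
qed

lemma stieltjes_of_real:
  assumes "u < - (1 / g)"
  shows "stieltjes M (of_real u) = of_real (Gr u)"
proof -
  have "1 / (complex_of_real u - complex_of_real x) = complex_of_real (1 / (u - x))" for x by simp
  then show ?thesis unfolding stieltjes_def Gr_def by (simp only: integral_complex_of_real)
qed

text \<open>Identity theorem on the connected \<open>slit\<close>, starting from the real half-line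
  of \<open>X_equation_left\<close>.\<close>

lemma X_equation_slit:
  assumes "z \<in> slit"
  shows "X z = - of_real g * stieltjes M z * X (z + of_real g)"
proof -
  define U where "U = (complex_of_real ` {..< - (1 / g)})"
  define a where "a = - (1 / g) - 1"
  have "X (z + of_real g) * stieltjes M z + X z / of_real g = 0"
  proof (rule analytic_continuation[of "\<lambda>z. X (z + of_real g) * stieltjes M z + X z / of_real g" slit U "of_real a"])
    have "stieltjes M holomorphic_on slit"
      unfolding holomorphic_on_def
      using slit_dist stieltjes_differentiable field_differentiable_at_within by blast
    moreover have "(\<lambda>z. X (z + of_real g)) holomorphic_on slit"
    proof -
      have "(\<lambda>z. z + complex_of_real g) holomorphic_on slit" by (intro holomorphic_intros)
      from holomorphic_on_compose_gen[OF this X_holomorphic] show ?thesis by (simp add: o_def)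
    qed
    moreover have "X holomorphic_on slit" using X_holomorphic holomorphic_on_subset by blast
    ultimately show "(\<lambda>z. X (z + of_real g) * stieltjes M z + X z / of_real g) holomorphic_on slit"
      using g_pos by (intro holomorphic_intros) auto
    show "open slit" "connected slit" by (fact slit_open slit_connected)+
    show "U \<subseteq> slit" by (auto simp: U_def slit_def)
    show "of_real a \<in> slit" by (simp add: slit_def a_def)
    show "of_real a islimpt U"
      unfolding islimpt_approachable
    proof (intro allI impI)
      fix \<epsilon> :: real assume "\<epsilon> > 0"
      then show "\<exists>x'\<in>U. x' \<noteq> of_real a \<and> dist x' (of_real a) < \<epsilon>"
        by (intro bexI[of _ "of_real (a - \<epsilon> / 2)"]) (auto simp: U_def a_def dist_norm simp flip: of_real_diff)
    qed
    show "X (z + of_real g) * stieltjes M z + X z / of_real g = 0" if "z \<in> U" for z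
      using that X_equation_left stieltjes_of_real by (auto simp: U_def)
  qed (use assms in auto)
  then show ?thesis using g_pos by (simp add: field_simps add_eq_0_iff)
qed
end

section \<open>Support of the measure\<close>

text \<open>For a monotone function the symmetric difference quotient dominates both one-sided ones.\<close>

lemma mono_symmetric_derivative_0_const:
  fixes f :: "real \<Rightarrow> real"
  assumes "mono f" and "x \<in> {a<..<b}" "y \<in> {a<..<b}"
    and der: "\<And>x. x \<in> {a<..<b} \<Longrightarrow> ((\<lambda>h. (f (x + h) - f (x - h)) / h) \<longlongrightarrow> 0) (at_right 0)"
  shows "f x = f y"
proof -
  have "DERIV f x :> 0" if x: "x \<in> {a<..<b}" for x
  proof -
  have "((\<lambda>h. (f (x + h) - f x) / h) \<longlongrightarrow> 0) (at 0)"
  proof (rule Lim_null_comparison)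
    have R: "norm ((f (x + h) - f x) / h) \<le> (f (x + \<bar>h\<bar>) - f (x - \<bar>h\<bar>)) / \<bar>h\<bar>" if "h \<noteq> 0" for h
    proof -
      have "f (x - \<bar>h\<bar>) \<le> f x" "f x \<le> f (x + \<bar>h\<bar>)" "f (x - \<bar>h\<bar>) \<le> f (x + h)" "f (x + h) \<le> f (x + \<bar>h\<bar>)"
        using \<open>mono f\<close> by (auto simp: mono_def)
      then have "\<bar>f (x + h) - f x\<bar> \<le> f (x + \<bar>h\<bar>) - f (x - \<bar>h\<bar>)" by linarith
      then show ?thesis by (simp add: abs_divide divide_right_mono)
    qed
    show "\<forall>\<^sub>F h in at 0. norm ((f (x + h) - f x) / h) \<le> (f (x + \<bar>h\<bar>) - f (x - \<bar>h\<bar>)) / \<bar>h\<bar>"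
      unfolding eventually_at using R by (auto intro: exI[of _ 1])
    have "filterlim (\<lambda>h::real. \<bar>h\<bar>) (at_right 0) (at 0)"
    proof -
      have "((\<lambda>h::real. \<bar>h\<bar>) \<longlongrightarrow> \<bar>0\<bar>) (at 0)" by (intro tendsto_intros)
      then show ?thesis by (auto simp: filterlim_at eventually_at_filter)
    qed
    from filterlim_compose[OF der[OF x] this]
    show "((\<lambda>h. (f (x + \<bar>h\<bar>) - f (x - \<bar>h\<bar>)) / \<bar>h\<bar>) \<longlongrightarrow> 0) (at 0)" .
  qed
  then show ?thesis by (simp add: DERIV_def)
  qed
  then show ?thesis using assms(2,3) by (intro DERIV_isconst3[of a b x y f]) auto
qed

section \<open>Support, atoms and boundary values of the transform\<close>

lemma measure_support_closed: "closed (measure_support M)"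
proof -
  have "- measure_support M = \<Union>{U. open U \<and> emeasure M U = 0}"
    by (auto simp: measure_support_def not_gr_zero)
  then show ?thesis unfolding closed_def by auto
qed

context real_distribution begin

text \<open>The complement is a union of null open sets, of which countably many suffice by
  Lindelof's theorem.\<close>

lemma AE_measure_support: "AE x in M. x \<in> measure_support M"
proof -
  define \<F> where "\<F> = {U. open U \<and> emeasure M U = 0}"
  obtain \<F>' where F': "\<F>' \<subseteq> \<F>" "countable \<F>'" "\<Union>\<F>' = \<Union>\<F>"
    using Lindelof[of \<F>] by (auto simp: \<F>_def)
  have "(\<Union>U\<in>\<F>'. U) \<in> null_sets M"
    using F' by (intro null_sets_UN') (auto simp: \<F>_def null_sets_def)
  moreover have "\<Union>\<F> = - measure_support M" by (auto simp: measure_support_def \<F>_def not_gr_zero)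
  ultimately have "- measure_support M \<in> null_sets M" using F' by simp
  then show ?thesis by (rule AE_I') auto
qed

lemma stieltjes_differentiable_off_support:
  assumes "z \<notin> complex_of_real ` measure_support M"
  shows "stieltjes M field_differentiable at z"
proof -
  have "closed (complex_of_real ` measure_support M)"
    using measure_support_closed
    by (intro closed_injective_linear_image) (auto simp: linear_iff inj_on_def scaleR_conv_of_real)
  then obtain \<delta> where "\<delta> > 0" and \<delta>: "ball z \<delta> \<subseteq> - complex_of_real ` measure_support M"
    using assms unfolding closed_def open_contains_ball by blast
  have "norm (z - complex_of_real x) \<ge> \<delta>" if "x \<in> measure_support M" for x
    using \<delta> that by (force simp: subset_eq dist_norm not_less)
  then show ?thesis
    using \<open>\<delta> > 0\<close> AE_measure_support by (intro stieltjes_differentiable) (auto elim: eventually_mono)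
qed

lemma tendsto_stieltjes_off_support:
  assumes "u \<notin> measure_support M"
  shows "(stieltjes M \<longlongrightarrow> stieltjes M (of_real u)) (at (of_real u))"
proof -
  have "complex_of_real u \<notin> complex_of_real ` measure_support M" using assms by auto
  then show ?thesis
    by (intro isContD field_differentiable_imp_continuous_at stieltjes_differentiable_off_support)
qed

text \<open>The kernel y / ((x - t)^2 + y^2) is at least 1 / (2 y) for |x - t| \<le> y.\<close>

lemma cdf_difference_le:
  assumes "y > 0"
  shows "(cdf M (x + y) - cdf M (x - y)) / y \<le> 2 * (- Im (stieltjes M (Complex x y)))"
proof -
  have "(\<integral>t. indicator {x - y<..x + y} t * (1 / (2 * y)) \<partial>M) \<le> (\<integral>t. y / ((x - t)\<^sup>2 + y\<^sup>2) \<partial>M)"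
  proof (rule integral_mono)
    show "integrable M (\<lambda>t. y / ((x - t)\<^sup>2 + y\<^sup>2))" using Im_stieltjes(1)[of "Complex x y"] assms by simp
    show "integrable M (\<lambda>t. indicator {x - y<..x + y} t * (1 / (2 * y)))"
      by (intro integrable_mult_left integrable_real_indicator) (auto simp: emeasure_eq_measure)
    show "indicator {x - y<..x + y} t * (1 / (2 * y)) \<le> y / ((x - t)\<^sup>2 + y\<^sup>2)" for t
    proof (cases "t \<in> {x - y<..x + y}")
      case True
      then have "(x - t)\<^sup>2 \<le> y\<^sup>2" by (intro abs_le_square_iff[THEN iffD1]) auto
      then have "y / (2 * y\<^sup>2) \<le> y / ((x - t)\<^sup>2 + y\<^sup>2)"
        using assms by (intro divide_left_mono mult_pos_pos add_nonneg_pos) auto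
      then show ?thesis using True assms by (simp add: power2_eq_square)
    qed (use assms in auto)
  qed
  also have "(\<integral>t. indicator {x - y<..x + y} t * (1 / (2 * y)) \<partial>M) = prob {x - y<..x + y} * (1 / (2 * y))"
    by simp
  also have "prob {x - y<..x + y} = cdf M (x + y) - cdf M (x - y)" using assms cdf_diff_eq[of "x - y" "x + y"] by simp
  also have "(\<integral>t. y / ((x - t)\<^sup>2 + y\<^sup>2) \<partial>M) = - Im (stieltjes M (Complex x y))"
    using Im_stieltjes(2)[of "Complex x y"] assms by simp
  finally show ?thesis using assms by (simp add: field_simps)
qed

text \<open>The symmetric derivative of the distribution function vanishes on the interval by
  \<open>cdf_difference_le\<close>, so that function is constant there.\<close>

lemma not_in_support_if_Im_stieltjes_tendsto_0:
  assumes "x \<in> {a<..<b}"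
    and lim: "\<And>x. x \<in> {a<..<b} \<Longrightarrow> ((\<lambda>y. Im (stieltjes M (Complex x y))) \<longlongrightarrow> 0) (at_right 0)"
  shows "x \<notin> measure_support M"
proof -
  have const: "cdf M s = cdf M t" if "s \<in> {a<..<b}" "t \<in> {a<..<b}" for s t
  proof (rule mono_symmetric_derivative_0_const[OF _ that])
    show "mono (cdf M)" by (auto simp: mono_def intro: cdf_nondecreasing)
    fix x assume x: "x \<in> {a<..<b}"
    show "((\<lambda>h. (cdf M (x + h) - cdf M (x - h)) / h) \<longlongrightarrow> 0) (at_right 0)"
    proof (rule tendsto_sandwich)
      show "\<forall>\<^sub>F h in at_right 0. 0 \<le> (cdf M (x + h) - cdf M (x - h)) / h"
        using eventually_at_right_less by eventually_elim (auto intro!: divide_nonneg_pos cdf_nondecreasing)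
      show "\<forall>\<^sub>F h in at_right 0. (cdf M (x + h) - cdf M (x - h)) / h \<le> 2 * (- Im (stieltjes M (Complex x h)))"
        using eventually_at_right_less by eventually_elim (rule cdf_difference_le)
      have "((\<lambda>h. 2 * (- Im (stieltjes M (Complex x h)))) \<longlongrightarrow> 2 * (- 0)) (at_right 0)"
        by (intro tendsto_intros lim x)
      then show "((\<lambda>h. 2 * (- Im (stieltjes M (Complex x h)))) \<longlongrightarrow> 0) (at_right 0)" by simp
    qed simp
  qed
  obtain s t where st: "a < s" "s < x" "x < t" "t < b" using assms(1) dense by (metis greaterThanLessThan_iff)
  then have "prob {s<..t} = 0" using cdf_diff_eq[of s t] const[of s t] by simp
  moreover have "prob {s<..<t} \<le> prob {s<..t}" by (intro finite_measure_mono) auto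
  ultimately have "emeasure M {s<..<t} = 0" using measure_nonneg[of M "{s<..<t}"] by (simp add: emeasure_eq_measure)
  then show ?thesis using st unfolding measure_support_def
    by (auto intro!: exI[of _ "{s<..<t}"])
qed

text \<open>The integrand (z - t) / (z - x) equals 1 at the atom x = t; elsewhere on the support |z
  - x| \<ge> \<delta>, since the gap is 2 \<delta> and z is within \<delta> of t. So t is at most a
  simple pole, with residue the mass of t.\<close>

lemma stieltjes_isolated_point:
  assumes iso: "\<And>s. s \<in> measure_support M \<Longrightarrow> s \<noteq> t \<Longrightarrow> 2 * \<delta> \<le> \<bar>s - t\<bar>" and "\<delta> > 0"
    and "z \<noteq> of_real t" "norm (z - of_real t) < \<delta>"
  shows "norm ((z - of_real t) * stieltjes M z - of_real (prob {t})) \<le> norm (z - of_real t) / \<delta>"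
proof -
  define q where "q x = (if x = t then 0 else (z - of_real t) / (z - complex_of_real x))" for x
  have dist: "norm (z - complex_of_real x) \<ge> \<delta>" if "x \<in> measure_support M" "x \<noteq> t" for x
  proof -
    have "norm (complex_of_real x - of_real t) \<le> norm (z - complex_of_real x) + norm (z - of_real t)"
      using norm_triangle_ineq4[of "z - of_real t" "z - complex_of_real x"] by simp
    moreover have "norm (complex_of_real x - of_real t) = \<bar>x - t\<bar>" by (simp flip: of_real_diff)
    ultimately show ?thesis using iso[OF that] assms(4) by linarith
  qed
  have bd: "AE x in M. norm (q x) \<le> norm (z - of_real t) / \<delta>"
    using AE_measure_support
  proof eventually_elim
    case (elim x)
    show ?case using dist[OF elim] \<open>\<delta> > 0\<close> by (auto simp: q_def norm_divide intro!: divide_left_mono mult_pos_pos)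
  qed
  have iq: "integrable M q" by (rule integrable_const_bound[OF bd]) (simp add: q_def[abs_def])
  have ir: "integrable M (\<lambda>x. indicator {t} x :: real)"
    by (intro integrable_real_indicator) (auto simp: emeasure_eq_measure)
  then have ii: "integrable M (\<lambda>x. complex_of_real (indicator {t} x))" by (rule integrable_of_real)
  have "(z - of_real t) * stieltjes M z = (\<integral>x. (z - of_real t) * (1 / (z - complex_of_real x)) \<partial>M)"
    by (simp only: stieltjes_def integral_mult_right_zero)
  also have "\<dots> = (\<integral>x. complex_of_real (indicator {t} x) + q x \<partial>M)"
    using assms(3) by (intro Bochner_Integration.integral_cong) (auto simp: q_def indicator_def)
  also have "\<dots> = of_real (prob {t}) + integral\<^sup>L M q"
    using iq ii by (simp only: Bochner_Integration.integral_add integral_complex_of_real) simp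
  finally have "norm ((z - of_real t) * stieltjes M z - of_real (prob {t})) = norm (integral\<^sup>L M q)" by simp
  also have "\<dots> \<le> (\<integral>x. norm (q x) \<partial>M)" by (rule integral_norm_bound)
  also have "\<dots> \<le> (\<integral>x. norm (z - of_real t) / \<delta> \<partial>M)" using bd iq by (intro integral_mono_AE) auto
  also have "\<dots> = norm (z - of_real t) / \<delta>" using prob_space by simp
  finally show ?thesis .
qed

lemma isolated_support_point_mass:
  assumes "t \<in> measure_support M" and iso: "\<And>s. s \<in> measure_support M \<Longrightarrow> s \<noteq> t \<Longrightarrow> \<delta> \<le> \<bar>s - t\<bar>" "\<delta> > 0"
  shows "prob {t} > 0"
proof -
  have "emeasure M (ball t \<delta>) > 0" using assms by (auto simp: measure_support_def)
  also have "emeasure M (ball t \<delta>) = emeasure M {t}"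
  proof (rule emeasure_eq_AE)
    show "AE x in M. x \<in> ball t \<delta> \<longleftrightarrow> x \<in> {t}"
      using AE_measure_support by eventually_elim (use iso in \<open>force simp: dist_real_def\<close>)
  qed auto
  finally show ?thesis by (simp add: emeasure_eq_measure)
qed
end

text \<open>Cancel (z - t)^a and let z tend to t: if a < m, or if a = m and \<psi> tends to 0, then
  h would tend to 0. In the application \<psi> is the transform up to a factor.\<close>

lemma order_comparison:
  fixes h k \<psi> :: "complex \<Rightarrow> complex"
  assumes eq: "\<forall>\<^sub>F z in at t. (z - t) ^ a * h z = \<psi> z * ((z - t) ^ m * k z)"
    and lim: "(h \<longlongrightarrow> h0) (at t)" "(k \<longlongrightarrow> k0) (at t)" "(\<psi> \<longlongrightarrow> L) (at t)" and "h0 \<noteq> 0"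
  shows "m \<le> a" "L = 0 \<Longrightarrow> m < a"
proof -
  have False if ma: "a \<le> m" and z: "a < m \<or> L = 0"
  proof -
    have "\<forall>\<^sub>F z in at t. \<psi> z * ((z - t) ^ (m - a) * k z) = h z"
      using eq eventually_neq_at_within[of t t UNIV]
    proof eventually_elim
      case (elim z)
      have pm: "(z - t) ^ m = (z - t) ^ a * (z - t) ^ (m - a)" using ma by (simp flip: power_add)
      have "(z - t) ^ a * (\<psi> z * ((z - t) ^ (m - a) * k z)) = (z - t) ^ a * h z"
        using elim(1) unfolding pm by (simp only: mult_ac)
      moreover have "(z - t) ^ a \<noteq> 0" using elim by simp
      ultimately show ?case by (metis mult_left_cancel)
    qed
    moreover have "((\<lambda>z. \<psi> z * ((z - t) ^ (m - a) * k z)) \<longlongrightarrow> L * ((t - t) ^ (m - a) * k0)) (at t)"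
      by (intro tendsto_intros lim)
    ultimately have "(h \<longlongrightarrow> L * ((t - t) ^ (m - a) * k0)) (at t)" by (rule Lim_transform_eventually[rotated])
    then have "h0 = L * ((t - t) ^ (m - a) * k0)" using lim(1) by (intro tendsto_unique[of "at t"]) auto
    then show False using z \<open>h0 \<noteq> 0\<close> by auto
  qed
  then show "m \<le> a" "L = 0 \<Longrightarrow> m < a" by (metis nat_le_linear not_le, metis not_le)
qed

text \<open>Induction on the largest point m of A: the point of B between m and its predecessor y
  lies beyond those used for the gaps up to y.\<close>

lemma card_le_if_separated:
  fixes A B :: "real set"
  assumes "finite A" "finite B"
    and "\<And>x y. x \<in> A \<Longrightarrow> y \<in> A \<Longrightarrow> x < y \<Longrightarrow> {x<..<y} \<inter> A = {} \<Longrightarrow> \<exists>b\<in>B. x < b \<and> b < y"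
  shows "card A \<le> Suc (card B)"
  using assms
proof (induction A arbitrary: B rule: finite_linorder_max_induct)
  case (insert m A)
  show ?case
  proof (cases "A = {}")
    case False
    define y where "y = Max A"
    have y: "y \<in> A" "\<And>x. x \<in> A \<Longrightarrow> x \<le> y" using insert.hyps False by (auto simp: y_def)
    have "{y<..<m} \<inter> insert m A = {}" using y by force
    then obtain b where b: "b \<in> B" "y < b" "b < m" using insert.prems(2)[of y m] y insert.hyps by auto
    have "card A \<le> Suc (card {b\<in>B. b < y})"
    proof (rule insert.IH)
      fix x x' assume x: "x \<in> A" "x' \<in> A" "x < x'" "{x<..<x'} \<inter> A = {}"
      have "{x<..<x'} \<inter> insert m A = {}" using x insert.hyps by force
      then obtain c where "c \<in> B" "x < c" "c < x'" using insert.prems(2)[of x x'] x by auto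
      then show "\<exists>b\<in>{b\<in>B. b < y}. x < b \<and> b < x'" using y(2)[OF x(2)] by (intro bexI[of _ c]) auto
    qed (use insert.prems in auto)
    moreover have "card {b\<in>B. b < y} \<le> card (B - {b})" using b insert.prems by (intro card_mono) auto
    then have "card {b\<in>B. b < y} < card B" using card_Diff1_less[OF insert.prems(1) b(1)] by linarith
    moreover have "m \<notin> A" using insert.hyps by auto
    ultimately show ?thesis using insert.hyps by simp
  qed simp
qed simp

context jack_sequence begin

section \<open>Real zeros of \<open>X\<close> and their orders\<close>

lemma X_Reals: "Im (X (of_real x)) = 0"
proof -
  have "Im (X_term m (of_real x)) = 0" for m
  proof -
    have "complex_of_nat (Suc m) - of_real x / of_real g = of_real (real (Suc m) - x / g)" by simp
    then show ?thesis unfolding X_term_def by (simp only: rGamma_complex_of_real flip: of_real_mult) simp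
  qed
  then have "(\<lambda>m. 0) sums Im (X (of_real x))" using sums_Im[OF X_sums[of "of_real x"]] by simp
  then show ?thesis using sums_unique2 sums_zero by blast
qed

lemma tendsto_X: "(X \<longlongrightarrow> X z) (at z within A)"
proof -
  have "continuous_on UNIV X" using X_holomorphic by (rule holomorphic_on_imp_continuous_on)
  then have "isCont X z" by (simp add: continuous_on_eq_continuous_at)
  then show ?thesis by (meson continuous_at_imp_continuous_at_within continuous_within)
qed

lemma X_not_identically_0: "\<exists>z. X z \<noteq> 0"
proof -
  obtain R where "\<And>z. Re z \<le> - R \<Longrightarrow> X z \<noteq> 0" using X_nonzero_left by blast
  then have "X (of_real (- R)) \<noteq> 0" by (metis Re_complex_of_real order_refl)
  then show ?thesis by blast
qed

text \<open>By \<open>X_nonzero_left\<close> these zeros lie in a compact disc. A constant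
  \<open>X\<close> is a nonzero constant and is set apart, as the finiteness theorem concerns
  nonconstant functions.\<close>

lemma finite_real_zeros_X: "finite {t::real. t \<le> w \<and> X (of_real t) = 0}"
proof (cases "X constant_on UNIV")
  case True
  then obtain c where "X z = c" for z by (auto simp: constant_on_def)
  then have "X z \<noteq> 0" for z using X_not_identically_0 by auto
  then show ?thesis by simp
next
  case False
  obtain R where R: "R > 0" "\<And>z. Re z \<le> - R \<Longrightarrow> X z \<noteq> 0" using X_nonzero_left by blast
  have "finite {z\<in>cball 0 (max R \<bar>w\<bar>). X z = 0}"
    by (rule holomorphic_compact_finite_zeros[OF X_holomorphic]) (use False in auto)
  moreover have "of_real ` {t::real. t \<le> w \<and> X (of_real t) = 0} \<subseteq> {z\<in>cball 0 (max R \<bar>w\<bar>). X z = 0}"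
  proof safe
    fix t :: real assume t: "t \<le> w" "X (of_real t) = 0"
    have "\<not> t \<le> - R" using R(2)[of "of_real t"] t by auto
    then show "complex_of_real t \<in> cball 0 (max R \<bar>w\<bar>)" using t by auto
  qed
  ultimately have "finite (complex_of_real ` {t::real. t \<le> w \<and> X (of_real t) = 0})" by (rule finite_subset[rotated])
  then show ?thesis by (rule finite_imageD) (auto simp: inj_on_def)
qed

definition X_order :: "real \<Rightarrow> nat" where "X_order t = nat (zorder X (of_real t))"

lemma X_order:
  "X_order t > 0 \<longleftrightarrow> X (of_real t) = 0"
  "\<exists>h h0. h0 \<noteq> 0 \<and> (h \<longlongrightarrow> h0) (at (of_real t)) \<and>
     (\<forall>\<^sub>F z in at (of_real t). X z = (z - of_real t) ^ X_order t * h z)"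
proof -
  have "\<exists>w\<in>UNIV. X w \<noteq> 0" using X_not_identically_0 by blast
  note Z = zorder_exist_zero[OF X_holomorphic open_UNIV connected_UNIV UNIV_I this, of "of_real t"]
  note * = conjunct1[OF Z]
  from conjunct2[OF Z] obtain r where r: "r > 0" "zor_poly X (of_real t) holomorphic_on cball (of_real t) r"
    and rX: "\<forall>w\<in>cball (of_real t) r. X w = zor_poly X (of_real t) w * (w - of_real t) ^ X_order t \<and>
        zor_poly X (of_real t) w \<noteq> 0"
    unfolding X_order_def[symmetric] by (elim exE conjE)
  show "X_order t > 0 \<longleftrightarrow> X (of_real t) = 0" using * by (auto simp: X_order_def split: if_splits)
  let ?h = "zor_poly X (of_real t)"
  have "?h holomorphic_on ball (of_real t) r" using r(2) by (rule holomorphic_on_subset) auto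
  then have "isCont ?h (of_real t)"
    using r(1) by (auto dest!: holomorphic_on_imp_continuous_on simp: continuous_on_eq_continuous_at)
  then have "(?h \<longlongrightarrow> ?h (of_real t)) (at (of_real t))" by (rule isContD)
  moreover have "\<forall>\<^sub>F z in at (of_real t). X z = (z - of_real t) ^ X_order t * ?h z"
    unfolding eventually_at using r(1) rX
    by (intro exI[of _ r]) (simp add: dist_commute mult.commute)
  moreover have "?h (of_real t) \<noteq> 0" using r(1) rX by simp
  ultimately show "\<exists>h h0. h0 \<noteq> 0 \<and> (h \<longlongrightarrow> h0) (at (of_real t)) \<and>
     (\<forall>\<^sub>F z in at (of_real t). X z = (z - of_real t) ^ X_order t * h z)" by blast
qed
end

text \<open>The gap is stated at every real t: at a support point it is isolation, elsewhere a
  neighbourhood without support. The factor 2 leaves room for z in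
  \<open>stieltjes_isolated_point\<close>. Neither g nor v occurs, so the results apply to measures
  for both signs of g.\<close>

locale discrete_distribution = real_distribution +
  assumes support_gap: "\<exists>\<delta>>0. \<forall>s\<in>measure_support M. s \<noteq> t \<longrightarrow> 2 * \<delta> \<le> \<bar>s - t\<bar>"
begin

abbreviation S :: "real set" where "S \<equiv> measure_support M"

lemma stieltjes_real: "u \<notin> S \<Longrightarrow> stieltjes M (of_real u) = of_real (Gr u)"
proof -
  have "1 / (complex_of_real u - complex_of_real x) = complex_of_real (1 / (u - x))" for x by simp
  then show ?thesis unfolding stieltjes_def Gr_def by (simp only: integral_complex_of_real)
qed

lemma Gr_integrable: "u \<notin> S \<Longrightarrow> integrable M (\<lambda>x. 1 / (u - x))"
proof -
  assume "u \<notin> S"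
  obtain \<delta> where \<delta>: "\<delta> > 0" "\<And>s. s \<in> S \<Longrightarrow> s \<noteq> u \<Longrightarrow> 2 * \<delta> \<le> \<bar>s - u\<bar>" using support_gap[of u] by blast
  show ?thesis
  proof (rule integrable_const_bound[of _ "1 / \<delta>"])
    show "AE x in M. norm (1 / (u - x)) \<le> 1 / \<delta>"
      using AE_measure_support
    proof eventually_elim
      case (elim x)
      then have "\<bar>u - x\<bar> \<ge> \<delta>" using \<delta>(2)[of x] \<open>u \<notin> S\<close> \<delta>(1) by force
      then show ?case using \<delta>(1) by (simp add: abs_divide frac_le)
    qed
  qed measurable
qed

lemma Gr_strict_decreasing:
  assumes "u < u'" "{u..u'} \<inter> S = {}"
  shows "Gr u' < Gr u"
  unfolding Gr_def
proof (rule integral_less_AE_space)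
  show "integrable M (\<lambda>x. 1 / (u' - x))" "integrable M (\<lambda>x. 1 / (u - x))"
    using assms by (auto intro!: Gr_integrable simp: disjoint_iff)
  show "AE x in M. 1 / (u' - x) < 1 / (u - x)"
    using AE_measure_support
  proof eventually_elim
    case (elim x)
    then have "x \<notin> {u..u'}" using assms(2) by blast
    then consider "x < u" | "u' < x" by fastforce
    then show ?case
    proof cases
      case 1 then show ?thesis using assms(1) by (intro divide_strict_left_mono mult_pos_pos) auto
    next
      case 2
      then have "1 / (x - u) < 1 / (x - u')" using assms(1) by (intro divide_strict_left_mono mult_pos_pos) auto
      moreover have "1 / (u' - x) = - (1 / (x - u'))" "1 / (u - x) = - (1 / (x - u))"
        by (simp_all add: minus_divide_right)
      ultimately show ?thesis by linarith
    qed
  qed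
  show "emeasure M (space M) \<noteq> 0" using emeasure_space_1 by simp
qed

lemma Gr_near_pole:
  assumes "t \<in> S"
  obtains \<delta> where "\<delta> > 0" "{t - \<delta><..<t + \<delta>} \<inter> S = {t}"
    "\<And>u. t - \<delta> < u \<Longrightarrow> u < t \<Longrightarrow> Gr u < 0" "\<And>u. t < u \<Longrightarrow> u < t + \<delta> \<Longrightarrow> Gr u > 0"
proof -
  obtain d where d: "d > 0" "\<And>s. s \<in> S \<Longrightarrow> s \<noteq> t \<Longrightarrow> 2 * d \<le> \<bar>s - t\<bar>" using support_gap[of t] by blast
  define p where "p = prob {t}"
  have p: "p > 0" unfolding p_def
    by (rule isolated_support_point_mass[OF assms, of d]) (use d in force)+
  \<comment> \<open>Makes the error |u - t| / d at most p / 2, so (u - t) * Gr u keeps the sign of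
    the mass p.\<close>
  define \<delta> where "\<delta> = min d (d * p / 2)"
  have \<delta>: "\<delta> > 0" "\<delta> \<le> d" "\<delta> \<le> d * p / 2" using d p by (auto simp: \<delta>_def)
  have iso: "{t - \<delta><..<t + \<delta>} \<inter> S = {t}" using d \<delta> assms by force
  have *: "(u - t) * Gr u > 0" if u: "\<bar>u - t\<bar> < \<delta>" "u \<noteq> t" for u
  proof -
    have "u \<in> {t - \<delta><..<t + \<delta>}" using u(1) by (simp add: abs_less_iff)
    then have uS: "u \<notin> S" using iso u(2) by blast
    have nm: "norm (complex_of_real u - of_real t) = \<bar>u - t\<bar>" by (simp flip: of_real_diff)
    have le: "norm ((complex_of_real u - of_real t) * stieltjes M (of_real u) - of_real p) \<le> \<bar>u - t\<bar> / d"
      unfolding p_def nm[symmetric]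
    proof (rule stieltjes_isolated_point)
      show "complex_of_real u \<noteq> of_real t" using u(2) by simp
      show "norm (complex_of_real u - of_real t) < d" unfolding nm using u(1) \<delta>(2) by linarith
    qed (use d in auto)
    have "(complex_of_real u - of_real t) * stieltjes M (of_real u) - of_real p = of_real ((u - t) * Gr u - p)"
      using stieltjes_real[OF uS] by simp
    then have "\<bar>(u - t) * Gr u - p\<bar> \<le> \<bar>u - t\<bar> / d" using le by (simp only: norm_of_real)
    also have "\<bar>u - t\<bar> / d \<le> p / 2" using u \<delta> d by (simp add: field_simps)
    finally show ?thesis using p by linarith
  qed
  show ?thesis
  proof (rule that[OF \<delta>(1) iso])
    fix u assume "t - \<delta> < u" "u < t"
    then show "Gr u < 0" using *[of u] by (simp add: zero_less_mult_iff)
  next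
    fix u assume "t < u" "u < t + \<delta>"
    then show "Gr u > 0" using *[of u] by (simp add: zero_less_mult_iff)
  qed
qed

lemma Gr_continuous: "u \<notin> S \<Longrightarrow> isCont Gr u"
proof -
  assume u: "u \<notin> S"
  obtain d where d: "d > 0" "\<And>s. s \<in> S \<Longrightarrow> s \<noteq> u \<Longrightarrow> 2 * d \<le> \<bar>s - u\<bar>" using support_gap[of u] by blast
  have c1: "isCont (stieltjes M) (of_real u)" using tendsto_stieltjes_off_support[OF u] by (simp add: isCont_def)
  have c2: "isCont complex_of_real u" by (intro continuous_intros)
  have "isCont (\<lambda>x. stieltjes M (of_real x)) u" by (rule isCont_o2[OF c2 c1])
  then have c3: "isCont (\<lambda>x. Re (stieltjes M (of_real x))) u" by (rule isCont_Re)
  have ev: "\<forall>\<^sub>F x in nhds u. Re (stieltjes M (of_real x)) = Gr x"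
    unfolding eventually_nhds_metric
  proof (intro exI[of _ d] conjI allI impI)
    fix y assume "dist y u < d"
    then have "y \<notin> S" using d u by (force simp: dist_real_def)
    then show "Re (stieltjes M (of_real y)) = Gr y" by (simp add: stieltjes_real)
  qed (use d in auto)
  show ?thesis using c3 isCont_cong[OF ev] by (simp only:)
qed

text \<open>\<open>Gr\<close> is positive just to the right of x and negative just to the left of y,
  and continuous in between.\<close>

lemma Gr_zero_between:
  assumes "x \<in> S" "y \<in> S" "x < y" "{x<..<y} \<inter> S = {}"
  shows "\<exists>b. x < b \<and> b < y \<and> b \<notin> S \<and> Gr b = 0"
proof -
  obtain d where d: "d > 0" "\<And>u. x < u \<Longrightarrow> u < x + d \<Longrightarrow> Gr u > 0" using Gr_near_pole[OF assms(1)] by metis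
  obtain d' where d': "d' > 0" "\<And>u. y - d' < u \<Longrightarrow> u < y \<Longrightarrow> Gr u < 0" using Gr_near_pole[OF assms(2)] by metis
  define r where "r = min (min d d') (y - x) / 3"
  have r: "r > 0" "r < d" "r < d'" "3 * r \<le> y - x" using d d' assms by (auto simp: r_def)
  have "\<exists>b\<ge>x + r. b \<le> y - r \<and> Gr b = 0"
  proof (rule IVT2)
    show "Gr (y - r) \<le> 0" using d'(2)[of "y - r"] r by simp
    show "0 \<le> Gr (x + r)" using d(2)[of "x + r"] r by simp
    show "x + r \<le> y - r" using r by simp
    show "\<forall>b. x + r \<le> b \<and> b \<le> y - r \<longrightarrow> isCont Gr b"
      using assms(4) r by (auto intro!: Gr_continuous simp: disjoint_iff)
  qed
  then obtain b where "x + r \<le> b" "b \<le> y - r" "Gr b = 0" by auto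
  then show ?thesis using assms(4) r by (intro exI[of _ b]) (auto simp: disjoint_iff)
qed

end

section \<open>Counting zeros of \<open>X\<close> in windows of length \<open>g\<close>\<close>

context jack_measure begin

text \<open>Real points off the support but to the right of \<open>- (1 / g)\<close> lie outside
  \<open>slit\<close>; they are reached by continuity along a vertical line.\<close>

lemma X_equation:
  assumes "z \<notin> complex_of_real ` measure_support M"
  shows "X z = - of_real g * stieltjes M z * X (z + of_real g)"
proof (cases "Im z = 0")
  case False
  then show ?thesis by (intro X_equation_slit) (simp add: slit_def)
next
  case True
  define w where "w n = z + \<i> * of_real (inverse (real (Suc n)))" for n
  have "w \<longlonglongrightarrow> z + \<i> * of_real 0"
    unfolding w_def by (intro tendsto_intros LIMSEQ_inverse_real_of_nat)
  then have w: "w \<longlonglongrightarrow> z" by simp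
  have X: "isCont X y" for y using tendsto_X[of y UNIV] by (simp add: isCont_def)
  have G: "isCont (stieltjes M) z"
    using stieltjes_differentiable_off_support[OF assms] by (rule field_differentiable_imp_continuous_at)
  have "(\<lambda>n. X (w n)) \<longlonglongrightarrow> X z" by (rule isCont_tendsto_compose[OF X w])
  moreover have "(\<lambda>n. - of_real g * stieltjes M (w n) * X (w n + of_real g)) \<longlonglongrightarrow>
      - of_real g * stieltjes M z * X (z + of_real g)"
    by (intro tendsto_intros isCont_tendsto_compose[OF G w] isCont_tendsto_compose[OF X] w)
  moreover have "X (w n) = - of_real g * stieltjes M (w n) * X (w n + of_real g)" for n
    using True by (intro X_equation_slit) (simp add: slit_def w_def)
  ultimately show ?thesis using LIMSEQ_unique by simp
qed

lemma support_ge: "x \<in> measure_support M \<Longrightarrow> - (1 / g) \<le> x"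
proof (rule ccontr)
  assume "x \<in> measure_support M" "\<not> - (1 / g) \<le> x"
  moreover have "emeasure M {..< - (1 / g)} = 0"
  proof -
    have "emeasure M {..< - (1 / g)} = emeasure M {}"
      by (rule emeasure_eq_AE) (use AE_right in \<open>auto elim: eventually_mono\<close>)
    then show ?thesis by simp
  qed
  ultimately show False unfolding measure_support_def
    by (auto dest!: spec[of _ "{..< - (1 / g)}"])
qed

text \<open>Near a point with X (x + g) \<noteq> 0 the equation writes the transform as a quotient
  with continuous boundary values, and these are real because \<open>X\<close> is real on the line;
  hence there is no mass.\<close>

lemma support_zero:
  assumes "x \<in> measure_support M"
  shows "X (of_real (x + g)) = 0"
proof (rule ccontr)
  assume nz: "X (of_real (x + g)) \<noteq> 0"
  have "open {u::real. X (of_real (u + g)) \<noteq> 0}"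
  proof -
    have "continuous_on UNIV (\<lambda>u::real. X (of_real (u + g)))"
      by (intro continuous_on_compose2[OF holomorphic_on_imp_continuous_on[OF X_holomorphic]] continuous_intros) auto
    then show ?thesis by (intro open_Collect_neq continuous_intros)
  qed
  then obtain d where d: "d > 0" "ball x d \<subseteq> {u. X (of_real (u + g)) \<noteq> 0}"
    using nz unfolding open_contains_ball by blast
  have "x \<notin> measure_support M"
  proof (rule not_in_support_if_Im_stieltjes_tendsto_0)
    show "x \<in> {x - d<..<x + d}" using d by simp
    fix u assume "u \<in> {x - d<..<x + d}"
    then have u: "X (of_real u + of_real g) \<noteq> 0" using d by (auto simp: subset_eq dist_real_def)
    have lim: "filterlim (\<lambda>y. Complex u y) (nhds (of_real u)) (at_right 0)"
    proof -
      have "((\<lambda>y. Complex u y) \<longlongrightarrow> Complex u 0) (at_right 0)" by (intro tendsto_intros)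
      then show ?thesis by (simp add: complex_of_real_def)
    qed
    have X: "isCont X y" for y using tendsto_X[of y UNIV] by (simp add: isCont_def)
    have "((\<lambda>y. - X (Complex u y) / (of_real g * X (Complex u y + of_real g))) \<longlongrightarrow>
        - X (of_real u) / (of_real g * X (of_real u + of_real g))) (at_right 0)"
      using u g_pos by (intro tendsto_intros isCont_tendsto_compose[OF X] lim) auto
    moreover have "\<forall>\<^sub>F y in at_right 0. stieltjes M (Complex u y) = - X (Complex u y) / (of_real g * X (Complex u y + of_real g))"
    proof -
      have "((\<lambda>y. X (Complex u y + of_real g)) \<longlongrightarrow> X (of_real u + of_real g)) (at_right 0)"
        by (intro tendsto_intros isCont_tendsto_compose[OF X] lim)
      then have "\<forall>\<^sub>F y in at_right 0. X (Complex u y + of_real g) \<noteq> 0" using u by (rule tendsto_imp_eventually_ne)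
      then show ?thesis using eventually_at_right_less
      proof eventually_elim
        case (elim y)
        have "X (Complex u y) = - of_real g * stieltjes M (Complex u y) * X (Complex u y + of_real g)"
          using elim by (intro X_equation_slit) (simp add: slit_def)
        then show ?case using elim g_pos by (simp add: field_simps)
      qed
    qed
    ultimately have "((\<lambda>y. stieltjes M (Complex u y)) \<longlongrightarrow> - X (of_real u) / (of_real g * X (of_real u + of_real g))) (at_right 0)"
      by (rule Lim_transform_eventually[OF _ eventually_mono]) auto
    then have "((\<lambda>y. Im (stieltjes M (Complex u y))) \<longlongrightarrow> Im (- X (of_real u) / (of_real g * X (of_real u + of_real g)))) (at_right 0)"
      by (rule tendsto_Im)
    moreover have "Im (- X (of_real u) / (of_real g * X (of_real u + of_real g))) = 0"
      using X_Reals[of u] X_Reals[of "u + g"] by (simp add: Im_divide)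
    ultimately show "((\<lambda>y. Im (stieltjes M (Complex u y))) \<longlongrightarrow> 0) (at_right 0)" by simp
  qed
  then show False using assms by blast
qed

lemma finite_support_le: "finite {t\<in>measure_support M. t \<le> w}"
proof (rule finite_subset)
  show "{t\<in>measure_support M. t \<le> w} \<subseteq> (\<lambda>t. t - g) ` {t::real. t \<le> w + g \<and> X (of_real t) = 0}"
    using support_zero by (force simp: image_iff intro!: exI[of _ "_ + g"])
qed (simp add: finite_real_zeros_X)

lemma support_gap_around: "\<exists>\<delta>>0. \<forall>s\<in>measure_support M. s \<noteq> t \<longrightarrow> 2 * \<delta> \<le> \<bar>s - t\<bar>"
proof -
  obtain d where d: "d > 0" "\<And>x. x \<in> {s\<in>measure_support M. s \<le> t + 1} \<Longrightarrow> x \<noteq> t \<Longrightarrow> d \<le> dist t x"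
    using finite_set_avoid[OF finite_support_le[of "t + 1"], of t] by auto
  have "2 * (min d 1 / 2) \<le> \<bar>s - t\<bar>" if "s \<in> measure_support M" "s \<noteq> t" for s
    using d(2)[of s] that by (cases "s \<le> t + 1") (auto simp: dist_real_def)
  then show ?thesis using d(1) by (intro exI[of _ "min d 1 / 2"]) auto
qed

sublocale discrete_distribution M
  by unfold_locales (rule support_gap_around)

text \<open>The factor between X z and X (z + g) is - g times the transform: finite off the support,
  where the order cannot rise and drops at a zero of \<open>Gr\<close>, and with at most a simple
  pole on the support.\<close>

lemma X_order_change:
  shows "X_order (t + g) \<le> X_order t + (if t \<in> S then 1 else 0)"
    and "t \<notin> S \<Longrightarrow> Gr t = 0 \<Longrightarrow> X_order (t + g) < X_order t"
proof -
  obtain h h0 where h: "h0 \<noteq> 0" "(h \<longlongrightarrow> h0) (at (of_real t))"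
    "\<forall>\<^sub>F z in at (of_real t). X z = (z - of_real t) ^ X_order t * h z" using X_order(2)[of t] by blast
  obtain k k0 where k: "k0 \<noteq> 0" "(k \<longlongrightarrow> k0) (at (of_real (t + g)))"
    "\<forall>\<^sub>F z in at (of_real (t + g)). X z = (z - of_real (t + g)) ^ X_order (t + g) * k z" using X_order(2)[of "t + g"] by blast
  have sh: "filterlim (\<lambda>z. z + of_real g) (at (complex_of_real (t + g))) (at (of_real t))"
  proof -
    have "((\<lambda>z. z + of_real g) \<longlongrightarrow> complex_of_real t + of_real g) (at (of_real t))" by (intro tendsto_intros)
    then show ?thesis by (auto simp: filterlim_at eventually_at_filter)
  qed
  define k' where "k' z = k (z + of_real g)" for z
  have k'l: "(k' \<longlongrightarrow> k0) (at (of_real t))" unfolding k'_def by (rule filterlim_compose[OF k(2) sh])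
  have k'e: "\<forall>\<^sub>F z in at (of_real t). X (z + of_real g) = (z - of_real t) ^ X_order (t + g) * k' z"
    using eventually_compose_filterlim[OF k(3) sh] by (simp add: k'_def)
  obtain d where d: "d > 0" "\<And>s. s \<in> S \<Longrightarrow> s \<noteq> t \<Longrightarrow> 2 * d \<le> \<bar>s - t\<bar>" using support_gap_around[of t] by blast
  have near: "\<forall>\<^sub>F z in at (of_real t). z \<noteq> of_real t \<and> dist z (complex_of_real t) < d"
    using d(1) by (auto simp: eventually_at intro!: exI[of _ d])
  have eq: "\<forall>\<^sub>F z in at (of_real t). X z = - of_real g * stieltjes M z * X (z + of_real g)"
    using near
  proof eventually_elim
    case (elim z)
    show ?case
    proof (rule X_equation, rule notI)
      assume "z \<in> complex_of_real ` S"
      then obtain s where s: "s \<in> S" "z = of_real s" by auto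
      then have "\<bar>s - t\<bar> < d" "s \<noteq> t" using elim by (auto simp: dist_norm simp flip: of_real_diff)
      then show False using d(2)[OF s(1)] d(1) by linarith
    qed
  qed
  have off: "X_order (t + g) \<le> X_order t" "Gr t = 0 \<Longrightarrow> X_order (t + g) < X_order t" if "t \<notin> S"
  proof -
    have e: "\<forall>\<^sub>F z in at (of_real t). (z - of_real t) ^ X_order t * h z =
        (- of_real g * stieltjes M z) * ((z - of_real t) ^ X_order (t + g) * k' z)"
      using eq h(3) k'e by eventually_elim simp
    have l: "((\<lambda>z. - of_real g * stieltjes M z) \<longlongrightarrow> - of_real g * of_real (Gr t)) (at (of_real t))"
      using tendsto_stieltjes_off_support[OF that] stieltjes_real[OF that] by (intro tendsto_intros) auto
    note oc = order_comparison[OF e h(2) k'l l h(1)]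
    show "X_order (t + g) \<le> X_order t" by (rule oc(1))
    show "X_order (t + g) < X_order t" if "Gr t = 0" using that by (intro oc(2)) simp
  qed
  have on: "X_order (t + g) \<le> Suc (X_order t)" if "t \<in> S"
  proof -
    \<comment> \<open>The extra factor z - t absorbs the pole, so that the coefficient
      converges.\<close>
    have e: "\<forall>\<^sub>F z in at (of_real t). (z - of_real t) ^ Suc (X_order t) * h z =
        (- of_real g * ((z - of_real t) * stieltjes M z)) * ((z - of_real t) ^ X_order (t + g) * k' z)"
      using eq h(3) k'e
    proof eventually_elim
      case (elim z)
      have "(z - of_real t) ^ Suc (X_order t) * h z = (z - of_real t) * X z" using elim(2) by (simp only: power_Suc mult.assoc)
      also have "\<dots> = (z - of_real t) * (- of_real g * stieltjes M z * X (z + of_real g))" using elim(1) by (simp only:)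
      finally show ?case unfolding elim(3) by (simp only: mult_ac)
    qed
    have "((\<lambda>z. (z - of_real t) * stieltjes M z - of_real (prob {t})) \<longlongrightarrow> 0) (at (of_real t))"
    proof (rule Lim_null_comparison)
      show "\<forall>\<^sub>F z in at (of_real t). norm ((z - of_real t) * stieltjes M z - of_real (prob {t})) \<le> norm (z - of_real t) / d"
        using near by eventually_elim (rule stieltjes_isolated_point, use d in \<open>auto simp: dist_norm\<close>)
      have "((\<lambda>z. norm (z - complex_of_real t) / d) \<longlongrightarrow> norm (complex_of_real t - of_real t) / d) (at (of_real t))"
        using d by (intro tendsto_intros) auto
      then show "((\<lambda>z. norm (z - complex_of_real t) / d) \<longlongrightarrow> 0) (at (of_real t))" by simp
    qed
    then have "((\<lambda>z. (z - of_real t) * stieltjes M z) \<longlongrightarrow> of_real (prob {t})) (at (of_real t))" by (rule LIM_zero_cancel)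
    then have l: "((\<lambda>z. - of_real g * ((z - of_real t) * stieltjes M z)) \<longlongrightarrow> - of_real g * of_real (prob {t})) (at (of_real t))"
      by (intro tendsto_intros)
    show ?thesis by (rule order_comparison(1)[OF e h(2) k'l l h(1)])
  qed
  show "X_order (t + g) \<le> X_order t + (if t \<in> S then 1 else 0)" using on off by auto
  show "t \<notin> S \<Longrightarrow> Gr t = 0 \<Longrightarrow> X_order (t + g) < X_order t" using off by auto
qed

text \<open>The poles and zeros of the Stieltjes transform interlace, and their orders are the increments
  of \<^term>\<open>X_order\<close> along the step \<^term>\<open>g\<close>; hence a window of length \<^term>\<open>g\<close> contains at
  most one zero of \<^term>\<open>X\<close>.\<close>

lemma X_zeros_separated:
  assumes "X (of_real p) = 0" "X (of_real q) = 0" "w < p" "p < q" "q \<le> w + g"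
  shows False
proof -
  \<comment> \<open>The t \<le> w for which the order at t or at t + g is nonzero; all sums below
    are over this finite set.\<close>
  define T where "T = {t. t \<le> w \<and> X (of_real t) = 0} \<union> (\<lambda>t. t - g) ` {t. t \<le> w + g \<and> X (of_real t) = 0}"
  have finT: "finite T" unfolding T_def by (intro finite_UnI finite_imageI finite_real_zeros_X)
  define B where "B = {t. t \<le> w \<and> t \<notin> S \<and> Gr t = 0}"
  have BT: "B \<subseteq> T"
  proof
    fix t assume t: "t \<in> B"
    then have "X_order t > 0" using X_order_change(2)[of t] by (auto simp: B_def)
    then show "t \<in> T" using t X_order(1) by (auto simp: T_def B_def)
  qed
  have finB: "finite B" using BT finT by (rule finite_subset)
  define A where "A = {t\<in>S. t \<le> w}"
  have finA: "finite A" unfolding A_def by (rule finite_support_le)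
  have AT: "A \<subseteq> T"
  proof
    fix t assume "t \<in> A"
    then have "t + g \<in> {t. t \<le> w + g \<and> X (of_real t) = 0}" using support_zero by (auto simp: A_def)
    then have "t + g - g \<in> T" unfolding T_def by blast
    then show "t \<in> T" by simp
  qed
  have "card A \<le> Suc (card B)"
  proof (rule card_le_if_separated[OF finA finB])
    fix x y assume "x \<in> A" "y \<in> A" "x < y" "{x<..<y} \<inter> A = {}"
    moreover from this have "{x<..<y} \<inter> S = {}" by (force simp: A_def)
    ultimately obtain b where "x < b" "b < y" "b \<notin> S" "Gr b = 0"
      using Gr_zero_between[of x y] by (auto simp: A_def)
    then show "\<exists>b\<in>B. x < b \<and> b < y" using \<open>y \<in> A\<close> by (intro bexI[of _ b]) (auto simp: A_def B_def)
  qed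
  moreover have "(\<Sum>t\<in>T. X_order (t + g)) + card B \<le> (\<Sum>t\<in>T. X_order t) + card A"
  proof -
    have "(\<Sum>t\<in>T. X_order (t + g) + (if t \<in> B then 1 else 0)) \<le> (\<Sum>t\<in>T. X_order t + (if t \<in> A then 1 else 0))"
    proof (rule sum_mono)
      fix t assume "t \<in> T"
      then have "t \<le> w" by (auto simp: T_def)
      then show "X_order (t + g) + (if t \<in> B then 1 else 0) \<le> X_order t + (if t \<in> A then 1 else 0)"
        using X_order_change(1)[of t] X_order_change(2)[of t] by (auto simp: A_def B_def)
    qed
    moreover have "(\<Sum>t\<in>T. if t \<in> C then 1 else 0 :: nat) = card C" if "C \<subseteq> T" for C
      using finT that by (simp add: sum.If_cases Int_absorb1)
    ultimately show ?thesis using AT BT by (simp add: sum.distrib)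
  qed
  \<comment> \<open>Shifted by g, \<open>T\<close> contains all zeros up to w + g, among them
    \<open>p\<close> and \<open>q\<close>, which exceed w and so are not counted on the
    left.\<close>
  moreover have "(\<Sum>t\<in>T. X_order t) + 2 \<le> (\<Sum>t\<in>T. X_order (t + g))"
  proof -
    define P where "P = {t. t \<le> w \<and> X (of_real t) = 0}"
    have finP: "finite P" unfolding P_def by (rule finite_real_zeros_X)
    have "(\<Sum>t\<in>T. X_order t) = (\<Sum>t\<in>P. X_order t)"
      using finT X_order(1) by (intro sum.mono_neutral_right) (auto simp: P_def T_def)
    then have "(\<Sum>t\<in>T. X_order t) + 2 \<le> (\<Sum>t\<in>insert p (insert q P). X_order t)"
      using finP assms X_order(1)[of p] X_order(1)[of q] by (simp add: P_def)
    also have "\<dots> \<le> (\<Sum>t\<in>(\<lambda>t. t + g) ` T. X_order t)"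
    proof (rule sum_mono2)
      have "t \<in> (\<lambda>t. t + g) ` T" if "t \<le> w + g" "X (of_real t) = 0" for t
        using that by (intro image_eqI[of _ _ "t - g"]) (auto simp: T_def)
      then show "insert p (insert q P) \<subseteq> (\<lambda>t. t + g) ` T" using assms g_pos by (auto simp: P_def)
    qed (use finT in auto)
    also have "\<dots> = (\<Sum>t\<in>T. X_order (t + g))" by (subst sum.reindex) (auto simp: inj_on_def)
    finally show ?thesis .
  qed
  ultimately show False by linarith
qed

text \<open>If y - x < g, then x + g and y + g are zeros of \<open>X\<close> in the same window (y,
  y + g].\<close>

lemma support_separated:
  assumes "x \<in> S" "y \<in> S" "x < y"
  shows "g \<le> y - x"
proof (rule ccontr)
  assume "\<not> g \<le> y - x"
  then show False using X_zeros_separated[OF support_zero[OF assms(1)] support_zero[OF assms(2)], of y] assms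
    by auto
qed

end

section \<open>Derivatives of monotone Lipschitz functions\<close>

text \<open>The assumptions are symmetric under replacing q by x - q, so an upper estimate for one
  function is a lower estimate for the other.\<close>

locale unit_slope =
  fixes q :: "real \<Rightarrow> real"
  assumes q_mono: "x \<le> y \<Longrightarrow> q x \<le> q y" and q_lip: "x \<le> y \<Longrightarrow> q y - q x \<le> y - x"
begin

lemma complement: "unit_slope (\<lambda>x. x - q x)"
  using q_mono q_lip by unfold_locales (force simp: algebra_simps)+

lemma q_continuous: "continuous_on UNIV q"
proof -
  have "\<bar>q x - q y\<bar> \<le> \<bar>x - y\<bar>" for x y
    using q_mono[of x y] q_mono[of y x] q_lip[of x y] q_lip[of y x] by linarith
  then have "1-lipschitz_on UNIV q" by (auto simp: lipschitz_on_def dist_real_def)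
  then show ?thesis by (rule lipschitz_on_continuous_on)
qed

abbreviation N :: "real measure" where "N \<equiv> interval_measure q"

lemma N_Icc: "a \<le> b \<Longrightarrow> emeasure N {a..b} = ennreal (q b - q a)"
  using q_continuous q_mono by (intro emeasure_interval_measure_Icc) auto

lemma N_Ioo: "a \<le> b \<Longrightarrow> emeasure N {a<..<b} = ennreal (q b - q a)"
proof -
  assume "a \<le> b"
  have pt: "AE x in N. x \<noteq> c" for c
    using N_Icc[of c c] by (intro AE_I[of _ _ "{c}"]) auto
  have "emeasure N {a<..<b} = emeasure N {a..b}"
    by (rule emeasure_eq_AE) (use pt[of a] pt[of b] in \<open>eventually_elim, auto\<close>)
  then show ?thesis using N_Icc[OF \<open>a \<le> b\<close>] by simp
qed
end

text \<open>The sum of the two interval measures gives an open interval its length, which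
  characterizes Lebesgue measure.\<close>

lemma (in unit_slope) N_add_complement:
  assumes "A \<in> sets borel"
  shows "emeasure N A + emeasure (interval_measure (\<lambda>x. x - q x)) A = emeasure lborel A"
proof -
  interpret c: unit_slope "\<lambda>x. x - q x" by (rule complement)
  define K where "K = measure_of UNIV (sets borel) (\<lambda>A. emeasure N A + emeasure c.N A)"
  have sK: "sets K = sets borel" unfolding K_def using sets.sigma_sets_eq[of borel] by simp
  have eK: "emeasure K A = emeasure N A + emeasure c.N A" if "A \<in> sets borel" for A
  proof (rule emeasure_measure_of[OF K_def])
    show "positive (sets K) (\<lambda>A. emeasure N A + emeasure c.N A)" by (simp add: positive_def)
    show "countably_additive (sets K) (\<lambda>A. emeasure N A + emeasure c.N A)"
      unfolding countably_additive_def sK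
    proof safe
      fix A :: "nat \<Rightarrow> real set" assume "range A \<subseteq> sets borel" "disjoint_family A"
      then show "suminf (\<lambda>i. emeasure N (A i) + emeasure c.N (A i)) = emeasure N (\<Union>i. A i) + emeasure c.N (\<Union>i. A i)"
        by (simp add: suminf_add[symmetric] suminf_emeasure)
    qed
  qed (use that sK in auto)
  have "lborel = K"
  proof (rule lborel_eqI)
    fix l u :: real assume "\<And>b. b \<in> Basis \<Longrightarrow> l \<bullet> b \<le> u \<bullet> b"
    then have "l \<le> u" by simp
    then show "emeasure K (box l u) = ennreal (\<Prod>b\<in>Basis. (u - l) \<bullet> b)"
      using q_mono[of l u] q_lip[of l u] by (simp add: eK box_real N_Ioo c.N_Ioo ennreal_plus[symmetric] del: ennreal_plus)
  qed (rule sK)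
  then show ?thesis using eK[OF assms] by simp
qed

section \<open>Almost everywhere differentiation with a bounded density\<close>

context unit_slope begin

lemma N_le_lborel: "A \<in> sets borel \<Longrightarrow> emeasure N A \<le> emeasure lborel A"
  by (metis N_add_complement le_iff_add)

lemma exists_density: "\<exists>f\<in>borel_measurable lborel. density lborel f = N"
proof (rule sigma_finite_measure.Radon_Nikodym[OF sigma_finite_lborel])
  show "absolutely_continuous lborel N"
    unfolding absolutely_continuous_def null_sets_def by auto (metis N_le_lborel le_zero_eq)
qed simp

text \<open>The upper half of Lebesgue's differentiation theorem, by the Vitali covering theorem.\<close>

lemma upper_density_null:
  assumes f[measurable]: "f \<in> borel_measurable borel" and dens: "density lborel f = N" and "0 \<le> p" "p < r"
  shows "negligible {x. f x < ennreal p \<and> (\<forall>d>0. \<exists>a b. a \<le> x \<and> x \<le> b \<and> a < b \<and> b - a < d \<and> r * (b - a) < q b - q a)}"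
    (is "negligible {x. f x < _ \<and> ?P x}")
proof -
  have "negligible ({x. f x < ennreal p \<and> ?P x} \<inter> {- real n<..<real n})" for n
    unfolding negligible_outer_le
  proof (intro allI impI)
    fix \<epsilon> :: real assume "\<epsilon> > 0"
    define A where "A = {x. f x < ennreal p} \<inter> {- real n<..<real n}"
    have Ab[measurable]: "A \<in> sets borel" unfolding A_def by measurable
    \<comment> \<open>Chosen because the estimate will end in (r - p) * m \<le> \<eta> for the
      measure m of the covering.\<close>
    define \<eta> where "\<eta> = (r - p) * \<epsilon>"
    have \<eta>: "\<eta> > 0" using \<open>\<epsilon> > 0\<close> \<open>p < r\<close> by (simp add: \<eta>_def)
    obtain U0 where U0: "open U0" "A \<subseteq> U0" "emeasure lborel (U0 - A) \<le> ennreal \<eta>"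
      using outer_regular_lborel_le[OF Ab \<eta>] by blast
    define U where "U = U0 \<inter> {- real n<..<real n}"
    have U: "open U" "A \<subseteq> U" using U0 by (auto simp: U_def A_def)
    have [measurable]: "U \<in> sets borel" using U(1) by simp
    have "emeasure lborel (U - A) \<le> emeasure lborel (U0 - A)"
      using U0(1) by (intro emeasure_mono) (auto simp: U_def)
    then have UA: "emeasure lborel (U - A) \<le> ennreal \<eta>" using U0(3) by (rule order_trans)
    \<comment> \<open>Intervals inside \<open>U\<close>, coded by centre and radius, over which q
      grows faster than the slope r; they form a Vitali cover of the exceptional set.\<close>
    define K where "K = {(c, \<rho>). 0 < \<rho> \<and> cball c \<rho> \<subseteq> U \<and> r * (2 * \<rho>) < q (c + \<rho>) - q (c - \<rho>)}"
    define S where "S = {x. f x < ennreal p \<and> ?P x} \<inter> {- real n<..<real n}"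
    obtain C where C: "countable C" "C \<subseteq> K"
      "pairwise (\<lambda>i j. disjnt (cball (fst i) (snd i)) (cball (fst j) (snd j))) C"
      "negligible (S - (\<Union>i\<in>C. cball (fst i) (snd i)))"
    proof (rule Vitali_covering_theorem_cballs[of K snd S fst])
      show "0 < snd i" if "i \<in> K" for i using that by (auto simp: K_def)
      fix x d :: real assume x: "x \<in> S" and "0 < d"
      then have "x \<in> U" using U by (auto simp: S_def A_def)
      then obtain \<delta> where \<delta>: "\<delta> > 0" "ball x \<delta> \<subseteq> U" using U(1) unfolding open_contains_ball by blast
      obtain a b where ab: "a \<le> x" "x \<le> b" "a < b" "b - a < min d \<delta>" "r * (b - a) < q b - q a"
        using x \<open>0 < d\<close> \<open>\<delta> > 0\<close> unfolding S_def by (auto dest!: spec[of _ "min d \<delta>"])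
      define c where "c = (a + b) / 2"
      define \<rho> where "\<rho> = (b - a) / 2"
      have cb: "cball c \<rho> = {a..b}" unfolding cball_eq_atLeastAtMost by (simp add: c_def \<rho>_def field_simps)
      have "{a..b} \<subseteq> ball x \<delta>" using ab by (auto simp: dist_real_def)
      then have "cball c \<rho> \<subseteq> U" using \<delta>(2) unfolding cb by blast
      moreover have e: "c + \<rho> = b" "c - \<rho> = a" "2 * \<rho> = b - a" by (simp_all add: c_def \<rho>_def field_simps)
      have "r * (2 * \<rho>) < q (c + \<rho>) - q (c - \<rho>)" unfolding e by (rule ab(5))
      moreover have "0 < \<rho>" using ab(3) by (simp add: \<rho>_def)
      ultimately have "(c, \<rho>) \<in> K" by (simp add: K_def)
      moreover have "x \<in> cball c \<rho>" unfolding cb using ab by simp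
      moreover have "\<rho> < d" using ab by (simp add: \<rho>_def)
      ultimately show "\<exists>i. i \<in> K \<and> x \<in> cball (fst i) (snd i) \<and> snd i < d" by (intro exI[of _ "(c, \<rho>)"]) auto
    qed
    define V where "V = (\<Union>i\<in>C. cball (fst i) (snd i))"
    have Vb[measurable]: "V \<in> sets borel" unfolding V_def using C(1) by (intro sets.countable_UN') auto
    have VU: "V \<subseteq> U"
      unfolding V_def
    proof (rule UN_least)
      fix i assume "i \<in> C"
      then have "i \<in> K" using C(2) by blast
      then show "cball (fst i) (snd i) \<subseteq> U" by (auto simp: K_def)
    qed
    have dis: "disjoint_family_on (\<lambda>i. cball (fst i) (snd i)) C"
      using C(3) by (auto simp: disjoint_family_on_def pairwise_def disjnt_def)
    have Vsum: "emeasure Q V = (\<integral>\<^sup>+i. emeasure Q (cball (fst i) (snd i)) \<partial>count_space C)" if "sets Q = sets borel" for Q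
      unfolding V_def using C(1) dis that by (intro emeasure_UN_countable) auto
    have rV: "ennreal r * emeasure lborel V \<le> emeasure N V"
    proof -
      have "ennreal r * emeasure lborel V = (\<integral>\<^sup>+i. ennreal r * emeasure lborel (cball (fst i) (snd i)) \<partial>count_space C)"
        by (subst Vsum) (auto simp: nn_integral_cmult)
      also have "\<dots> \<le> (\<integral>\<^sup>+i. emeasure N (cball (fst i) (snd i)) \<partial>count_space C)"
      proof (rule nn_integral_mono)
        fix i assume "i \<in> space (count_space C)"
        then have "i \<in> K" using C(2) by auto
        then obtain c \<rho> where i: "i = (c, \<rho>)" "0 < \<rho>" "r * (2 * \<rho>) < q (c + \<rho>) - q (c - \<rho>)" by (auto simp: K_def)
        have "ennreal r * emeasure lborel (cball c \<rho>) = ennreal (r * (2 * \<rho>))"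
          using i \<open>0 \<le> p\<close> \<open>p < r\<close> by (simp add: cball_eq_atLeastAtMost ennreal_mult)
        also have "\<dots> \<le> ennreal (q (c + \<rho>) - q (c - \<rho>))" using i by (intro ennreal_leI) simp
        also have "\<dots> = emeasure N (cball c \<rho>)" using i by (simp add: cball_eq_atLeastAtMost N_Icc)
        finally show "ennreal r * emeasure lborel (cball (fst i) (snd i)) \<le> emeasure N (cball (fst i) (snd i))"
          by (simp add: i)
      qed
      also have "\<dots> = emeasure N V" by (subst Vsum) auto
      finally show ?thesis .
    qed
    have Vfin: "emeasure lborel V < \<infinity>"
    proof -
      have "emeasure lborel V \<le> emeasure lborel {- real n<..<real n}"
        using VU by (intro emeasure_mono) (auto simp: U_def)
      also have "\<dots> < \<infinity>" by simp
      finally show ?thesis .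
    qed
    have "emeasure N V \<le> emeasure N (V \<inter> A) + emeasure N (U - A)"
    proof -
      have "emeasure N V \<le> emeasure N ((V \<inter> A) \<union> (U - A))" using VU by (intro emeasure_mono) auto
      also have "\<dots> \<le> emeasure N (V \<inter> A) + emeasure N (U - A)" by (intro emeasure_subadditive) auto
      finally show ?thesis .
    qed
    also have "emeasure N (V \<inter> A) \<le> ennreal p * emeasure lborel V"
    proof -
      have "emeasure N (V \<inter> A) = (\<integral>\<^sup>+x. f x * indicator (V \<inter> A) x \<partial>lborel)"
        unfolding dens[symmetric] by (subst emeasure_density) auto
      also have "\<dots> \<le> (\<integral>\<^sup>+x. ennreal p * indicator V x \<partial>lborel)"
        by (intro nn_integral_mono) (auto simp: A_def indicator_def)
      also have "\<dots> = ennreal p * emeasure lborel V" by (simp add: nn_integral_cmult_indicator)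
      finally show ?thesis .
    qed
    also have "emeasure N (U - A) \<le> ennreal \<eta>" using N_le_lborel[of "U - A"] UA by (auto intro: order_trans)
    finally have le: "ennreal r * emeasure lborel V \<le> ennreal p * emeasure lborel V + ennreal \<eta>"
      using rV by (meson add_left_mono add_right_mono order_trans)
    define m where "m = measure lborel V"
    have m: "emeasure lborel V = ennreal m" "m \<ge> 0"
      using Vfin by (auto simp: m_def emeasure_eq_ennreal_measure)
    have "r * m \<le> p * m + \<eta>"
      using le \<eta> \<open>0 \<le> p\<close> \<open>p < r\<close> m(2) unfolding m(1)
      by (simp add: ennreal_mult[symmetric] ennreal_plus[symmetric] del: ennreal_plus)
    then have "(r - p) * m \<le> (r - p) * \<epsilon>" by (simp add: \<eta>_def algebra_simps)
    then have m\<epsilon>: "m \<le> \<epsilon>" using \<open>p < r\<close> by simp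
    define Z where "Z = S - V"
    have Z: "Z \<in> lmeasurable" "measure lebesgue Z = 0"
      using C(4) by (auto simp: Z_def V_def negligible_iff_measure)
    have VL: "V \<in> lmeasurable" using Vfin by (intro fmeasurableI) (auto simp: emeasure_completion)
    have "measure lebesgue (Z \<union> V) \<le> measure lebesgue Z + measure lebesgue V"
      using Z VL by (intro measure_Un_le) (auto simp: fmeasurableD)
    also have "measure lebesgue V = m" by (simp add: m_def measure_completion)
    finally have "measure lebesgue (Z \<union> V) \<le> \<epsilon>" using Z m\<epsilon> by simp
    moreover have "Z \<union> V \<in> lmeasurable" by (rule fmeasurable.Un[OF Z(1) VL])
    moreover have "S \<subseteq> Z \<union> V" by (auto simp: Z_def)
    ultimately show "\<exists>T. {x. f x < ennreal p \<and> ?P x} \<inter> {- real n<..<real n} \<subseteq> T \<and> T \<in> lmeasurable \<and> measure lebesgue T \<le> \<epsilon>"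
      unfolding S_def[symmetric] by blast
  qed
  then have "negligible (\<Union>n. {x. f x < ennreal p \<and> ?P x} \<inter> {- real n<..<real n})"
    by (intro negligible_countable_Union) auto
  moreover have "(\<Union>n. {x. f x < ennreal p \<and> ?P x} \<inter> {- real n<..<real n}) = {x. f x < ennreal p \<and> ?P x}"
  proof -
    have "\<exists>n. x \<in> {- real n<..<real n}" for x
      using reals_Archimedean2[of "\<bar>x\<bar>"] by (auto simp: abs_less_iff)  (metis minus_less_iff)
    then show ?thesis by blast
  qed
  ultimately show ?thesis by simp
qed

text \<open>Restricting p and r to rationals keeps the union of the exceptional sets null.\<close>

lemma AE_upper_density:
  assumes f: "f \<in> borel_measurable borel" and dens: "density lborel f = N"
  shows "AE x in lebesgue. \<forall>p\<in>\<rat>. \<forall>r\<in>\<rat>. 0 \<le> p \<longrightarrow> p < r \<longrightarrow> f x < ennreal p \<longrightarrow>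
    (\<exists>d>0. \<forall>a b. a \<le> x \<longrightarrow> x \<le> b \<longrightarrow> a < b \<longrightarrow> b - a < d \<longrightarrow> q b - q a \<le> r * (b - a))"
proof -
  have "AE x in lebesgue. 0 \<le> p \<longrightarrow> p < r \<longrightarrow> f x < ennreal p \<longrightarrow>
    (\<exists>d>0. \<forall>a b. a \<le> x \<longrightarrow> x \<le> b \<longrightarrow> a < b \<longrightarrow> b - a < d \<longrightarrow> q b - q a \<le> r * (b - a))" for p r
  proof (cases "0 \<le> p \<and> p < r")
    case True
    show ?thesis
      by (rule AE_I'[OF upper_density_null[OF f dens, of p r, unfolded negligible_iff_null_sets]])
        (use True in \<open>auto simp: not_le\<close>)
  qed auto
  then show ?thesis by (simp add: AE_ball_countable countable_rat)
qed
end

text \<open>The upper estimate for q bounds its difference quotients from above by h, and the upper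
  estimate for x - q, whose density is 1 - h, bounds them from below.\<close>

lemma (in unit_slope) derivative_density:
  obtains h where "h \<in> borel_measurable borel" "\<And>x. 0 \<le> h x" "\<And>x. h x \<le> 1"
    "density lborel (\<lambda>x. ennreal (h x)) = N"
    "density lborel (\<lambda>x. ennreal (1 - h x)) = interval_measure (\<lambda>x. x - q x)"
    "AE x in lebesgue. (q has_real_derivative h x) (at x)"
proof -
  interpret c: unit_slope "\<lambda>x. x - q x" by (rule complement)
  obtain f where f[measurable]: "f \<in> borel_measurable borel" and df: "density lborel f = N" using exists_density by auto
  obtain f' where f'[measurable]: "f' \<in> borel_measurable borel" and df': "density lborel f' = c.N" using c.exists_density by auto
  have "density lborel (\<lambda>x. f x + f' x) = density lborel (\<lambda>_. 1)"
  proof (rule measure_eqI)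
    fix A assume "A \<in> sets (density lborel (\<lambda>x. f x + f' x))"
    then have A[measurable]: "A \<in> sets borel" by simp
    have "emeasure (density lborel (\<lambda>x. f x + f' x)) A = emeasure (density lborel f) A + emeasure (density lborel f') A"
      by (simp add: emeasure_density nn_integral_add distrib_right)
    also have "\<dots> = emeasure lborel A" unfolding df df' by (rule N_add_complement[OF A])
    finally show "emeasure (density lborel (\<lambda>x. f x + f' x)) A = emeasure (density lborel (\<lambda>_. 1)) A"
      by (simp add: emeasure_density)
  qed simp
  then have one: "AE x in lborel. f x + f' x = 1"
    by (intro sigma_finite_measure.density_unique[OF sigma_finite_lborel]) auto
  \<comment> \<open>Truncation makes the bounds 0 \<le> h \<le> 1 hold everywhere and not just
    almost everywhere.\<close>
  define h where "h x = enn2real (min 1 (f x))" for x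
  have hm[measurable]: "h \<in> borel_measurable borel" unfolding h_def[abs_def] by measurable
  have h0: "0 \<le> h x" for x by (simp add: h_def)
  have h1: "h x \<le> 1" for x
  proof -
    have "min 1 (f x) \<le> 1" by simp
    then show ?thesis unfolding h_def by (metis enn2real_1 enn2real_mono ennreal_one_less_top)
  qed
  have hf: "AE x in lborel. f x = ennreal (h x) \<and> f' x = ennreal (1 - h x)"
    using one
  proof eventually_elim
    case (elim x)
    then have "f x \<le> 1" by (metis le_iff_add)
    then have fx: "f x = ennreal (h x)" by (simp add: h_def min_def ennreal_enn2real_if top.extremum_unique)
        (metis ennreal_one_neq_top top.extremum_unique)
    have "ennreal (h x) + f' x = ennreal (h x) + ennreal (1 - h x)"
      using elim h0[of x] h1[of x] by (simp add: fx ennreal_plus[symmetric] del: ennreal_plus)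
    then have "f' x = ennreal (1 - h x)" by (simp add: ennreal_add_left_cancel)
    with fx show ?case by simp
  qed
  have dh: "density lborel (\<lambda>x. ennreal (h x)) = N"
    unfolding df[symmetric] by (rule density_cong) (use hf in auto)
  have dh': "density lborel (\<lambda>x. ennreal (1 - h x)) = c.N"
    unfolding df'[symmetric] by (rule density_cong) (use hf in auto)
  have m1: "(\<lambda>x. ennreal (h x)) \<in> borel_measurable borel" "(\<lambda>x. ennreal (1 - h x)) \<in> borel_measurable borel" by measurable
  have "AE x in lebesgue. (q has_real_derivative h x) (at x)"
    using AE_upper_density[OF m1(1) dh] c.AE_upper_density[OF m1(2) dh']
  proof eventually_elim
    case (elim x)
    have up: "\<exists>d>0. \<forall>a b. a \<le> x \<longrightarrow> x \<le> b \<longrightarrow> a < b \<longrightarrow> b - a < d \<longrightarrow> q b - q a \<le> (h x + \<epsilon>) * (b - a)" if eps: "\<epsilon> > 0" for \<epsilon>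
    proof -
      obtain p where p: "p \<in> \<rat>" "h x < p" "p < h x + \<epsilon>" using Rats_dense_in_real[of "h x" "h x + \<epsilon>"] eps by auto
      obtain r where r: "r \<in> \<rat>" "p < r" "r < h x + \<epsilon>" using Rats_dense_in_real[of p "h x + \<epsilon>"] p by auto
      have "0 \<le> p" using p h0[of x] by linarith
      moreover have "ennreal (h x) < ennreal p" using p h0[of x] by (simp add: ennreal_lessI)
      ultimately obtain d where d: "d > 0" "\<And>a b. a \<le> x \<Longrightarrow> x \<le> b \<Longrightarrow> a < b \<Longrightarrow> b - a < d \<Longrightarrow> q b - q a \<le> r * (b - a)"
        using elim(1) p(1) r(1,2) by meson
      have "q b - q a \<le> (h x + \<epsilon>) * (b - a)" if "a \<le> x" "x \<le> b" "a < b" "b - a < d" for a b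
        using d(2)[OF that] mult_right_mono[of r "h x + \<epsilon>" "b - a"] r that by linarith
      then show ?thesis using d(1) by blast
    qed
    have lo: "\<exists>d>0. \<forall>a b. a \<le> x \<longrightarrow> x \<le> b \<longrightarrow> a < b \<longrightarrow> b - a < d \<longrightarrow> (h x - \<epsilon>) * (b - a) \<le> q b - q a" if eps: "\<epsilon> > 0" for \<epsilon>
    proof -
      obtain p where p: "p \<in> \<rat>" "1 - h x < p" "p < 1 - h x + \<epsilon>" using Rats_dense_in_real[of "1 - h x" "1 - h x + \<epsilon>"] eps by auto
      obtain r where r: "r \<in> \<rat>" "p < r" "r < 1 - h x + \<epsilon>" using Rats_dense_in_real[of p "1 - h x + \<epsilon>"] p by auto
      have "0 \<le> p" using p h1[of x] by linarith
      moreover have "ennreal (1 - h x) < ennreal p" using p h1[of x] by (simp add: ennreal_lessI)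
      ultimately obtain d where d: "d > 0" "\<And>a b. a \<le> x \<Longrightarrow> x \<le> b \<Longrightarrow> a < b \<Longrightarrow> b - a < d \<Longrightarrow> (b - q b) - (a - q a) \<le> r * (b - a)"
        using elim(2) p(1) r(1,2) by meson
      have "(h x - \<epsilon>) * (b - a) \<le> q b - q a" if "a \<le> x" "x \<le> b" "a < b" "b - a < d" for a b
      proof -
        have "(1 - h x + \<epsilon>) * (b - a) = (b - a) - (h x - \<epsilon>) * (b - a)" by (simp add: algebra_simps)
        then show ?thesis using d(2)[OF that] mult_right_mono[of r "1 - h x + \<epsilon>" "b - a"] r that by linarith
      qed
      then show ?thesis using d(1) by blast
    qed
    have "((\<lambda>y. (q y - q x) / (y - x)) \<longlongrightarrow> h x) (at x)"
    proof (rule tendstoI)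
      fix \<epsilon> :: real assume "\<epsilon> > 0"
      then have "\<epsilon> / 2 > 0" by simp
      obtain d1 where d1: "d1 > 0" "\<And>a b. a \<le> x \<Longrightarrow> x \<le> b \<Longrightarrow> a < b \<Longrightarrow> b - a < d1 \<Longrightarrow> q b - q a \<le> (h x + \<epsilon> / 2) * (b - a)"
        using up[OF \<open>\<epsilon> / 2 > 0\<close>] by blast
      obtain d2 where d2: "d2 > 0" "\<And>a b. a \<le> x \<Longrightarrow> x \<le> b \<Longrightarrow> a < b \<Longrightarrow> b - a < d2 \<Longrightarrow> (h x - \<epsilon> / 2) * (b - a) \<le> q b - q a"
        using lo[OF \<open>\<epsilon> / 2 > 0\<close>] by blast
      have key: "dist ((q y - q x) / (y - x)) (h x) < \<epsilon>" if y: "y \<noteq> x" "dist y x < min d1 d2" for y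
      proof -
        define a where "a = min x y" define b where "b = max x y"
        have ab: "a \<le> x" "x \<le> b" "a < b" "b - a < d1" "b - a < d2" using y by (auto simp: a_def b_def dist_real_def)
        have quo: "(q y - q x) / (y - x) = (q b - q a) / (b - a)"
          by (auto simp: a_def b_def max_def min_def) (metis minus_diff_eq minus_divide_divide)
        have "(q b - q a) / (b - a) \<le> h x + \<epsilon> / 2" "h x - \<epsilon> / 2 \<le> (q b - q a) / (b - a)"
          using d1(2)[of a b] d2(2)[of a b] ab by (auto simp: pos_divide_le_eq pos_le_divide_eq)
        then show ?thesis unfolding quo dist_real_def using \<open>\<epsilon> > 0\<close> by linarith
      qed
      show "\<forall>\<^sub>F y in at x. dist ((q y - q x) / (y - x)) (h x) < \<epsilon>"
        unfolding eventually_at using d1(1) d2(1) key by (intro exI[of _ "min d1 d2"]) auto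
    qed
    then show ?case by (simp add: has_field_derivative_iff)
  qed
  then show thesis using that hm h0 h1 dh dh' by blast
qed

section \<open>The phase of the Stieltjes transform\<close>

text \<open>The total mass is pi, so integrals of functions between 0 and 1 against it are angles in
  [0, pi].\<close>

definition poisson :: "real \<Rightarrow> real \<Rightarrow> real \<Rightarrow> real" where
  "poisson u y x = y / ((x - u)\<^sup>2 + y\<^sup>2)"

lemma poisson_nonneg: "y > 0 \<Longrightarrow> 0 \<le> poisson u y x"
  by (simp add: poisson_def)

lemma poisson_measurable[measurable]: "poisson u y \<in> borel_measurable borel"
  unfolding poisson_def[abs_def] by measurable

text \<open>The primitive is arctan ((x - u) / y). The integral over the negative half-line is the
  argument of u + i y; it will cancel the argument contributed by the factor 1 / z.\<close>

lemma poisson_integral: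
  assumes "y > 0"
  shows "integrable lborel (poisson u y)" "(\<integral>x. poisson u y x \<partial>lborel) = pi"
    "(\<integral>x. indicator {..<0} x * poisson u y x \<partial>lborel) = pi / 2 - arctan (u / y)"
proof -
  define A where "A x = arctan ((x - u) / y)" for x
  have der: "DERIV A x :> poisson u y x" for x
  proof -
    have "DERIV A x :> inverse (1 + ((x - u) / y)\<^sup>2) * (1 / y)"
      unfolding A_def using assms by (auto intro!: derivative_eq_intros)
    also have "inverse (1 + ((x - u) / y)\<^sup>2) * (1 / y) = poisson u y x"
    proof -
      have "1 + ((x - u) / y)\<^sup>2 = ((x - u)\<^sup>2 + y\<^sup>2) / y\<^sup>2" using assms by (simp add: power_divide field_simps)
      then show ?thesis using assms by (simp add: poisson_def power2_eq_square)
    qed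
    finally show ?thesis .
  qed
  have cont: "isCont (poisson u y) x" for x
  proof -
    have "(x - u)\<^sup>2 + y\<^sup>2 \<noteq> 0" using assms by (simp add: sum_power2_eq_zero_iff)
    then show ?thesis unfolding poisson_def[abs_def] by (intro continuous_intros)
  qed
  have top: "(A \<longlongrightarrow> pi / 2) at_top"
  proof -
    have "filterlim (\<lambda>x. (x - u) / y) at_top at_top"
      using assms by real_asymp
    then show ?thesis unfolding A_def by (rule filterlim_compose[OF tendsto_arctan_at_top])
  qed
  have bot: "(A \<longlongrightarrow> - (pi / 2)) at_bot"
  proof -
    have "filterlim (\<lambda>x. (x - u) / y) at_bot at_bot"
      using assms by real_asymp
    then show ?thesis unfolding A_def by (rule filterlim_compose[OF tendsto_arctan_at_bot])
  qed
  have zero: "(A \<longlongrightarrow> A 0) (at_left 0)"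
    using der[of 0, THEN DERIV_isCont] by (simp add: isCont_def filterlim_at_split)
  note F = interval_integral_FTC_nonneg[where F = A and f = "poisson u y"]
  have l1: "((A \<circ> real_of_ereal) \<longlongrightarrow> - (pi / 2)) (at_right (- \<infinity>))"
    using bot by (simp add: ereal_tendsto_simps)
  have l2: "((A \<circ> real_of_ereal) \<longlongrightarrow> pi / 2) (at_left \<infinity>)"
    using top by (simp add: ereal_tendsto_simps)
  have l3: "((A \<circ> real_of_ereal) \<longlongrightarrow> A 0) (at_left (ereal 0))"
    using zero by (simp only: ereal_tendsto_simps)
  have 1: "set_integrable lborel (einterval (- \<infinity>) \<infinity>) (poisson u y)" "(LBINT x=-\<infinity>..\<infinity>. poisson u y x) = pi / 2 - (- (pi / 2))"
    using F[of "-\<infinity>" "\<infinity>", OF _ der cont _ l1 l2] poisson_nonneg[OF assms] by auto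
  have 2: "(LBINT x=-\<infinity>..ereal 0. poisson u y x) = A 0 - (- (pi / 2))"
    using F(2)[of "-\<infinity>" "ereal 0", OF _ der cont _ l1 l3] poisson_nonneg[OF assms] by auto
  show "integrable lborel (poisson u y)" using 1(1) by (simp add: set_integrable_def)
  show "(\<integral>x. poisson u y x \<partial>lborel) = pi"
    using 1(2) by (simp add: interval_lebesgue_integral_def set_lebesgue_integral_def)
  have "einterval (- \<infinity>) (ereal 0) = {..<0}" by (auto simp: einterval_def)
  then have "(\<integral>x. indicator {..<0} x * poisson u y x \<partial>lborel) = A 0 + pi / 2"
    using 2 by (simp add: interval_lebesgue_integral_def set_lebesgue_integral_def)
  also have "A 0 = - arctan (u / y)" by (simp add: A_def arctan_minus)
  finally show "(\<integral>x. indicator {..<0} x * poisson u y x \<partial>lborel) = pi / 2 - arctan (u / y)" by simp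
qed

lemma integrable_mult_poisson:
  assumes "y > 0" "h \<in> borel_measurable borel" "\<And>x. 0 \<le> h x" "\<And>x. h x \<le> (1::real)"
  shows "integrable lborel (\<lambda>x. h x * poisson u y x)"
proof (rule Bochner_Integration.integrable_bound[OF poisson_integral(1)[OF assms(1), of u]])
  show "(\<lambda>x. h x * poisson u y x) \<in> borel_measurable lborel" using assms(2) by measurable
  show "AE x in lborel. norm (h x * poisson u y x) \<le> norm (poisson u y x)"
    using assms poisson_nonneg[OF assms(1)] by (intro AE_I2) (simp add: abs_mult mult_left_le_one_le)
qed

context unit_slope begin

lemma density_integral:
  assumes h[measurable]: "h \<in> borel_measurable borel" and h0: "\<And>x. 0 \<le> h x"
    and d: "density lborel (\<lambda>x. ennreal (h x)) = N" and A[measurable]: "A \<in> sets borel"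
  shows "(\<integral>\<^sup>+x. ennreal (indicator A x * h x) \<partial>lborel) = emeasure N A"
  unfolding d[symmetric] by (subst emeasure_density) (auto intro!: nn_integral_cong simp: indicator_def)

lemma density_integrable:
  assumes h[measurable]: "h \<in> borel_measurable borel" and h0: "\<And>x. 0 \<le> h x"
    and d: "density lborel (\<lambda>x. ennreal (h x)) = N"
    and A: "incseq A" "\<And>n :: nat. A n \<in> sets borel" "\<And>n. emeasure N (A n) \<le> ennreal C"
  shows "integrable lborel (\<lambda>x. indicator (\<Union>n. A n) x * h x)"
proof (rule integrableI_nonneg)
  have [measurable]: "(\<Union>n. A n) \<in> sets borel" using A(2) by auto
  show "(\<lambda>x. indicator (\<Union>n. A n) x * h x) \<in> borel_measurable lborel" by measurable
  have "emeasure N (\<Union>n. A n) = (SUP n. emeasure N (A n))"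
    using A by (intro SUP_emeasure_incseq[symmetric]) auto
  also have "\<dots> \<le> ennreal C" by (intro SUP_least A)
  finally show "(\<integral>\<^sup>+x. ennreal (indicator (\<Union>n. A n) x * h x) \<partial>lborel) < \<infinity>"
    using density_integral[OF h h0 d, of "\<Union>n. A n"] by (simp add: le_less_trans)
qed (use h0 in auto)

text \<open>The counterpart of \<open>cdf_difference_le\<close> for a density: the kernel is at
  least 1 / (2 y) on the window.\<close>

lemma window_le_poisson:
  assumes h[measurable]: "h \<in> borel_measurable borel" and h0: "\<And>x. 0 \<le> h x" and h1: "\<And>x. h x \<le> 1"
    and d: "density lborel (\<lambda>x. ennreal (h x)) = N" and y: "y > 0"
  shows "(q (u + y) - q (u - y)) / y \<le> 2 * (\<integral>x. h x * poisson u y x \<partial>lborel)"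
proof -
  have int: "integrable lborel (\<lambda>x. h x * poisson u y x)" by (rule integrable_mult_poisson) (use assms in auto)
  have "ennreal (q (u + y) - q (u - y)) = (\<integral>\<^sup>+x. ennreal (indicator {u - y..u + y} x * h x) \<partial>lborel)"
    using density_integral[OF h h0 d, of "{u - y..u + y}"] y by (simp add: N_Icc)
  also have "\<dots> \<le> (\<integral>\<^sup>+x. ennreal (2 * y * (h x * poisson u y x)) \<partial>lborel)"
  proof (intro nn_integral_mono ennreal_leI)
    fix x
    show "indicator {u - y..u + y} x * h x \<le> 2 * y * (h x * poisson u y x)"
    proof (cases "x \<in> {u - y..u + y}")
      case True
      then have "(x - u)\<^sup>2 \<le> y\<^sup>2" by (intro abs_le_square_iff[THEN iffD1]) auto
      then have "y / (2 * y\<^sup>2) \<le> poisson u y x"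
        unfolding poisson_def using y by (intro divide_left_mono mult_pos_pos add_nonneg_pos) auto
      then have "1 \<le> 2 * y * poisson u y x" using y by (simp add: power2_eq_square field_simps)
      from mult_left_mono[OF this h0[of x]] show ?thesis using True by (simp add: mult_ac)
    qed (use y h0 poisson_nonneg[OF y] in auto)
  qed
  also have "\<dots> = ennreal (\<integral>x. 2 * y * (h x * poisson u y x) \<partial>lborel)"
    using int h0 y poisson_nonneg[OF y] by (intro nn_integral_eq_integral) auto
  finally have "q (u + y) - q (u - y) \<le> 2 * y * (\<integral>x. h x * poisson u y x \<partial>lborel)"
    using h0 y poisson_nonneg[OF y] by (subst (asm) ennreal_le_iff) (auto intro!: integral_nonneg_AE mult_nonneg_nonneg)
  then show ?thesis using y by (simp add: field_simps)
qed
end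

text \<open>Completeness of Lebesgue measure; it makes the \<open>deriv\<close> in the exponent,
  known almost everywhere, measurable.\<close>

lemma lebesgue_measurable_AE_eq:
  fixes f g :: "'a::euclidean_space \<Rightarrow> 'b::topological_space"
  assumes g: "g \<in> borel_measurable lborel" and ae: "AE x in lebesgue. f x = g x"
  shows "f \<in> borel_measurable lebesgue"
proof (rule measurableI)
  fix A :: "'b set" assume A: "A \<in> sets borel"
  obtain Z where Z: "Z \<in> null_sets lebesgue" "{x. f x \<noteq> g x} \<subseteq> Z"
    using ae by (auto simp: eventually_ae_filter)
  have eq: "f -` A \<inter> space lebesgue = (g -` A - Z) \<union> (f -` A \<inter> Z)" using Z(2) by auto
  have 1: "f -` A \<inter> Z \<in> null_sets lebesgue" by (rule null_sets_completion_subset[OF _ Z(1)]) auto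
  have "g -` A \<inter> space lborel \<in> sets lborel" using g A by (rule measurable_sets)
  then have 2: "g -` A \<in> sets lebesgue" by auto
  show "f -` A \<inter> space lebesgue \<in> sets lebesgue"
    unfolding eq using 1 2 Z(1) by (intro sets.Un sets.Diff) (auto dest: null_setsD2)
qed auto

text \<open>The imaginary part of the exponent is the Poisson integral of the derivative of
  (\<omega> x - |x|) / 2. The part of it that comes from |x| is the argument of z, cancelled by 1 /
  z, and what remains is minus the Poisson integral of h = q'.\<close>

lemma (in real_distribution) limit_shape_phase:
  assumes shape: "is_limit_shape M \<omega>"
    and q_def: "q = (\<lambda>x. (x - \<omega> x) / 2)"
  obtains h where "unit_slope q" "h \<in> borel_measurable borel" "\<And>x. 0 \<le> h x" "\<And>x. h x \<le> 1"
    "density lborel (\<lambda>x. ennreal (h x)) = interval_measure q"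
    "density lborel (\<lambda>x. ennreal (1 - h x)) = interval_measure (\<lambda>x. x - q x)"
    "\<And>u y. y > 0 \<Longrightarrow> \<exists>r>0. stieltjes M (Complex u y) = of_real r * cis (- (\<integral>x. h x * poisson u y x \<partial>lborel))"
proof -
  have lip: "\<bar>\<omega> x - \<omega> y\<bar> \<le> \<bar>x - y\<bar>" for x y
    using shape by (auto simp: is_limit_shape_def lipschitz_on_def dist_real_def)
  have abs_le: "\<bar>x\<bar> \<le> \<omega> x" for x using shape by (auto simp: is_limit_shape_def)
  interpret u: unit_slope q
  proof
    fix x y :: real assume "x \<le> y"
    then show "q x \<le> q y" "q y - q x \<le> y - x" using lip[of x y] by (auto simp: q_def field_simps abs_le_iff)
  qed
  interpret c: unit_slope "\<lambda>x. x - q x" by (rule u.complement)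
  obtain h where h[measurable]: "h \<in> borel_measurable borel" and h0: "\<And>x. 0 \<le> h x" and h1: "\<And>x. h x \<le> 1"
    and d: "density lborel (\<lambda>x. ennreal (h x)) = u.N" and d': "density lborel (\<lambda>x. ennreal (1 - h x)) = c.N"
    and der: "AE x in lebesgue. (q has_real_derivative h x) (at x)"
    using u.derivative_density by blast
  have ih: "integrable lborel (\<lambda>x. indicator (\<Union>n. {0..real n}) x * h x)"
  proof (rule u.density_integrable[OF h h0 d])
    show "incseq (\<lambda>n. {0..real n})" by (auto simp: incseq_def)
    \<comment> \<open>\<omega> n \<ge> n gives q n \<le> 0, so the increment is at most - q 0 =
      \<omega> 0 / 2.\<close>
    show "emeasure u.N {0..real n} \<le> ennreal (\<omega> 0 / 2)" for n
    proof -
      have "q (real n) - q 0 \<le> \<omega> 0 / 2" using abs_le[of "real n"] by (simp add: q_def field_simps)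
      then show ?thesis using u.N_Icc[of 0 "real n"] by (simp only: of_nat_0_le_iff ennreal_leI)
    qed
  qed auto
  have ih': "integrable lborel (\<lambda>x. indicator (\<Union>n. {- real n..0}) x * (1 - h x))"
  proof (rule c.density_integrable[OF _ _ d'])
    show "incseq (\<lambda>n. {- real n..0})" by (auto simp: incseq_def)
    show "emeasure c.N {- real n..0} \<le> ennreal (\<omega> 0 / 2)" for n
    proof -
      have "0 - q 0 - (- real n - q (- real n)) \<le> \<omega> 0 / 2" using abs_le[of "- real n"] by (simp add: q_def field_simps)
      moreover have "- real n \<le> 0" by simp
      ultimately show ?thesis using c.N_Icc[of "- real n" 0] by (simp only: ennreal_leI)
    qed
  qed (use h1 in auto)
  have U: "(\<Union>n. {0..real n}) = {0..}" "(\<Union>n. {- real n..0}) = {..0}"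
  proof -
    have "\<exists>n. - real n \<le> x" for x using real_arch_simple[of "- x"] by (auto simp: minus_le_iff)
    then show "(\<Union>n. {0..real n}) = {0..}" "(\<Union>n. {- real n..0}) = {..0}"
      using real_arch_simple by (auto simp: set_eq_iff)
  qed
  \<comment> \<open>The derivative of (\<omega> x - |x|) / 2: it is - h for x > 0 and 1 - h for x <
    0.\<close>
  define k where "k x = indicator {..<0} x - h x" for x :: real
  have km[measurable]: "k \<in> borel_measurable borel" unfolding k_def[abs_def] by measurable
  have ki: "integrable lborel k"
  proof (rule Bochner_Integration.integrable_bound)
    show "integrable lborel (\<lambda>x. indicator {..0} x * (1 - h x) + indicator {0..} x * h x)"
      using ih ih' unfolding U by (intro Bochner_Integration.integrable_add)
    show "AE x in lborel. norm (k x) \<le> norm (indicator {..0} x * (1 - h x) + indicator {0..} x * h x)"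
      using h0 h1 by (intro AE_I2) (auto simp: k_def indicator_def abs_le_iff intro: order_trans)
  qed measurable
  have dk: "AE x in lebesgue. deriv (\<lambda>t. (\<omega> t - \<bar>t\<bar>) / 2) x = k x"
  proof -
    have "AE x in lebesgue. x \<noteq> (0::real)" by (rule AE_completion) (rule AE_lborel_singleton)
    with der show ?thesis
    proof eventually_elim
      case (elim x)
      have om: "\<omega> t = t - 2 * q t" for t by (simp add: q_def field_simps)
      have "((\<lambda>t. (\<omega> t - \<bar>t\<bar>) / 2) has_real_derivative k x) (at x)"
      proof (cases "x > 0")
        case True
        have "((\<lambda>t. - q t) has_real_derivative k x) (at x)"
          using elim(1) True by (auto simp: k_def intro!: derivative_eq_intros)
        then show ?thesis
          by (rule has_field_derivative_transform_within_open[where S = "{0<..}"]) (use True om in auto)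
      next
        case False
        then have x: "x < 0" using elim by simp
        have "((\<lambda>t. t - q t) has_real_derivative k x) (at x)"
          using elim(1) x by (auto simp: k_def intro!: derivative_eq_intros)
        then show ?thesis
          by (rule has_field_derivative_transform_within_open[where S = "{..<0}"]) (use x om in auto)
      qed
      then show ?case by (rule DERIV_imp_deriv)
    qed
  qed
  have phase: "\<exists>r>0. stieltjes M (Complex u y) = of_real r * cis (- (\<integral>x. h x * poisson u y x \<partial>lborel))"
    if y: "y > 0" for u y
  proof -
    define z where "z = Complex u y"
    define \<Theta> where "\<Theta> = (\<integral>x. h x * poisson u y x \<partial>lborel)"
    define \<theta> where "\<theta> = pi / 2 - arctan (u / y)"
    define f where "f x = 1 / (complex_of_real x - z) * complex_of_real (k x)" for x
    define J where "J = (\<integral>x. f x \<partial>lborel)"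
    have fm[measurable]: "f \<in> borel_measurable borel" unfolding f_def[abs_def] by measurable
    have fi: "integrable lborel f"
    proof (rule Bochner_Integration.integrable_bound)
      show "integrable lborel (\<lambda>x. k x / y)" using ki by simp
      show "AE x in lborel. norm (f x) \<le> norm (k x / y)"
      proof (rule AE_I2)
        fix x
        have "y \<le> norm (complex_of_real x - z)"
          using abs_Im_le_cmod[of "complex_of_real x - z"] y by (simp add: z_def)
        then have "\<bar>k x\<bar> / norm (complex_of_real x - z) \<le> \<bar>k x\<bar> / y" using y by (intro divide_left_mono mult_pos_pos) auto
        then show "norm (f x) \<le> norm (k x / y)" using y by (simp add: f_def norm_mult norm_divide)
      qed
    qed measurable
    have leb: "(\<integral>x. 1 / (complex_of_real x - z) * complex_of_real (deriv (\<lambda>t. (\<omega> t - \<bar>t\<bar>) / 2) x) \<partial>lebesgue) = J"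
    proof -
      have ae: "AE x in lebesgue. 1 / (complex_of_real x - z) * complex_of_real (deriv (\<lambda>t. (\<omega> t - \<bar>t\<bar>) / 2) x) = f x"
        using dk by eventually_elim (simp add: f_def)
      have "(\<integral>x. 1 / (complex_of_real x - z) * complex_of_real (deriv (\<lambda>t. (\<omega> t - \<bar>t\<bar>) / 2) x) \<partial>lebesgue) = (\<integral>x. f x \<partial>lebesgue)"
        using ae fm by (intro integral_cong_AE lebesgue_measurable_AE_eq[OF _ ae] measurable_completion) auto
      also have "\<dots> = J" unfolding J_def using fm by (intro integral_completion) simp
      finally show ?thesis .
    qed
    have G: "stieltjes M z = 1 / z * exp J"
      using shape y leb by (simp add: is_limit_shape_def stieltjes_def z_def)
    have ip: "integrable lborel (\<lambda>x. indicator {..<0} x * poisson u y x)" "integrable lborel (\<lambda>x. h x * poisson u y x)"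
      using y h0 h1 by (auto intro!: integrable_mult_poisson)
    have "Im J = (\<integral>x. Im (f x) \<partial>lborel)" unfolding J_def using fi by simp
    also have "\<dots> = (\<integral>x. indicator {..<0} x * poisson u y x - h x * poisson u y x \<partial>lborel)"
      by (intro Bochner_Integration.integral_cong refl)
        (simp add: f_def k_def z_def poisson_def Im_divide algebra_simps diff_divide_distrib)
    also have "\<dots> = \<theta> - \<Theta>"
      unfolding \<theta>_def \<Theta>_def poisson_integral(3)[OF y, symmetric] using ip by (rule Bochner_Integration.integral_diff)
    finally have ImJ: "Im J = \<theta> - \<Theta>" .
    have zn: "z \<noteq> 0" using y by (auto simp: z_def complex_eq_iff)
    have zcis: "z = of_real (norm z) * cis \<theta>"
    proof -
      have n: "norm z = y * sqrt (1 + (u / y)\<^sup>2)"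
      proof -
        have "u\<^sup>2 + y\<^sup>2 = y\<^sup>2 * (1 + (u / y)\<^sup>2)" using y by (simp add: power_divide field_simps)
        then show ?thesis using y by (simp add: z_def cmod_def real_sqrt_mult)
      qed
      have sq: "sqrt (1 + (u / y)\<^sup>2) > 0" by (simp add: add_pos_nonneg)
      have "cos \<theta> = sin (arctan (u / y))" "sin \<theta> = cos (arctan (u / y))"
        by (simp_all add: \<theta>_def cos_diff sin_diff)
      then have "norm z * cos \<theta> = u" "norm z * sin \<theta> = y"
        using sq y by (simp_all add: n sin_arctan cos_arctan)
      then show ?thesis by (simp add: z_def complex_eq_iff)
    qed
    have "stieltjes M z = of_real (exp (Re J) / norm z) * (cis (\<theta> - \<Theta>) / cis \<theta>)"
      unfolding G using zn by (subst zcis) (simp add: exp_eq_polar ImJ)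
    also have "cis (\<theta> - \<Theta>) / cis \<theta> = cis (- \<Theta>)" by (simp add: cis_divide)
    finally show ?thesis using zn unfolding z_def \<Theta>_def by (intro exI[of _ "exp (Re J) / norm (Complex u y)"]) auto
  qed
  show thesis by (rule that[OF u.unit_slope_axioms h h0 h1 d d' phase])
qed

text \<open>Real nonzero boundary values force the phase to 0 or to pi. Then the Poisson integral of
  h, respectively of 1 - h, tends to 0, and with it the symmetric derivative of q, respectively of x
  - q.\<close>

lemma (in real_distribution) limit_shape_slope:
  assumes shape: "is_limit_shape M \<omega>" and st: "s \<in> {a<..<b}" "t \<in> {a<..<b}"
    and lim: "\<And>u. u \<in> {a<..<b} \<Longrightarrow> ((\<lambda>y. stieltjes M (Complex u y)) \<longlongrightarrow> complex_of_real (c u)) (at_right 0)"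
  shows "(\<And>u. u \<in> {a<..<b} \<Longrightarrow> c u > 0) \<Longrightarrow> \<omega> s - s = \<omega> t - t"
    and "(\<And>u. u \<in> {a<..<b} \<Longrightarrow> c u < 0) \<Longrightarrow> \<omega> s + s = \<omega> t + t"
proof -
  define q where "q = (\<lambda>x. (x - \<omega> x) / 2)"
  obtain h where us: "unit_slope q" and h[measurable]: "h \<in> borel_measurable borel" and h0: "\<And>x. 0 \<le> h x" and h1: "\<And>x. h x \<le> 1"
    and d: "density lborel (\<lambda>x. ennreal (h x)) = interval_measure q"
    and d': "density lborel (\<lambda>x. ennreal (1 - h x)) = interval_measure (\<lambda>x. x - q x)"
    and phase: "\<And>u y. y > 0 \<Longrightarrow> \<exists>r>0. stieltjes M (Complex u y) = of_real r * cis (- (\<integral>x. h x * poisson u y x \<partial>lborel))"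
    by (rule limit_shape_phase[OF shape q_def]) (rule that)
  interpret u: unit_slope q by (rule us)
  interpret c: unit_slope "\<lambda>x. x - q x" by (rule u.complement)
  define \<Theta> where "\<Theta> u y = (\<integral>x. h x * poisson u y x \<partial>lborel)" for u y
  have int: "integrable lborel (\<lambda>x. h x * poisson u y x)" if "y > 0" for u y
    using that h0 h1 by (intro integrable_mult_poisson) auto
  have \<Theta>c: "(\<integral>x. (1 - h x) * poisson u y x \<partial>lborel) = pi - \<Theta> u y" if "y > 0" for u y
    using int[OF that] poisson_integral(1,2)[OF that] by (simp add: left_diff_distrib \<Theta>_def)
  have \<Theta>0: "0 \<le> \<Theta> u y" if "y > 0" for u y
    unfolding \<Theta>_def using h0 poisson_nonneg[OF that] by (intro integral_nonneg_AE) auto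
  have \<Theta>1: "\<Theta> u y \<le> pi" if "y > 0" for u y
  proof -
    have "0 \<le> (\<integral>x. (1 - h x) * poisson u y x \<partial>lborel)"
      using h1 poisson_nonneg[OF that] by (intro integral_nonneg_AE) (auto intro!: AE_I2 mult_nonneg_nonneg)
    then show ?thesis using \<Theta>c[OF that] by simp
  qed
  \<comment> \<open>Since \<Theta> stays in [0, pi] it is determined by its cosine, which leaves no
    ambiguity by multiples of 2 pi.\<close>
  have \<Theta>lim: "((\<lambda>y. \<Theta> u y) \<longlongrightarrow> arccos (sgn (c u))) (at_right 0)" if u: "u \<in> {a<..<b}" and cu: "c u \<noteq> 0" for u
  proof -
    have L1: "((\<lambda>y. Re (stieltjes M (Complex u y)) / norm (stieltjes M (Complex u y))) \<longlongrightarrow>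
        Re (complex_of_real (c u)) / norm (complex_of_real (c u))) (at_right 0)"
      using lim[OF u] cu by (intro tendsto_intros) auto
    have L2: "Re (complex_of_real (c u)) / norm (complex_of_real (c u)) = sgn (c u)" using cu by (auto simp: sgn_if)
    have L3: "\<forall>\<^sub>F y in at_right 0. Re (stieltjes M (Complex u y)) / norm (stieltjes M (Complex u y)) = cos (\<Theta> u y)"
      using eventually_at_right_less
    proof eventually_elim
      case (elim y)
      then obtain r where "r > 0" "stieltjes M (Complex u y) = of_real r * cis (- \<Theta> u y)" using phase unfolding \<Theta>_def by blast
      then show ?case by (simp add: norm_mult)
    qed
    have "((\<lambda>y. cos (\<Theta> u y)) \<longlongrightarrow> sgn (c u)) (at_right 0)"
      using Lim_transform_eventually[OF L1 L3] unfolding L2 .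
    then have "((\<lambda>y. arccos (cos (\<Theta> u y))) \<longlongrightarrow> arccos (sgn (c u))) (at_right 0)"
      by (intro continuous_on_tendsto_compose[OF continuous_on_arccos']) (auto simp: sgn_if)
    moreover have "\<forall>\<^sub>F y in at_right 0. arccos (cos (\<Theta> u y)) = \<Theta> u y"
      using eventually_at_right_less by eventually_elim (simp add: arccos_cos \<Theta>0 \<Theta>1)
    ultimately show ?thesis by (rule Lim_transform_eventually)
  qed
  show "\<omega> s - s = \<omega> t - t" if pos: "\<And>u. u \<in> {a<..<b} \<Longrightarrow> c u > 0"
  proof -
    have "q s = q t"
    proof (rule mono_symmetric_derivative_0_const[OF _ st])
      show "mono q" using u.q_mono by (auto simp: mono_def)
      fix x assume x: "x \<in> {a<..<b}"
      show "((\<lambda>y. (q (x + y) - q (x - y)) / y) \<longlongrightarrow> 0) (at_right 0)"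
      proof (rule tendsto_sandwich)
        show "\<forall>\<^sub>F y in at_right 0. 0 \<le> (q (x + y) - q (x - y)) / y"
          using eventually_at_right_less by eventually_elim (auto intro!: divide_nonneg_pos u.q_mono)
        show "\<forall>\<^sub>F y in at_right 0. (q (x + y) - q (x - y)) / y \<le> 2 * \<Theta> x y"
          using eventually_at_right_less by eventually_elim (unfold \<Theta>_def, rule u.window_le_poisson[OF h h0 h1 d])
        have "((\<lambda>y. 2 * \<Theta> x y) \<longlongrightarrow> 2 * arccos (sgn (c x))) (at_right 0)"
          using \<Theta>lim[OF x] pos[OF x] by (intro tendsto_intros) auto
        then show "((\<lambda>y. 2 * \<Theta> x y) \<longlongrightarrow> 0) (at_right 0)" using pos[OF x] by simp
      qed simp
    qed
    then show ?thesis by (simp add: q_def)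
  qed
  show "\<omega> s + s = \<omega> t + t" if neg: "\<And>u. u \<in> {a<..<b} \<Longrightarrow> c u < 0"
  proof -
    have "s - q s = t - q t"
    proof (rule mono_symmetric_derivative_0_const[OF _ st])
      show "mono (\<lambda>x. x - q x)" using c.q_mono by (auto simp: mono_def)
      fix x assume x: "x \<in> {a<..<b}"
      show "((\<lambda>y. (x + y - q (x + y) - (x - y - q (x - y))) / y) \<longlongrightarrow> 0) (at_right 0)"
      proof (rule tendsto_sandwich)
        show "\<forall>\<^sub>F y in at_right 0. 0 \<le> (x + y - q (x + y) - (x - y - q (x - y))) / y"
          using eventually_at_right_less
        proof eventually_elim
          case (elim y)
          then show ?case using c.q_mono[of "x - y" "x + y"] by (intro divide_nonneg_pos) auto
        qed
        show "\<forall>\<^sub>F y in at_right 0. (x + y - q (x + y) - (x - y - q (x - y))) / y \<le> 2 * (pi - \<Theta> x y)"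
          using eventually_at_right_less
        proof eventually_elim
          case (elim y)
          show ?case unfolding \<Theta>c[OF elim, symmetric]
            using h0 h1 by (intro c.window_le_poisson[OF _ _ _ d' elim]) auto
        qed
        have "((\<lambda>y. 2 * (pi - \<Theta> x y)) \<longlongrightarrow> 2 * (pi - arccos (sgn (c x)))) (at_right 0)"
          using \<Theta>lim[OF x] neg[OF x] by (intro tendsto_intros) auto
        then show "((\<lambda>y. 2 * (pi - \<Theta> x y)) \<longlongrightarrow> 0) (at_right 0)" using neg[OF x] by simp
      qed simp
    qed
    then show ?thesis by (simp add: q_def field_simps)
  qed
qed

section \<open>Local minima and reflection\<close>

text \<open>If some point of A other than t is within g / 2 of t, every other point is at least g
  away from it and hence farther from t.\<close>

lemma separated_imp_gap:
  assumes "g > 0" and sep: "\<And>x y. x \<in> A \<Longrightarrow> y \<in> A \<Longrightarrow> x < y \<Longrightarrow> g \<le> y - x"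
  shows "\<exists>\<delta>>0. \<forall>s\<in>A. s \<noteq> t \<longrightarrow> 2 * \<delta> \<le> \<bar>s - (t::real)\<bar>"
proof (cases "\<exists>s\<in>A. s \<noteq> t \<and> \<bar>s - t\<bar> < g / 2")
  case True
  then obtain s where s: "s \<in> A" "s \<noteq> t" "\<bar>s - t\<bar> < g / 2" by blast
  have "\<bar>s - t\<bar> \<le> \<bar>s' - t\<bar>" if "s' \<in> A" "s' \<noteq> t" for s'
    using sep[OF s(1) that(1)] sep[OF that(1) s(1)] s(3) by (cases s s' rule: linorder_cases) linarith+
  then show ?thesis using s(2) by (intro exI[of _ "\<bar>s - t\<bar> / 2"]) auto
next
  case False
  then show ?thesis using \<open>g > 0\<close> by (intro exI[of _ "g / 4"]) (auto simp: not_less)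
qed

context discrete_distribution begin

lemma support_discrete: "topological_space_class.discrete S"
proof (rule discreteI)
  fix t assume t: "t \<in> S"
  obtain \<delta> where \<delta>: "\<delta> > 0" "\<And>s. s \<in> S \<Longrightarrow> s \<noteq> t \<Longrightarrow> 2 * \<delta> \<le> \<bar>s - t\<bar>" using support_gap[of t] by blast
  have "y = t" if "y \<in> S" "dist t y < \<delta>" for y
    using \<delta>(2)[OF that(1)] that(2) \<delta>(1) by (force simp: dist_real_def)
  then show "t isolated_in S" unfolding isolated_in_dist_Ex_iff using t \<delta>(1) by blast
qed

lemma stieltjes_boundary:
  assumes "u \<notin> S"
  shows "((\<lambda>y. stieltjes M (Complex u y)) \<longlongrightarrow> complex_of_real (Gr u)) (at_right 0)"
proof -
  have "((\<lambda>y. Complex u y) \<longlongrightarrow> Complex u 0) (at_right 0)" by (intro tendsto_intros)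
  then have "filterlim (\<lambda>y. Complex u y) (at (of_real u)) (at_right 0)"
    by (auto simp: filterlim_at complex_of_real_def complex_eq_iff eventually_at_filter)
  from filterlim_compose[OF tendsto_stieltjes_off_support[OF assms] this]
  show ?thesis by (simp add: stieltjes_real[OF assms])
qed

text \<open>At a pole the slope changes from -1 to 1. Elsewhere \<open>Gr\<close> is strictly
  decreasing, so even at a zero it is negative just to the right or positive just to the left, and
  \<omega> falls with slope of modulus 1 in that direction.\<close>

lemma local_minima_limit_shape:
  assumes shape: "is_limit_shape M \<omega>"
  shows "S = local_minima \<omega>"
proof -
  have lip: "\<bar>\<omega> x - \<omega> y\<bar> \<le> \<bar>x - y\<bar>" for x y
    using shape by (auto simp: is_limit_shape_def lipschitz_on_def dist_real_def)
  have up: "\<omega> s - s = \<omega> t - t" if "{a<..<b} \<inter> S = {}" "\<And>u. u \<in> {a<..<b} \<Longrightarrow> Gr u > 0" "s \<in> {a<..<b}" "t \<in> {a<..<b}" for a b s t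
    by (rule limit_shape_slope(1)[OF shape that(3,4), of Gr]) (use that stieltjes_boundary in \<open>auto simp: disjoint_iff\<close>)
  have down: "\<omega> s + s = \<omega> t + t" if "{a<..<b} \<inter> S = {}" "\<And>u. u \<in> {a<..<b} \<Longrightarrow> Gr u < 0" "s \<in> {a<..<b}" "t \<in> {a<..<b}" for a b s t
    by (rule limit_shape_slope(2)[OF shape that(3,4), of Gr]) (use that stieltjes_boundary in \<open>auto simp: disjoint_iff\<close>)
  have "x \<in> local_minima \<omega>" if "x \<in> S" for x
  proof -
    obtain \<delta> where \<delta>: "\<delta> > 0" "{x - \<delta><..<x + \<delta>} \<inter> S = {x}"
      "\<And>u. x - \<delta> < u \<Longrightarrow> u < x \<Longrightarrow> Gr u < 0" "\<And>u. x < u \<Longrightarrow> u < x + \<delta> \<Longrightarrow> Gr u > 0"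
      by (rule Gr_near_pole[OF \<open>x \<in> S\<close>]) (rule that)
    have iso: "u \<notin> S" if "x - \<delta> < u" "u < x + \<delta>" "u \<noteq> x" for u using \<delta>(2) that by (auto simp: set_eq_iff)
    have "\<omega> x \<le> \<omega> y" if y: "dist y x < \<delta>" for y
    proof -
      \<comment> \<open>The slope is known only on open intervals excluding x; the Lipschitz bound
        covers the half from x to m, the exact slope the half from m to y.\<close>
      define m where "m = (x + y) / 2"
      consider "y = x" | "x < y" | "y < x" by linarith
      then show ?thesis
      proof cases
        case 2
        have "\<omega> y - y = \<omega> m - m"
          by (rule up[of x "x + \<delta>"]) (use 2 y iso \<delta> in \<open>auto simp: m_def dist_real_def disjoint_iff\<close>)
        moreover have "\<bar>\<omega> x - \<omega> m\<bar> \<le> (y - x) / 2" using lip[of x m] 2 by (simp add: m_def field_simps)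
        moreover have "y - m = (y - x) / 2" by (simp add: m_def field_simps)
        ultimately show ?thesis by linarith
      next
        case 3
        have "\<omega> y + y = \<omega> m + m"
          by (rule down[of "x - \<delta>" x]) (use 3 y iso \<delta> in \<open>auto simp: m_def dist_real_def disjoint_iff\<close>)
        moreover have "\<bar>\<omega> x - \<omega> m\<bar> \<le> (x - y) / 2" using lip[of x m] 3 by (simp add: m_def field_simps)
        moreover have "m - y = (x - y) / 2" by (simp add: m_def field_simps)
        ultimately show ?thesis by linarith
      qed simp
    qed
    then show ?thesis unfolding local_minima_def eventually_nhds_metric using \<delta>(1) by blast
  qed
  moreover have "x \<notin> local_minima \<omega>" if "x \<notin> S" for x
  proof
    assume "x \<in> local_minima \<omega>"
    then obtain d where d: "d > 0" "\<And>y. dist y x < d \<Longrightarrow> \<omega> x \<le> \<omega> y"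
      unfolding local_minima_def eventually_nhds_metric by auto
    obtain \<delta>0 where \<delta>0: "\<delta>0 > 0" "\<And>s. s \<in> S \<Longrightarrow> s \<noteq> x \<Longrightarrow> 2 * \<delta>0 \<le> \<bar>s - x\<bar>" using support_gap[of x] by blast
    define \<delta> where "\<delta> = min d \<delta>0"
    have \<delta>: "\<delta> > 0" "\<delta> \<le> d" "2 * \<delta> \<le> 2 * \<delta>0" using d(1) \<delta>0(1) by (auto simp: \<delta>_def)
    have off: "u \<notin> S" if "\<bar>u - x\<bar> < 2 * \<delta>" for u
    proof
      assume "u \<in> S"
      then have "u \<noteq> x" using \<open>x \<notin> S\<close> by blast
      then show False using \<delta>0(2)[OF \<open>u \<in> S\<close>] that \<delta>(3) by linarith
    qed
    show False
    proof (cases "Gr x \<le> 0")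
      case True
      have neg: "Gr u < 0" if "u \<in> {x<..<x + \<delta>}" for u
      proof -
        have "Gr u < Gr x" using that off by (intro Gr_strict_decreasing) (auto simp: disjoint_iff)
        then show ?thesis using True by linarith
      qed
      \<comment> \<open>A fall of 3/8 \<delta> against a possible rise of at most \<delta> / 8
        between x and x + \<delta> / 8.\<close>
      have "\<omega> (x + \<delta> / 2) + (x + \<delta> / 2) = \<omega> (x + \<delta> / 8) + (x + \<delta> / 8)"
        using \<delta>(1) off neg by (intro down[of x "x + \<delta>"]) (auto simp: disjoint_iff)
      moreover have "\<bar>\<omega> (x + \<delta> / 8) - \<omega> x\<bar> \<le> \<delta> / 8" using lip[of "x + \<delta> / 8" x] \<delta>(1) by simp
      moreover have "\<omega> x \<le> \<omega> (x + \<delta> / 2)" using d(2)[of "x + \<delta> / 2"] \<delta> by (simp add: dist_real_def)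
      ultimately show False using \<delta>(1) by linarith
    next
      case False
      have pos: "Gr u > 0" if "u \<in> {x - \<delta><..<x}" for u
      proof -
        have "Gr x < Gr u" using that off by (intro Gr_strict_decreasing) (auto simp: disjoint_iff)
        then show ?thesis using False by linarith
      qed
      have "\<omega> (x - \<delta> / 2) - (x - \<delta> / 2) = \<omega> (x - \<delta> / 8) - (x - \<delta> / 8)"
        using \<delta>(1) off pos by (intro up[of "x - \<delta>" x]) (auto simp: disjoint_iff)
      moreover have "\<bar>\<omega> (x - \<delta> / 8) - \<omega> x\<bar> \<le> \<delta> / 8" using lip[of "x - \<delta> / 8" x] \<delta>(1) by simp
      moreover have "\<omega> x \<le> \<omega> (x - \<delta> / 2)" using d(2)[of "x - \<delta> / 2"] \<delta> by (simp add: dist_real_def)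
      ultimately show False using \<delta>(1) by linarith
    qed
  qed
  ultimately show ?thesis by blast
qed
end

text \<open>The weight of a step with height increment d is multiplied by (-1)^(d+1), for d = -1 and
  d = 0 as well; over l steps from i down to 0 this gives (-1)^(l-i).\<close>

lemma luk_sum_reflect:
  "luk_sum (- g) (\<lambda>j. (-1) ^ (j - 1) * v j) l i = (-1) ^ (l + i) * luk_sum g v l i"
proof (induction l arbitrary: i)
  case (Suc l)
  have up: "(\<Sum>k=1..l. (-1) ^ (k - 1) * v k * ((-1) ^ (l + (i + k)) * luk_sum g v l (i + k))) =
      (-1) ^ (Suc l + i) * (\<Sum>k=1..l. v k * luk_sum g v l (i + k))"
    unfolding sum_distrib_left
  proof (intro sum.cong refl)
    fix k assume "k \<in> {1..l}"
    then obtain m where k: "k = Suc m" by (cases k) auto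
    have "(-1 :: real) ^ m * (-1) ^ m = 1" by (simp flip: power_add mult_2)
    then show "(-1) ^ (k - 1) * v k * ((-1) ^ (l + (i + k)) * luk_sum g v l (i + k)) =
        (-1) ^ (Suc l + i) * (v k * luk_sum g v l (i + k))"
      by (simp add: k power_add mult_ac)
  qed
  have down: "(if i = 0 then 0 else (-1) ^ (l + (i - 1)) * luk_sum g v l (i - 1)) =
      (-1) ^ (Suc l + i) * (if i = 0 then 0 else luk_sum g v l (i - 1))"
    by (cases i) auto
  show ?case unfolding luk_sum.simps(2) Suc.IH up down by (simp add: algebra_simps)
qed simp

lemma is_mu_reflect:
  assumes "is_mu g v M"
  shows "is_mu (- g) (\<lambda>j. (-1) ^ (j - 1) * v j) (distr M borel uminus)"
proof -
  interpret real_distribution M using assms by (simp add: is_mu_def)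
  have "real_distribution (distr M borel uminus)"
    by (intro real_distribution.intro prob_space_distr real_distribution_axioms.intro) auto
  moreover have "has_bochner_integral (distr M borel uminus) (\<lambda>x. x ^ l)
      (path_moment (- g) (\<lambda>j. (-1) ^ (j - 1) * v j) l)" if "l \<ge> 1" for l
  proof -
    have "has_bochner_integral M (\<lambda>x. (-1) ^ l * x ^ l) ((-1) ^ l * path_moment g v l)"
      using assms that by (intro has_bochner_integral_mult_right) (auto simp: is_mu_def)
    then have "has_bochner_integral M (\<lambda>x. (- x) ^ l) ((-1) ^ l * path_moment g v l)"
      by (simp flip: power_mult_distrib)
    moreover have "path_moment (- g) (\<lambda>j. (-1) ^ (j - 1) * v j) l = (-1) ^ l * path_moment g v l"
      unfolding path_moment_eq_luk_sum luk_sum_reflect by simp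
    ultimately show ?thesis by (simp only:) (intro has_bochner_integral_distr, auto)
  qed
  ultimately show ?thesis by (simp add: is_mu_def)
qed

lemma measure_support_reflect:
  assumes "real_distribution M"
  shows "x \<in> measure_support (distr M borel uminus) \<longleftrightarrow> - x \<in> measure_support M"
proof -
  interpret real_distribution M by fact
  have em: "emeasure (distr M borel uminus) U = emeasure M (uminus ` U)" if "open U" for U
  proof -
    have "emeasure (distr M borel uminus) U = emeasure M (uminus -` U \<inter> space M)" using that by (intro emeasure_distr) auto
    also have "uminus -` U \<inter> space M = uminus ` U" by (auto simp: image_iff) (metis minus_minus)
    finally show ?thesis .
  qed
  have op: "open (uminus ` U)" if "open U" for U :: "real set" using that by (rule open_negations)
  have inv: "uminus ` uminus ` U = U" for U :: "real set" by (auto simp: image_iff)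
  show ?thesis
  proof
    assume x: "x \<in> measure_support (distr M borel uminus)"
    have "emeasure M U > 0" if "open U" "- x \<in> U" for U
    proof -
      have "x \<in> uminus ` U" using that(2) by (auto simp: image_iff intro!: bexI[of _ "- x"])
      then show ?thesis using x op[OF that(1)] em[OF op[OF that(1)]] inv by (auto simp: measure_support_def)
    qed
    then show "- x \<in> measure_support M" by (auto simp: measure_support_def)
  next
    assume "- x \<in> measure_support M"
    then show "x \<in> measure_support (distr M borel uminus)"
      using op by (auto simp: measure_support_def em)
  qed
qed

lemma jack_measureI:
  assumes "totally_jack_positive v" "v 1 = 1" "g > 0" "is_mu g v M"
  shows "jack_measure g v M"
proof -
  interpret real_distribution M using assms by (simp add: is_mu_def)
  show ?thesis
    by unfold_locales (use assms totally_jack_positive_bounds[OF assms(1,2)] in \<open>auto simp: is_mu_def\<close>)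
qed

theorem proposition6p6:
  fixes g :: real and v :: "nat \<Rightarrow> real" and M :: "real measure" and \<omega> :: "real \<Rightarrow> real"
  assumes "admissible g v" and "v 1 = 1"
    and "is_mu g v M"
    and "is_limit_shape M \<omega>"
  shows "topological_space_class.discrete (measure_support M) \<and>
    measure_support M = local_minima \<omega> \<and>
    (g > 0 \<longrightarrow> measure_support M \<subseteq> {- (1 / g)..}) \<and>
    (g < 0 \<longrightarrow> measure_support M \<subseteq> {..- (1 / g)}) \<and>
    (\<forall>x\<in>measure_support M. \<forall>y\<in>measure_support M.
       x < y \<and> {x<..<y} \<inter> measure_support M = {} \<longrightarrow> \<bar>g\<bar> \<le> y - x)"
proof -
  have rd: "real_distribution M" using assms(3) by (simp add: is_mu_def)
  have "g \<noteq> 0 \<and> (g > 0 \<longrightarrow> measure_support M \<subseteq> {- (1 / g)..}) \<and>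
    (g < 0 \<longrightarrow> measure_support M \<subseteq> {..- (1 / g)}) \<and>
    (\<forall>x\<in>measure_support M. \<forall>y\<in>measure_support M. x < y \<longrightarrow> \<bar>g\<bar> \<le> y - x)"
  proof (cases "g > 0")
    case True
    then interpret jack_measure g v M
      using assms by (intro jack_measureI) (auto simp: admissible_def)
    show ?thesis using True support_ge support_separated by auto
  next
    case False
    then have g: "g < 0" and pos: "totally_jack_positive (\<lambda>j. (-1) ^ (j - 1) * v j)"
      using assms(1) by (auto simp: admissible_def)
    interpret jack_measure "- g" "\<lambda>j. (-1) ^ (j - 1) * v j" "distr M borel uminus"
      using g pos assms by (intro jack_measureI is_mu_reflect) auto
    have refl: "- x \<in> measure_support (distr M borel uminus)" if "x \<in> measure_support M" for x
      using that measure_support_reflect[OF rd, of "- x"] by simp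
    have "x \<le> - (1 / g)" if "x \<in> measure_support M" for x using support_ge[OF refl[OF that]] by simp
    moreover have "- g \<le> y - x" if "x \<in> measure_support M" "y \<in> measure_support M" "x < y" for x y
      using support_separated[OF refl[OF that(2)] refl[OF that(1)]] that(3) by simp
    ultimately show ?thesis using g by auto
  qed
  note sep = this
  \<comment> \<open>The gaps have been carried back to \<open>M\<close> for both signs of g, so
    \<omega> itself is never reflected.\<close>
  interpret discrete_distribution M
  proof (intro discrete_distribution.intro discrete_distribution_axioms.intro rd)
    show "\<exists>\<delta>>0. \<forall>s\<in>measure_support M. s \<noteq> t \<longrightarrow> 2 * \<delta> \<le> \<bar>s - t\<bar>" for t
      by (rule separated_imp_gap[of "\<bar>g\<bar>"]) (use sep in auto)
  qed
  show ?thesis using sep support_discrete local_minima_limit_shape[OF assms(4)] by blast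
qed

end
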